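(* There is a multithreaded algorithm that, given a set of $n$ items stored in increasing order at the leaves of a leaf-based 2-3 tree encoded as a leaf-based red-black tree, and an unsorted batch $I$ of $b$ query items, tags each query item $x$ in $I$ with whether $x$ is in the set and, if so, a direct pointer to the leaf containing $x$, within $O(b\cdot\log n)$ work and $O(\log b\cdot\log n)$ span.
   Context: Items come from a totally ordered set with an $O(1)$-time comparison. A leaf-based 2-3 tree stores items only at its leaves, all leaves have the same depth, and every internal node has $2$ or $3$ children; it is encoded as a leaf-based red-black tree in which black nodes correspond to 2-3 tree nodes and a 3-child node is represented by a black node with one red child. Computation model: asynchronous dynamic multithreading on a parallel pointer machine with queued read-modify-write (QRMW) contention. Memory consists of nodes each with a fixed number of cells holding an integer or a pointer; pointers can only be stored, followed and tested for equality (no pointer arithmetic). Threads can fork threads, join (wait for termination of) a thread, suspend themselves, resume a suspended thread, terminate, create memory nodes, perform integer arithmetic, and perform read-modify-write operations (read, write, test-and-set, fetch-and-add, compare-and-swap) on memory cells, each in $O(1)$ time, except that RMW operations on the same memory cell are FIFO-queued and serviced one per time step, the issuing thread being blocked until its request is serviced. An execution is described by its execution DAG whose nodes are the executed primitive instructions, weighted by the time taken to execute them, and whose edges are the dependencies (program order within a thread, fork, join, resume). Work is the total weight of the DAG and span is the maximum total weight of a directed path. The bounds are required to hold for every execution schedule, asymptotically as $b,n$ grow. A batch of items is stored as a BBT: a full binary tree with items only at its leaves in which at every internal node the heights of the two subtrees differ by at most $1$. *)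

theory Defs
  imports Complex_Main "HOL-Library.Landau_Symbols"
begin

section \<open>The parallel pointer machine\<close>

type_synonym addr = nat   \<comment> \<open>memory nodes\<close>
type_synonym tid = nat    \<comment> \<open>threads\<close>
type_synonym reg = nat
type_synonym label = nat
type_synonym cell = "addr \<times> nat"

text \<open>
  Items are opaque: no instruction does anything with an item except copying it and comparing it
  with another item.  Likewise no instruction computes on an address or on a thread handle.
\<close>

datatype 'a val = Null | Integer int | Ptr addr | Thread tid | Item 'a

type_synonym 'a regs = "reg \<Rightarrow> 'a val"
type_synonym 'a heap = "cell \<Rightarrow> 'a val"

datatype arith = Plus | Minus | Times | Div | Mod

fun arith_val :: "arith \<Rightarrow> int \<Rightarrow> int \<Rightarrow> int" where
  "arith_val Plus i j = i + j"
| "arith_val Minus i j = i - j"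
| "arith_val Times i j = i * j"
| "arith_val Div i j = i div j"
| "arith_val Mod i j = i mod j"

text \<open>In the constructors below a register that receives a result comes first.\<close>

datatype rmw =
    Read reg
  | Write reg
  | Test_And_Set reg
  | Fetch_And_Add reg reg
  | Compare_And_Swap reg reg reg   \<comment> \<open>success flag, expected value, new value\<close>

fun perform :: "rmw \<Rightarrow> 'a regs \<Rightarrow> 'a val \<Rightarrow> 'a regs \<times> 'a val" where
  "perform (Read d) \<rho> v = (\<rho>(d := v), v)"
| "perform (Write s) \<rho> v = (\<rho>, \<rho> s)"
| "perform (Test_And_Set d) \<rho> v = (\<rho>(d := v), Integer 1)"
| "perform (Fetch_And_Add d s) \<rho> v =
     (case (v, \<rho> s) of (Integer i, Integer j) \<Rightarrow> (\<rho>(d := v), Integer (i + j)) | _ \<Rightarrow> (\<rho>, v))"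
| "perform (Compare_And_Swap d e s) \<rho> v =
     (if v = \<rho> e then (\<rho>(d := Integer 1), \<rho> s) else (\<rho>(d := Integer 0), v))"

text \<open>
  Registers and cell offsets occur in instructions only as literals, so a program (a finite list)
  uses a fixed number of registers per thread and a fixed number of cells per memory node.
  A forked thread starts at the given label with a copy of the registers of its parent.
\<close>

datatype instr =
    Set_Null reg
  | Set_Int reg int
  | Move reg reg
  | Arith arith reg reg reg
  | Jump label
  | Jump_Eq reg reg label
  | Jump_Less reg reg label        \<comment> \<open>compares two integers or two items\<close>
  | New reg
  | RMW rmw reg nat                \<comment> \<open>pointer to a memory node, offset of the cell in it\<close>
  | Fork reg label
  | Self reg
  | Join reg
  | Suspend
  | Resume reg
  | Halt

type_synonym program = "instr list"

subsection \<open>Execution DAGs\<close>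

text \<open>
  Node \<open>v\<close> of the DAG is the \<open>v\<close>-th executed instruction; it is recorded as its
  weight together with the set of its immediate predecessors.
\<close>

type_synonym dag = "(nat \<times> nat set) list"

definition dag_edges :: "dag \<Rightarrow> (nat \<times> nat) set" where
  "dag_edges G = {(u, v). v < length G \<and> u \<in> snd (G ! v)}"

definition dag_path :: "dag \<Rightarrow> nat list \<Rightarrow> bool" where
  "dag_path G p \<longleftrightarrow> set p \<subseteq> {..<length G} \<and> successively (\<lambda>u v. (u, v) \<in> dag_edges G) p"

definition dag_work :: "dag \<Rightarrow> nat" where
  "dag_work G = (\<Sum>v<length G. fst (G ! v))"

text \<open>
  Execution only creates edges from older to newer nodes, so there are finitely many paths.
\<close>

definition dag_span :: "dag \<Rightarrow> nat" where
  "dag_span G = Max {(\<Sum>v\<leftarrow>p. fst (G ! v)) | p. dag_path G p}"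

subsection \<open>Configurations and time steps\<close>

datatype status = Ready | Blocked | Suspended | Terminated

text \<open>
  \<open>deps\<close> is the set of DAG nodes on which the next instruction of the thread depends; for a
  terminated thread it consists of its last instruction.
\<close>

record 'a thread =
  pc :: nat
  regs :: "'a regs"
  status :: status
  deps :: "nat set"

text \<open>
  A request consists of the issuing thread, the operation and the time of issue.  Thread handles
  are positions in \<open>threads\<close>.  The memory nodes in existence are those with address below
  \<open>fresh\<close>.
\<close>

type_synonym request = "tid \<times> rmw \<times> nat"

record 'a config =
  threads :: "'a thread list"
  heap :: "'a heap"
  fresh :: addr
  queue :: "cell \<Rightarrow> request list"
  now :: nat
  trace :: dag

definition initial_config :: "'a heap \<Rightarrow> addr \<Rightarrow> 'a regs \<Rightarrow> 'a config" where
  "initial_config h m \<rho> =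
     \<lparr>threads = [\<lparr>pc = 0, regs = \<rho>, status = Ready, deps = {}\<rparr>],
      heap = h, fresh = m, queue = (\<lambda>_. []), now = 0, trace = []\<rparr>"

text \<open>
  A thread whose next instruction has operands of the wrong kind, or whose program counter is
  outside the program, is never enabled.
\<close>

definition enabled :: "program \<Rightarrow> 'a config \<Rightarrow> tid \<Rightarrow> bool" where
  "enabled P c t \<longleftrightarrow>
     t < length (threads c) \<and> status (threads c ! t) = Ready \<and> pc (threads c ! t) < length P \<and>
     (let \<rho> = regs (threads c ! t) in
      case P ! pc (threads c ! t) of
        Arith _ _ r s \<Rightarrow> \<exists>i j. \<rho> r = Integer i \<and> \<rho> s = Integer j
      | Jump_Less r s _ \<Rightarrow>
          (\<exists>i j. \<rho> r = Integer i \<and> \<rho> s = Integer j) \<or> (\<exists>x y. \<rho> r = Item x \<and> \<rho> s = Item y)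
      | RMW _ r _ \<Rightarrow> \<exists>a. \<rho> r = Ptr a
      | Join r \<Rightarrow> \<exists>u. \<rho> r = Thread u \<and> status (threads c ! u) = Terminated
      | Resume r \<Rightarrow> \<exists>u. \<rho> r = Thread u
      | _ \<Rightarrow> True)"

text \<open>
  \<open>finish ps t th c\<close> records an instruction of unit weight with predecessors \<open>ps\<close>, after
  which thread \<open>t\<close> is in state \<open>th\<close>.
\<close>

definition finish :: "nat set \<Rightarrow> tid \<Rightarrow> 'a thread \<Rightarrow> 'a config \<Rightarrow> 'a config" where
  "finish ps t th c =
     c\<lparr>threads := (threads c)[t := th\<lparr>deps := {length (trace c)}\<rparr>],
       trace := trace c @ [(1, ps)]\<rparr>"

fun the_int :: "'a val \<Rightarrow> int" where
  "the_int (Integer i) = i"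
| "the_int _ = 0"

fun the_thread :: "'a val \<Rightarrow> tid" where
  "the_thread (Thread u) = u"
| "the_thread _ = 0"

fun the_addr :: "'a val \<Rightarrow> addr" where
  "the_addr (Ptr a) = a"
| "the_addr _ = 0"

fun val_less :: "'a::linorder val \<Rightarrow> 'a val \<Rightarrow> bool" where
  "val_less (Integer i) (Integer j) \<longleftrightarrow> i < j"
| "val_less (Item x) (Item y) \<longleftrightarrow> x < y"
| "val_less _ _ \<longleftrightarrow> False"

text \<open>
  One instruction of an enabled thread.  An operation on a memory cell is only issued here, and is
  recorded in the DAG when it is serviced.  Resuming a thread that is not suspended has no effect.
\<close>

definition exec :: "program \<Rightarrow> tid \<Rightarrow> 'a::linorder config \<Rightarrow> 'a config" where
  "exec P t c =
     (let th = threads c ! t;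
          \<rho> = regs th;
          ps = deps th;
          next = th\<lparr>pc := Suc (pc th)\<rparr>;
          assign = (\<lambda>d v. finish ps t (next\<lparr>regs := \<rho>(d := v)\<rparr>));
          branch = (\<lambda>b l. finish ps t (if b then th\<lparr>pc := l\<rparr> else next))
      in case P ! pc th of
        Set_Null d \<Rightarrow> assign d Null c
      | Set_Int d i \<Rightarrow> assign d (Integer i) c
      | Move d s \<Rightarrow> assign d (\<rho> s) c
      | Arith f d r s \<Rightarrow> assign d (Integer (arith_val f (the_int (\<rho> r)) (the_int (\<rho> s)))) c
      | Jump l \<Rightarrow> branch True l c
      | Jump_Eq r s l \<Rightarrow> branch (\<rho> r = \<rho> s) l c
      | Jump_Less r s l \<Rightarrow> branch (val_less (\<rho> r) (\<rho> s)) l c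
      | New d \<Rightarrow>
          assign d (Ptr (fresh c))
            (c\<lparr>heap := (\<lambda>(a, i). if a = fresh c then Null else heap c (a, i)),
               fresh := Suc (fresh c)\<rparr>)
      | RMW f r i \<Rightarrow>
          (let x = (the_addr (\<rho> r), i) in
           c\<lparr>threads := (threads c)[t := th\<lparr>status := Blocked\<rparr>],
             queue := (queue c)(x := queue c x @ [(t, f, now c)])\<rparr>)
      | Fork d l \<Rightarrow>
          assign d (Thread (length (threads c)))
            (c\<lparr>threads := threads c @
                 [\<lparr>pc = l, regs = \<rho>, status = Ready, deps = {length (trace c)}\<rparr>]\<rparr>)
      | Self d \<Rightarrow> assign d (Thread t) c
      | Join r \<Rightarrow> finish (ps \<union> deps (threads c ! the_thread (\<rho> r))) t next c
      | Suspend \<Rightarrow> finish ps t (next\<lparr>status := Suspended\<rparr>) c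
      | Resume r \<Rightarrow>
          (let u = the_thread (\<rho> r); uth = threads c ! u in
           finish ps t next
             (if status uth = Suspended
              then c\<lparr>threads := (threads c)
                       [u := uth\<lparr>status := Ready, deps := insert (length (trace c)) (deps uth)\<rparr>]\<rparr>
              else c))
      | Halt \<Rightarrow> finish ps t (th\<lparr>status := Terminated\<rparr>) c)"

text \<open>
  Servicing the first request on cell \<open>x\<close>.  Its weight is the number of time steps from its issue
  to its service, both included; it is 1 in the absence of contention.
\<close>

definition serve :: "cell \<Rightarrow> 'a config \<Rightarrow> 'a config" where
  "serve x c =
     (case queue c x of
        [] \<Rightarrow> c
      | (t, f, s) # rs \<Rightarrow>
          (let th = threads c ! t; (\<rho>, v) = perform f (regs th) (heap c x) in
           c\<lparr>threads := (threads c)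
               [t := th\<lparr>pc := Suc (pc th), regs := \<rho>, status := Ready, deps := {length (trace c)}\<rparr>],
             heap := (heap c)(x := v),
             queue := (queue c)(x := rs),
             trace := trace c @ [(Suc (now c - s), deps th)]\<rparr>))"

text \<open>
  In a time step an arbitrary set of enabled threads (chosen by the schedule, and listed in the
  order in which simultaneous requests arrive) execute one instruction each, and then one request
  is serviced on every cell that has any.  Time steps in which nothing at all happens are left out;
  they would not change any weight.
\<close>

definition step :: "program \<Rightarrow> 'a::linorder config \<Rightarrow> 'a config \<Rightarrow> bool" where
  "step P c c' \<longleftrightarrow>
     (\<exists>ts xs. distinct ts \<and> (\<forall>t\<in>set ts. enabled P c t) \<and>
        (let c1 = fold (exec P) ts c in
         distinct xs \<and> set xs = {x. queue c1 x \<noteq> []} \<and> (ts \<noteq> [] \<or> xs \<noteq> []) \<and>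
         c' = (fold serve xs c1)\<lparr>now := Suc (now c)\<rparr>))"

definition always_terminates :: "program \<Rightarrow> 'a::linorder config \<Rightarrow> bool" where
  "always_terminates P c \<longleftrightarrow> \<not> (\<exists>f. f 0 = c \<and> (\<forall>i. step P (f i) (f (Suc i))))"

definition complete_execution :: "program \<Rightarrow> 'a::linorder config \<Rightarrow> 'a config \<Rightarrow> bool" where
  "complete_execution P c c' \<longleftrightarrow> (step P)\<^sup>*\<^sup>* c c' \<and> \<not> (\<exists>c''. step P c' c'')"

definition all_terminated :: "'a config \<Rightarrow> bool" where
  "all_terminated c \<longleftrightarrow> (\<forall>th\<in>set (threads c). status th = Terminated)"

section \<open>Leaf-based 2-3 trees and their red-black encoding\<close>

datatype 'a tree23 =
    Leaf 'a
  | Node2 "'a tree23" "'a tree23"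
  | Node3 "'a tree23" "'a tree23" "'a tree23"

fun leaves23 :: "'a tree23 \<Rightarrow> 'a list" where
  "leaves23 (Leaf x) = [x]"
| "leaves23 (Node2 s t) = leaves23 s @ leaves23 t"
| "leaves23 (Node3 s t u) = leaves23 s @ leaves23 t @ leaves23 u"

fun leaf_depths :: "'a tree23 \<Rightarrow> nat set" where
  "leaf_depths (Leaf x) = {0}"
| "leaf_depths (Node2 s t) = Suc ` (leaf_depths s \<union> leaf_depths t)"
| "leaf_depths (Node3 s t u) = Suc ` (leaf_depths s \<union> leaf_depths t \<union> leaf_depths u)"

definition is_23_tree :: "'a::linorder tree23 \<Rightarrow> bool" where
  "is_23_tree t \<longleftrightarrow> (\<exists>d. leaf_depths t = {d}) \<and> sorted_wrt (<) (leaves23 t)"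

datatype color = Red | Black

text \<open>
  Red-black trees are annotated with the addresses of their memory nodes.  An inner node also
  carries a routing key, which is only required to separate its two subtrees (so it may be, for
  instance, the greatest item on the left).
\<close>

datatype 'a rbt =
    RB_Leaf addr 'a
  | RB_Node addr color 'a "'a rbt" "'a rbt"

fun rbt_addrs :: "'a rbt \<Rightarrow> addr list" where
  "rbt_addrs (RB_Leaf a x) = [a]"
| "rbt_addrs (RB_Node a c k l r) = a # rbt_addrs l @ rbt_addrs r"

fun rbt_leaves :: "'a rbt \<Rightarrow> (addr \<times> 'a) list" where
  "rbt_leaves (RB_Leaf a x) = [(a, x)]"
| "rbt_leaves (RB_Node a c k l r) = rbt_leaves l @ rbt_leaves r"

fun routed :: "'a::linorder rbt \<Rightarrow> bool" where
  "routed (RB_Leaf a x) \<longleftrightarrow> True"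
| "routed (RB_Node a c k l r) \<longleftrightarrow>
     (\<forall>x\<in>snd ` set (rbt_leaves l). x \<le> k) \<and> (\<forall>x\<in>snd ` set (rbt_leaves r). k < x) \<and>
     routed l \<and> routed r"

inductive encodes :: "'a tree23 \<Rightarrow> 'a rbt \<Rightarrow> bool" where
  "encodes (Leaf x) (RB_Leaf a x)"
| "encodes s s' \<Longrightarrow> encodes t t' \<Longrightarrow> encodes (Node2 s t) (RB_Node a Black k s' t')"
| "encodes s s' \<Longrightarrow> encodes t t' \<Longrightarrow> encodes u u' \<Longrightarrow>
     encodes (Node3 s t u) (RB_Node a Black k (RB_Node a' Red k' s' t') u')"
| "encodes s s' \<Longrightarrow> encodes t t' \<Longrightarrow> encodes u u' \<Longrightarrow>
     encodes (Node3 s t u) (RB_Node a Black k s' (RB_Node a' Red k' t' u'))"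

definition is_rb_encoding :: "'a::linorder rbt \<Rightarrow> bool" where
  "is_rb_encoding R \<longleftrightarrow> routed R \<and> (\<exists>t. is_23_tree t \<and> encodes t R)"

section \<open>Batches\<close>

datatype 'a bbt =
    Query addr 'a
  | Branch addr "'a bbt" "'a bbt"

fun bbt_height :: "'a bbt \<Rightarrow> nat" where
  "bbt_height (Query a x) = 0"
| "bbt_height (Branch a l r) = Suc (max (bbt_height l) (bbt_height r))"

fun is_bbt :: "'a bbt \<Rightarrow> bool" where
  "is_bbt (Query a x) \<longleftrightarrow> True"
| "is_bbt (Branch a l r) \<longleftrightarrow>
     bbt_height l \<le> bbt_height r + 1 \<and> bbt_height r \<le> bbt_height l + 1 \<and> is_bbt l \<and> is_bbt r"

fun bbt_addrs :: "'a bbt \<Rightarrow> addr list" where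
  "bbt_addrs (Query a x) = [a]"
| "bbt_addrs (Branch a l r) = a # bbt_addrs l @ bbt_addrs r"

fun bbt_queries :: "'a bbt \<Rightarrow> (addr \<times> 'a) list" where
  "bbt_queries (Query a x) = [(a, x)]"
| "bbt_queries (Branch a l r) = bbt_queries l @ bbt_queries r"

section \<open>Representation in memory\<close>

abbreviation (input) kind_cell :: nat where "kind_cell \<equiv> 0"   \<comment> \<open>0 for a leaf, 1 otherwise\<close>
abbreviation (input) color_cell :: nat where "color_cell \<equiv> 1"
abbreviation (input) item_cell :: nat where "item_cell \<equiv> 2"
abbreviation (input) left_cell :: nat where "left_cell \<equiv> 3"
abbreviation (input) right_cell :: nat where "right_cell \<equiv> 4"
abbreviation (input) found_cell :: nat where "found_cell \<equiv> 5"
abbreviation (input) link_cell :: nat where "link_cell \<equiv> 6"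

fun color_code :: "color \<Rightarrow> int" where
  "color_code Black = 0"
| "color_code Red = 1"

fun rbt_at :: "'a heap \<Rightarrow> 'a val \<Rightarrow> 'a rbt \<Rightarrow> bool" where
  "rbt_at h p (RB_Leaf a x) \<longleftrightarrow>
     p = Ptr a \<and> h (a, kind_cell) = Integer 0 \<and> h (a, color_cell) = Integer (color_code Black) \<and>
     h (a, item_cell) = Item x"
| "rbt_at h p (RB_Node a c k l r) \<longleftrightarrow>
     p = Ptr a \<and> h (a, kind_cell) = Integer 1 \<and> h (a, color_cell) = Integer (color_code c) \<and>
     h (a, item_cell) = Item k \<and>
     rbt_at h (h (a, left_cell)) l \<and> rbt_at h (h (a, right_cell)) r"

fun bbt_at :: "'a heap \<Rightarrow> 'a val \<Rightarrow> 'a bbt \<Rightarrow> bool" where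
  "bbt_at h p (Query a x) \<longleftrightarrow>
     p = Ptr a \<and> h (a, kind_cell) = Integer 0 \<and> h (a, item_cell) = Item x"
| "bbt_at h p (Branch a l r) \<longleftrightarrow>
     p = Ptr a \<and> h (a, kind_cell) = Integer 1 \<and>
     bbt_at h (h (a, left_cell)) l \<and> bbt_at h (h (a, right_cell)) r"

text \<open>
  A full binary tree and a leaf-based 2-3 tree have at least one leaf; the empty set and the empty
  batch are given as \<open>None\<close> and stored as the pointer \<open>Null\<close>.
\<close>

definition set_leaves :: "'a rbt option \<Rightarrow> (addr \<times> 'a) list" where
  "set_leaves R = (case R of None \<Rightarrow> [] | Some t \<Rightarrow> rbt_leaves t)"

definition batch_queries :: "'a bbt option \<Rightarrow> (addr \<times> 'a) list" where
  "batch_queries B = (case B of None \<Rightarrow> [] | Some t \<Rightarrow> bbt_queries t)"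

definition stored_set :: "'a::linorder heap \<Rightarrow> 'a val \<Rightarrow> 'a rbt option \<Rightarrow> bool" where
  "stored_set h p R \<longleftrightarrow>
     (case R of None \<Rightarrow> p = Null | Some t \<Rightarrow> is_rb_encoding t \<and> rbt_at h p t)"

definition stored_batch :: "'a heap \<Rightarrow> 'a val \<Rightarrow> 'a bbt option \<Rightarrow> bool" where
  "stored_batch h q B \<longleftrightarrow>
     (case B of None \<Rightarrow> q = Null | Some t \<Rightarrow> is_bbt t \<and> bbt_at h q t)"

definition separate :: "addr \<Rightarrow> 'a rbt option \<Rightarrow> 'a bbt option \<Rightarrow> bool" where
  "separate m R B \<longleftrightarrow>
     (let as = (case R of None \<Rightarrow> [] | Some t \<Rightarrow> rbt_addrs t) @
               (case B of None \<Rightarrow> [] | Some t \<Rightarrow> bbt_addrs t)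
      in distinct as \<and> (\<forall>a\<in>set as. a < m))"

definition input_regs :: "'a val \<Rightarrow> 'a val \<Rightarrow> 'a regs" where
  "input_regs p q = (\<lambda>_. Null)(0 := p, 1 := q)"

definition tagged :: "'a heap \<Rightarrow> 'a rbt option \<Rightarrow> 'a bbt option \<Rightarrow> bool" where
  "tagged h R B \<longleftrightarrow>
     (\<forall>(a, x) \<in> set (batch_queries B).
        if x \<in> snd ` set (set_leaves R)
        then h (a, found_cell) = Integer 1 \<and>
             (\<exists>l. (l, x) \<in> set (set_leaves R) \<and> h (a, link_cell) = Ptr l)
        else h (a, found_cell) = Integer 0)"

end

(*
  Descend the tree, starting with the whole batch at the root.  At an inner node with key k, split
  the batch into the queries \<le> k and the queries > k, and search the two subtrees for the two parts
  in parallel; at a leaf, tag all remaining queries.  A batch tree is split recursively and in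
  parallel, and a branch one side of which became empty is contracted.  So the parts are full binary
  trees again, with as many leaves in total as before and never higher than the original batch;
  no rebalancing is needed.  Thus every level of the search tree costs O(b) work and O(log b) span.
  Different threads never access the same memory node at the same time, so no request ever waits.

  The bounds for all schedules come from a separation logic for fork and join: every thread owns a
  part of the memory, hands over a part of it to a thread that it forks, and receives the memory of
  a thread that it joins.
*)

theory Submission
  imports Defs
begin

text \<open>Exclusive ownership also settles the costs. Without waiting, every DAG node has weight
  1, so work is the number of executed instructions and span the number of nodes on a path. Both are
  budgeted in the same judgement as correctness: a fork sets aside the whole work budget of the
  child, and a join continues from the larger of the two depths. Instructions executed plus budgets
  left never grow, and every time step executes something, so the work bound is at the same time a
  termination proof for all schedules. The obstacle on the side of the algorithm is that the input
  has to come out intact although threads return results through memory and restructure batches.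
  Hence the cells 0 to 4 of old nodes are read-only, the parts of a batch are returned in the cells
  7 and 8, and the branches that join two non-empty parts are new nodes. The leaves of the parts are
  the original query nodes, so the tags end up in the input batch.\<close>

section \<open>Thread-local reasoning\<close>

text \<open>
  A token records what a thread may assume after joining a child: the postcondition on the memory
  owned by the child, and a bound on the DAG depth of its last instruction.
\<close>

type_synonym 'a frag = "addr \<rightharpoonup> (nat \<Rightarrow> 'a val)"
type_synonym 'a tokens = "tid \<rightharpoonup> ('a frag \<Rightarrow> bool) \<times> nat"

text \<open>Covers instructions that act only on the label and registers of the thread. A comparison
  of operands of different kinds gives \<open>None\<close>, so a safe thread is never stuck on one.
  \<open>Suspend\<close> and \<open>Resume\<close> are left out, so that threads influence each
  other's status only through forks and joins.\<close>

definition local_step ::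
  "instr \<Rightarrow> label \<Rightarrow> 'a::linorder regs \<Rightarrow> (label \<times> 'a regs) option" where
  "local_step i l \<rho> =
     (case i of
        Set_Null d \<Rightarrow> Some (Suc l, \<rho>(d := Null))
      | Set_Int d j \<Rightarrow> Some (Suc l, \<rho>(d := Integer j))
      | Move d s \<Rightarrow> Some (Suc l, \<rho>(d := \<rho> s))
      | Jump l' \<Rightarrow> Some (l', \<rho>)
      | Jump_Eq r s l' \<Rightarrow> Some (if \<rho> r = \<rho> s then l' else Suc l, \<rho>)
      | Jump_Less r s l' \<Rightarrow>
          (case (\<rho> r, \<rho> s) of
             (Item x, Item y) \<Rightarrow> Some (if x < y then l' else Suc l, \<rho>)
           | (Integer x, Integer y) \<Rightarrow> Some (if x < y then l' else Suc l, \<rho>)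
           | _ \<Rightarrow> None)
      | _ \<Rightarrow> None)"

text \<open>
  \<open>safe P m E K Q l \<rho> h tok d k\<close>: a thread at label \<open>l\<close> with registers \<open>\<rho>\<close> that owns the memory
  \<open>h\<close> and holds the tokens \<open>tok\<close> terminates with its memory satisfying \<open>Q\<close>.  It has reached
  depth \<open>d\<close>, relative to its start, and will not exceed depth \<open>E\<close>; together with the threads it
  forks it has spent \<open>k\<close> units of work and will not exceed \<open>K\<close>.  The cells 0 to 4 of the addresses
  below \<open>m\<close>, which hold the input, are never changed.
\<close>

inductive safe :: "program \<Rightarrow> addr \<Rightarrow> nat \<Rightarrow> nat \<Rightarrow> ('a::linorder frag \<Rightarrow> bool) \<Rightarrow>
    label \<Rightarrow> 'a regs \<Rightarrow> 'a frag \<Rightarrow> 'a tokens \<Rightarrow> nat \<Rightarrow> nat \<Rightarrow> bool" for P m where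
  safe_local: "l < length P \<Longrightarrow> local_step (P ! l) l \<rho> = Some (l', \<rho>') \<Longrightarrow>
    safe P m E K Q l' \<rho>' h tok (Suc d) (Suc k) \<Longrightarrow> safe P m E K Q l \<rho> h tok d k"
| safe_rmw: "l < length P \<Longrightarrow> P ! l = RMW f r i \<Longrightarrow> \<rho> r = Ptr a \<Longrightarrow> h a = Some g \<Longrightarrow>
    perform f \<rho> (g i) = (\<rho>', v) \<Longrightarrow> v = g i \<or> 5 \<le> i \<or> m \<le> a \<Longrightarrow>
    safe P m E K Q (Suc l) \<rho>' (h(a \<mapsto> g(i := v))) tok (Suc d) (Suc k) \<Longrightarrow>
    safe P m E K Q l \<rho> h tok d k"
| safe_new: "l < length P \<Longrightarrow> P ! l = New r \<Longrightarrow> d < E \<Longrightarrow> k < K \<Longrightarrow>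
    (\<And>a. m \<le> a \<Longrightarrow> a \<notin> dom h \<Longrightarrow>
      safe P m E K Q (Suc l) (\<rho>(r := Ptr a)) (h(a \<mapsto> (\<lambda>_. Null))) tok (Suc d) (Suc k)) \<Longrightarrow>
    safe P m E K Q l \<rho> h tok d k"
| safe_fork: "l < length P \<Longrightarrow> P ! l = Fork r l' \<Longrightarrow>
    safe P m E' K' Q' l' \<rho> (h |` A) Map.empty 0 0 \<Longrightarrow> Suc d + E' < E \<Longrightarrow> Suc k + K' < K \<Longrightarrow>
    (\<And>u. u \<notin> dom tok \<Longrightarrow>
      safe P m E K Q (Suc l) (\<rho>(r := Thread u)) (h |` (- A)) (tok(u \<mapsto> (Q', Suc d + E')))
        (Suc d) (Suc k + K')) \<Longrightarrow>
    safe P m E K Q l \<rho> h tok d k"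
| safe_join: "l < length P \<Longrightarrow> P ! l = Join r \<Longrightarrow> \<rho> r = Thread u \<Longrightarrow> tok u = Some (Q', e) \<Longrightarrow> max d e < E \<Longrightarrow> k < K \<Longrightarrow>
    (\<And>h'. Q' h' \<Longrightarrow> dom h' \<inter> dom h = {} \<Longrightarrow>
      safe P m E K Q (Suc l) \<rho> (h ++ h') (tok(u := None)) (Suc (max d e)) (Suc k)) \<Longrightarrow>
    safe P m E K Q l \<rho> h tok d k"
| safe_halt: "l < length P \<Longrightarrow> P ! l = Halt \<Longrightarrow> Q h \<Longrightarrow> d < E \<Longrightarrow> k < K \<Longrightarrow>
    safe P m E K Q l \<rho> h tok d k"

text \<open>The budgets \<open>E\<close> and \<open>K\<close> stay fixed, so having used less of
  them leaves more room. The tokens have to vary too: a fork records the end of the child relative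
  to the current depth, which is smaller in the better situation.\<close>

lemma safe_mono:
  assumes "safe P m E K Q l \<rho> h tok d k"
  shows "d' \<le> d \<Longrightarrow> k' \<le> k \<Longrightarrow> (\<And>u. tok' u = None \<longleftrightarrow> tok u = None) \<Longrightarrow>
    (\<And>u Q' e. tok u = Some (Q', e) \<Longrightarrow> \<exists>e'\<le>e. tok' u = Some (Q', e')) \<Longrightarrow>
    safe P m E K Q l \<rho> h tok' d' k'"
  using assms
proof (induction arbitrary: d' k' tok' rule: safe.induct)
  case (safe_local l \<rho> l' \<rho>' E K Q h tok d k)
  show ?case
    by (rule safe.safe_local[OF safe_local.hyps(1,2)], rule safe_local.IH)
      (use safe_local.prems in auto)
next
  case (safe_rmw l f r i \<rho> a h g \<rho>' v E K Q tok d k)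
  show ?case
    by (rule safe.safe_rmw[where h = h and g = g and \<rho> = \<rho> and v = v, OF safe_rmw.hyps(1-6)],
        rule safe_rmw.IH) (use safe_rmw.prems in auto)
next
  case (safe_new l r d E k K h Q \<rho> tok)
  show ?case
    by (rule safe.safe_new[OF safe_new.hyps(1,2)])
      (use safe_new.prems safe_new.hyps in \<open>auto intro!: safe_new.IH\<close>)
next
  case (safe_fork l r l' E' K' Q' \<rho> h A d E k K tok Q)
  show ?case
  proof (rule safe.safe_fork[OF safe_fork.hyps(1-3)])
    show "Suc d' + E' < E" "Suc k' + K' < K" using safe_fork by simp_all
    show "safe P m E K Q (Suc l) (\<rho>(r := Thread u)) (h |` (- A)) (tok'(u \<mapsto> (Q', Suc d' + E')))
        (Suc d') (Suc k' + K')" if "u \<notin> dom tok'" for u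
    proof -
      have "tok u = None" using that safe_fork.prems(3) by (metis domIff)
      then show ?thesis
        by (intro safe_fork.IH(2)) (use safe_fork.prems in \<open>auto split: if_splits\<close>)
    qed
  qed
next
  case (safe_join l r \<rho> u tok Q' e d E k K h Q)
  then obtain e' where e': "tok' u = Some (Q', e')" "e' \<le> e" by blast
  show ?case
  proof (rule safe.safe_join[where h = h and \<rho> = \<rho> and tok = tok',
        OF safe_join.hyps(1-3) e'(1)])
    show "max d' e' < E" "k' < K" using safe_join.hyps safe_join.prems e' by auto
    show "safe P m E K Q (Suc l) \<rho> (h ++ h') (tok'(u := None)) (Suc (max d' e')) (Suc k')"
      if "Q' h'" "dom h' \<inter> dom h = {}" for h'
      by (rule safe_join.IH[OF that]) (use safe_join.prems e' in \<open>auto split: if_splits\<close>)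
  qed
next
  case (safe_halt l Q h d E k K \<rho> tok)
  then show ?case by (auto intro: safe.safe_halt)
qed

text \<open>Strict, because halting is itself an instruction that has to be paid for.\<close>

lemma safe_bounds: "safe P m E K Q l \<rho> h tok d k \<Longrightarrow> d < E \<and> k < K"
  by (induction rule: safe.induct) auto

section \<open>Soundness\<close>

text \<open>
  Ghost state of a thread.  \<open>start\<close> is the absolute depth to which \<open>depth\<close>, \<open>max_depth\<close> and the
  depths in \<open>tokens\<close> are relative.  In the invariant, \<open>\<delta> v\<close> bounds the weight of the paths to the
  DAG node \<open>v\<close>.
\<close>

record 'a ghost =
  owned :: "'a frag"
  tokens :: "'a tokens"
  start :: nat
  depth :: nat
  max_depth :: nat
  work :: nat
  max_work :: nat
  post :: "'a frag \<Rightarrow> bool"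

text \<open>A blocked thread is described by the state in which it issued its request, as the
  operation takes effect only when serviced. A terminated thread keeps its memory for the thread
  that joins it, and of its last instruction only the promised bound \<open>max_depth\<close> is
  remembered.\<close>

definition thread_inv ::
  "program \<Rightarrow> addr \<Rightarrow> nat \<Rightarrow> (nat \<Rightarrow> nat) \<Rightarrow> 'a::linorder thread \<Rightarrow> 'a ghost \<Rightarrow> bool" where
  "thread_inv P m L \<delta> th g \<longleftrightarrow>
     deps th \<subseteq> {..<L} \<and> status th \<noteq> Suspended \<and>
     (if status th = Terminated
      then post g (owned g) \<and> (\<forall>v\<in>deps th. \<delta> v \<le> start g + max_depth g)
      else safe P m (max_depth g) (max_work g) (post g) (pc th) (regs th) (owned g) (tokens g)
             (depth g) (work g) \<and> (\<forall>v\<in>deps th. \<delta> v \<le> start g + depth g))"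

text \<open>Owned addresses lie below the allocation bound \<open>b\<close>, so a new node belongs
  to nobody yet.\<close>

definition heap_inv ::
  "addr \<Rightarrow> 'a heap \<Rightarrow> nat \<Rightarrow> (tid \<Rightarrow> 'a ghost) \<Rightarrow> 'a heap \<Rightarrow> addr \<Rightarrow> bool" where
  "heap_inv m h\<^sub>0 n G h b \<longleftrightarrow>
     m \<le> b \<and> (\<forall>a<m. \<forall>i<5. h (a, i) = h\<^sub>0 (a, i)) \<and>
     (\<forall>t<n. \<forall>a g. owned (G t) a = Some g \<longrightarrow> a < b \<and> (\<forall>i. h (a, i) = g i)) \<and>
     (\<forall>t<n. \<forall>t'<n. t \<noteq> t' \<longrightarrow> dom (owned (G t)) \<inter> dom (owned (G t')) = {})"

text \<open>The order \<open>t < u\<close> says that a thread waits only for threads created after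
  it, which excludes deadlock. The unique holder of a token ensures that the memory of a child is
  handed over at most once.\<close>

definition token_inv :: "nat \<Rightarrow> (tid \<Rightarrow> 'a ghost) \<Rightarrow> bool" where
  "token_inv n G \<longleftrightarrow>
     (\<forall>t<n. \<forall>u Q e. tokens (G t) u = Some (Q, e) \<longrightarrow>
        t < u \<and> u < n \<and> post (G u) = Q \<and> start (G u) + max_depth (G u) \<le> start (G t) + e \<and>
        (\<forall>t'<n. u \<in> dom (tokens (G t')) \<longrightarrow> t' = t))"

definition pending :: "program \<Rightarrow> 'a thread \<Rightarrow> rmw \<Rightarrow> cell \<Rightarrow> bool" where
  "pending P th f x \<longleftrightarrow> status th = Blocked \<and>
     (\<exists>r. P ! pc th = RMW f r (snd x) \<and> regs th r = Ptr (fst x))"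

text \<open>No queue is longer than 1, and \<open>s\<close> is the current time; so the weight
  \<open>Suc (now c - s)\<close> of a serviced request is 1.\<close>

definition queue_inv ::
  "program \<Rightarrow> 'a thread list \<Rightarrow> (cell \<Rightarrow> request list) \<Rightarrow> nat \<Rightarrow> bool" where
  "queue_inv P ths q s \<longleftrightarrow>
     (\<forall>x. q x = [] \<or> (\<exists>t<length ths. \<exists>f. q x = [(t, f, s)] \<and> pending P (ths ! t) f x)) \<and>
     (\<forall>t<length ths. status (ths ! t) = Blocked \<longrightarrow> (\<exists>x f. q x = [(t, f, s)]))"

definition dag_inv :: "nat \<Rightarrow> (nat \<Rightarrow> nat) \<Rightarrow> dag \<Rightarrow> bool" where
  "dag_inv S \<delta> G \<longleftrightarrow>
     (\<forall>v<length G. fst (G ! v) = 1 \<and> snd (G ! v) \<subseteq> {..<v} \<and> (\<forall>u\<in>snd (G ! v). \<delta> u < \<delta> v) \<and>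
        0 < \<delta> v \<and> \<delta> v \<le> S)"

definition remaining :: "'a ghost \<Rightarrow> nat" where
  "remaining g = max_work g - work g"

definition config_inv ::
  "program \<Rightarrow> addr \<Rightarrow> nat \<Rightarrow> nat \<Rightarrow> ('a frag \<Rightarrow> bool) \<Rightarrow> 'a heap \<Rightarrow> 'a::linorder config \<Rightarrow>
     (tid \<Rightarrow> 'a ghost) \<Rightarrow> (nat \<Rightarrow> nat) \<Rightarrow> bool" where
  "config_inv P m S W Q h\<^sub>0 c G \<delta> \<longleftrightarrow>
     threads c \<noteq> [] \<and> post (G 0) = Q \<and>
     (\<forall>t<length (threads c). thread_inv P m (length (trace c)) \<delta> (threads c ! t) (G t) \<and>
        start (G t) + max_depth (G t) \<le> S) \<and>
     heap_inv m h\<^sub>0 (length (threads c)) G (heap c) (fresh c) \<and>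
     token_inv (length (threads c)) G \<and>
     queue_inv P (threads c) (queue c) (now c) \<and>
     dag_inv S \<delta> (trace c) \<and>
     length (trace c) + (\<Sum>t<length (threads c). remaining (G t)) \<le> W"

section \<open>Frame rules for the components of the invariant\<close>

lemma thread_inv_mono:
  assumes "thread_inv P m L \<delta> th g" "L \<le> L'" "\<And>v. v < L \<Longrightarrow> \<delta>' v = \<delta> v"
  shows "thread_inv P m L' \<delta>' th g"
  using assms unfolding thread_inv_def by (auto split: if_splits simp: subset_iff)

lemma dag_inv_snoc:
  assumes "dag_inv S \<delta> G" "ps \<subseteq> {..<length G}" "\<And>v. v \<in> ps \<Longrightarrow> \<delta> v < e" "0 < e" "e \<le> S"
  shows "dag_inv S (\<delta>(length G := e)) (G @ [(1, ps)])"
proof -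
  have "u \<noteq> length G" if "v < length G" "u \<in> snd (G ! v)" for u v
    using assms(1) that by (fastforce simp: dag_inv_def)
  then show ?thesis
    using assms unfolding dag_inv_def
    by (auto simp: nth_append less_Suc_eq subset_iff)
qed

text \<open>Collects what is common to all transitions that add one node to the DAG; the new node
  gets the depth bound \<open>start (G t) + e\<close>. Other threads may change their ghost state,
  as a joined thread does, but they depend on old nodes only.\<close>

lemma inv_advance:
  assumes inv: "config_inv P m S W Q h\<^sub>0 c G \<delta>"
    and t: "t < length (threads c)"
    and len: "length (threads c) \<le> length (threads c')"
    and trace: "trace c' = trace c @ [(1, ps)]"
    and ps: "ps \<subseteq> {..<length (trace c)}" "\<And>v. v \<in> ps \<Longrightarrow> \<delta> v < start (G t) + e"
    and e: "0 < e" "e \<le> max_depth (G t)"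
    and \<delta>': "\<delta>' = \<delta>(length (trace c) := start (G t) + e)"
    and root: "post (G' 0) = Q"
    and old: "\<And>u. u < length (threads c) \<Longrightarrow> u \<noteq> t \<Longrightarrow>
      thread_inv P m (length (trace c)) \<delta> (threads c' ! u) (G' u)"
    and new: "\<And>u. u = t \<or> length (threads c) \<le> u \<Longrightarrow> u < length (threads c') \<Longrightarrow>
      thread_inv P m (Suc (length (trace c))) \<delta>' (threads c' ! u) (G' u)"
    and ends: "\<And>u. u < length (threads c') \<Longrightarrow> start (G' u) + max_depth (G' u) \<le> S"
    and heap: "heap_inv m h\<^sub>0 (length (threads c')) G' (heap c') (fresh c')"
    and tok: "token_inv (length (threads c')) G'"
    and queue: "queue_inv P (threads c') (queue c') (now c')"
    and budget: "(\<Sum>t<length (threads c'). remaining (G' t)) <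
      (\<Sum>t<length (threads c). remaining (G t))"
  shows "config_inv P m S W Q h\<^sub>0 c' G' \<delta>'"
proof -
  have "dag_inv S \<delta>' (trace c')"
    unfolding trace \<delta>'
    by (rule dag_inv_snoc) (use inv ps e t in \<open>auto simp: config_inv_def intro: order.trans\<close>)
  moreover have "thread_inv P m (length (trace c')) \<delta>' (threads c' ! u) (G' u)"
    if "u < length (threads c')" for u
  proof (cases "u = t \<or> length (threads c) \<le> u")
    case True
    then show ?thesis using new[OF True that] by (simp add: trace)
  next
    case False
    then show ?thesis using old[of u] by (auto intro: thread_inv_mono simp: trace \<delta>')
  qed
  moreover have "threads c' \<noteq> []" using t len by auto
  ultimately show ?thesis
    using inv budget unfolding config_inv_def by (simp add: root ends heap tok queue trace)
qed

lemma sum_upd_less: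
  fixes f :: "'b \<Rightarrow> nat"
  assumes "t < (n::nat)" "f g' < f (G t)"
  shows "(\<Sum>u<n. f ((G(t := g')) u)) < (\<Sum>u<n. f (G u))"
  by (rule sum_strict_mono_ex1) (use assms in \<open>auto intro!: bexI[of _ t]\<close>)

lemma exec_local:
  assumes "local_step (P ! pc (threads c ! t)) (pc (threads c ! t)) (regs (threads c ! t)) =
    Some (l, \<rho>)"
  shows "exec P t c =
    finish (deps (threads c ! t)) t ((threads c ! t)\<lparr>pc := l, regs := \<rho>\<rparr>) c"
  using assms unfolding local_step_def exec_def Let_def
  by (auto split: instr.splits val.splits)

lemma heap_invD:
  assumes "heap_inv m h\<^sub>0 n G h b" "t < n" "owned (G t) a = Some f"
  shows "a < b" "h (a, i) = f i"
  using assms by (auto simp: heap_inv_def)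

lemma heap_inv_shrink:
  assumes "heap_inv m h\<^sub>0 n G h b" "\<And>u. u < n \<Longrightarrow> owned (G' u) \<subseteq>\<^sub>m owned (G u)"
  shows "heap_inv m h\<^sub>0 n G' h b"
proof -
  have "owned (G u) a = Some g" if "u < n" "owned (G' u) a = Some g" for u a g
    using assms(2)[OF that(1)] that(2) by (auto simp: map_le_def domI dest!: bspec)
  moreover have "dom (owned (G' u)) \<subseteq> dom (owned (G u))" if "u < n" for u
    using assms(2)[OF that] by (rule map_le_implies_dom_le)
  ultimately show ?thesis
    using assms(1) unfolding heap_inv_def by (simp add: disjoint_iff) (meson subsetD)
qed

lemma queue_inv_cong:
  assumes q: "queue_inv P ths q s" and "length ths \<le> length ths'"
    and same: "\<And>t. t < length ths' \<Longrightarrow>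
      (if t < length ths then status (ths ! t) = Blocked else False) \<or>
      status (ths' ! t) = Blocked \<Longrightarrow> t < length ths \<and> ths' ! t = ths ! t"
  shows "queue_inv P ths' q s"
proof -
  have "q x = [] \<or> (\<exists>t<length ths'. \<exists>f. q x = [(t, f, s)] \<and> pending P (ths' ! t) f x)" for x
  proof (cases "q x = []")
    case False
    then obtain t f where t: "t < length ths" "q x = [(t, f, s)]" "pending P (ths ! t) f x"
      using q unfolding queue_inv_def by metis
    moreover have "ths' ! t = ths ! t" using same[of t] t assms(2) by (auto simp: pending_def)
    ultimately show ?thesis using assms(2) by fastforce
  qed simp
  moreover have "\<exists>x f. q x = [(t, f, s)]" if "t < length ths'" "status (ths' ! t) = Blocked" for t
    using same[of t] that q by (auto simp: queue_inv_def)
  ultimately show ?thesis unfolding queue_inv_def by blast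
qed

lemma queue_inv_upd:
  assumes "queue_inv P ths q s" "t < length ths" "status (ths ! t) \<noteq> Blocked"
    "status th \<noteq> Blocked"
  shows "queue_inv P (ths[t := th]) q s"
  by (rule queue_inv_cong[OF assms(1)])
    (use assms in \<open>auto simp: nth_list_update split: if_splits\<close>)

lemma queue_inv_append:
  assumes "queue_inv P ths q s" "status th \<noteq> Blocked"
  shows "queue_inv P (ths @ [th]) q s"
  by (rule queue_inv_cong[OF assms(1)])
    (use assms in \<open>auto simp: nth_append less_Suc_eq split: if_splits\<close>)

lemma token_invD:
  assumes "token_inv n G" "t < n" "tokens (G t) u = Some (Q, e)"
  shows "t < u" "u < n" "post (G u) = Q" "start (G u) + max_depth (G u) \<le> start (G t) + e"
    "\<And>t'. t' < n \<Longrightarrow> u \<in> dom (tokens (G t')) \<Longrightarrow> t' = t"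
  using assms unfolding token_inv_def by blast+

text \<open>Tokens may disappear but not appear, and a thread may change its postcondition only if
  no token for it is left. This is what a join does: it spends the token and resets the
  postcondition of the joined thread.\<close>

lemma token_inv_cong:
  assumes inv: "token_inv n G"
    and tok: "\<And>t u y. t < n \<Longrightarrow> tokens (G' t) u = Some y \<Longrightarrow>
      tokens (G t) u = Some y \<and> post (G' u) = post (G u)"
    and same: "\<And>u. start (G' u) = start (G u)" "\<And>u. max_depth (G' u) = max_depth (G u)"
  shows "token_inv n G'"
  unfolding token_inv_def
proof (intro allI impI)
  fix t u Q e assume t: "t < n" "tokens (G' t) u = Some (Q, e)"
  have dom: "u \<in> dom (tokens (G' t')) \<Longrightarrow> u \<in> dom (tokens (G t'))" if "t' < n" for t'
    using tok[OF that] by blast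
  show "t < u \<and> u < n \<and> post (G' u) = Q \<and> start (G' u) + max_depth (G' u) \<le> start (G' t) + e \<and>
      (\<forall>t'<n. u \<in> dom (tokens (G' t')) \<longrightarrow> t' = t)"
    using token_invD[OF inv t(1) conjunct1[OF tok[OF t]]] tok[OF t] dom same by simp
qed

lemma token_inv_upd:
  assumes "token_inv n G" "tokens g \<subseteq>\<^sub>m tokens (G t)" "post g = post (G t)"
    "start g = start (G t)" "max_depth g = max_depth (G t)"
  shows "token_inv n (G(t := g))"
proof -
  have "tokens (G t) v = Some y" if "tokens g v = Some y" for v y
    using assms(2) that by (auto simp: map_le_def dom_def)
  then show ?thesis using assms by (intro token_inv_cong[OF assms(1)]) (auto split: if_splits)
qed

text \<open>The case in which a single thread changes its ghost state and gains no token: register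
  instructions, node creation, halting and the service of a request. The queue is a parameter
  because the service changes it.\<close>

lemma inv_finish:
  assumes inv: "config_inv P m S W Q h\<^sub>0 c G \<delta>" and t: "t < length (threads c)"
    and live: "status (threads c ! t) \<noteq> Terminated"
    and th': "status th' = Ready \<or> status th' = Terminated"
    and heap: "heap_inv m h\<^sub>0 (length (threads c)) (G(t := g)) h b"
    and g: "tokens g \<subseteq>\<^sub>m tokens (G t)" "post g = post (G t)"
      "start g = start (G t)" "max_depth g = max_depth (G t)" "max_work g = max_work (G t)"
      "work (G t) < work g" "depth g = Suc (depth (G t))" "depth (G t) < max_depth (G t)"
      "work (G t) < max_work (G t)"
    and state: "if status th' = Terminated then post g (owned g)
      else safe P m (max_depth g) (max_work g) (post g) (pc th') (regs th') (owned g) (tokens g)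
             (depth g) (work g)"
    and c': "c' = finish (deps (threads c ! t)) t th' (c\<lparr>heap := h, fresh := b, queue := q\<rparr>)"
    and queue: "queue_inv P (threads c') q (now c)"
  shows "\<exists>G \<delta>. config_inv P m S W Q h\<^sub>0 c' G \<delta>"
proof -
  let ?L = "length (trace c)" and ?th = "threads c ! t"
  let ?\<delta> = "\<delta>(?L := start (G t) + Suc (depth (G t)))"
  have ti: "thread_inv P m ?L \<delta> (threads c ! u) (G u)"
    and ends: "start (G u) + max_depth (G u) \<le> S" if "u < length (threads c)" for u
    using inv that by (auto simp: config_inv_def)
  have "config_inv P m S W Q h\<^sub>0 c' (G(t := g)) ?\<delta>"
  proof (rule inv_advance[OF inv t, where e = "Suc (depth (G t))" and ps = "deps ?th"])
    show "length (threads c) \<le> length (threads c')" "trace c' = trace c @ [(1, deps ?th)]"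
      by (simp_all add: c' finish_def)
    show "deps ?th \<subseteq> {..<?L}"
      and "v \<in> deps ?th \<Longrightarrow> \<delta> v < start (G t) + Suc (depth (G t))" for v
      using ti[OF t] live by (auto simp: thread_inv_def)
    show "0 < Suc (depth (G t))" "Suc (depth (G t)) \<le> max_depth (G t)" using g by auto
    show "post ((G(t := g)) 0) = Q" using inv g by (auto simp: config_inv_def)
    show "thread_inv P m ?L \<delta> (threads c' ! u) ((G(t := g)) u)"
      if "u < length (threads c)" "u \<noteq> t" for u
      using ti[OF that(1)] that by (simp add: c' finish_def)
    show "thread_inv P m (Suc ?L) ?\<delta> (threads c' ! u) ((G(t := g)) u)"
      if "u = t \<or> length (threads c) \<le> u" "u < length (threads c')" for u
    proof -
      have "u = t" using that by (auto simp: c' finish_def)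
      then show ?thesis
        using state th' g t by (auto simp: thread_inv_def c' finish_def split: if_splits)
    qed
    show "start ((G(t := g)) u) + max_depth ((G(t := g)) u) \<le> S" if "u < length (threads c')" for u
      using ends[of u] g that by (auto simp: c' finish_def)
    show "heap_inv m h\<^sub>0 (length (threads c')) (G(t := g)) (heap c') (fresh c')"
      using heap by (simp add: c' finish_def)
    show "token_inv (length (threads c')) (G(t := g))"
      using token_inv_upd[of _ G g t] inv g by (simp add: c' finish_def config_inv_def)
    show "queue_inv P (threads c') (queue c') (now c')"
      using queue by (simp add: c' finish_def)
    show "(\<Sum>u<length (threads c'). remaining ((G(t := g)) u)) <
      (\<Sum>u<length (threads c). remaining (G u))"
      using sum_upd_less[OF t, of remaining g G] g by (auto simp: c' finish_def remaining_def)
  qed simp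
  then show ?thesis by blast
qed

lemma inv_exec_finish:
  assumes inv: "config_inv P m S W Q h\<^sub>0 c G \<delta>" and t: "t < length (threads c)"
    and ready: "status (threads c ! t) = Ready"
    and th': "status th' = Ready \<or> status th' = Terminated"
    and rest: "heap_inv m h\<^sub>0 (length (threads c)) (G(t := g)) h b"
      "tokens g \<subseteq>\<^sub>m tokens (G t)" "post g = post (G t)"
      "start g = start (G t)" "max_depth g = max_depth (G t)" "max_work g = max_work (G t)"
      "work (G t) < work g" "depth g = Suc (depth (G t))" "depth (G t) < max_depth (G t)"
      "work (G t) < max_work (G t)"
      "if status th' = Terminated then post g (owned g)
       else safe P m (max_depth g) (max_work g) (post g) (pc th') (regs th') (owned g) (tokens g)
             (depth g) (work g)"
  shows "\<exists>G \<delta>. config_inv P m S W Q h\<^sub>0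
    (finish (deps (threads c ! t)) t th' (c\<lparr>heap := h, fresh := b\<rparr>)) G \<delta>"
proof -
  have "queue_inv P ((threads c)[t := th'\<lparr>deps := {length (trace c)}\<rparr>]) (queue c) (now c)"
    by (rule queue_inv_upd) (use inv t ready th' in \<open>auto simp: config_inv_def\<close>)
  then show ?thesis
    using ready by (intro inv_finish[OF inv t _ th' rest, where q = "queue c"])
      (auto simp: finish_def)
qed

text \<open>Treats a write to an owned node and the creation of a node alike: no other thread owns
  \<open>a\<close>, by disjointness in the first case and because owned addresses lie below
  \<open>b\<close> in the second.\<close>

lemma heap_inv_write:
  assumes inv: "heap_inv m h\<^sub>0 n G h b" and t: "t < n"
    and own: "owned g = (owned (G t))(a \<mapsto> f)" "a \<in> dom (owned (G t)) \<or> b \<le> a"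
    and b: "a < b'" "b \<le> b'"
    and h': "\<And>a' i. h' (a', i) = (if a' = a then f i else h (a', i))"
    and input: "\<And>i. a < m \<Longrightarrow> i < 5 \<Longrightarrow> f i = h (a, i)"
  shows "heap_inv m h\<^sub>0 n (G(t := g)) h' b'"
proof -
  have other: "a \<notin> dom (owned (G u))" if "u < n" "u \<noteq> t" for u
    using inv own(2) t that unfolding heap_inv_def by (metis disjoint_iff domD not_le)
  show ?thesis
    unfolding heap_inv_def
  proof (intro conjI allI impI)
    show "m \<le> b'" using inv b by (auto simp: heap_inv_def)
    show "h' (a', i) = h\<^sub>0 (a', i)" if "a' < m" "i < 5" for a' i
      using inv that input by (auto simp: h' heap_inv_def)
    fix u assume u: "u < n"
    show "a' < b'" "h' (a', i) = g' i" if "owned ((G(t := g)) u) a' = Some g'" for a' g' i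
    proof -
      have "u \<noteq> t \<Longrightarrow> a' \<noteq> a" using other[OF u] that by auto
      then show "a' < b'" "h' (a', i) = g' i"
        using inv that u b by (auto simp: heap_inv_def h' own split: if_splits
            intro: less_le_trans[OF _ b(2)])
    qed
    show "dom (owned ((G(t := g)) u)) \<inter> dom (owned ((G(t := g)) u')) = {}"
      if "u' < n" "u \<noteq> u'" for u'
      using inv that u t other[of u] other[of u'] by (simp add: heap_inv_def own(1))
  qed
qed

section \<open>Preservation of the invariant by single instructions\<close>

lemma safe_rmwD:
  assumes "safe P m E K Q l \<rho> h tok d k" "P ! l = RMW f r i"
  shows "\<exists>a g \<rho>' v. \<rho> r = Ptr a \<and> h a = Some g \<and> perform f \<rho> (g i) = (\<rho>', v) \<and>
    (v = g i \<or> 5 \<le> i \<or> m \<le> a) \<and>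
    safe P m E K Q (Suc l) \<rho>' (h(a \<mapsto> g(i := v))) tok (Suc d) (Suc k)"
  using assms by (cases rule: safe.cases) (auto simp: local_step_def)

text \<open>Issuing a request touches neither memory nor DAG, so the ghost state stays the same; it
  advances when the request is serviced.\<close>

lemma inv_exec_rmw:
  assumes inv: "config_inv P m S W Q h\<^sub>0 c G \<delta>" and t: "t < length (threads c)"
    and ready: "status (threads c ! t) = Ready"
    and instr: "P ! pc (threads c ! t) = RMW f r i"
  shows "config_inv P m S W Q h\<^sub>0 (exec P t c) G \<delta>"
proof -
  let ?th = "threads c ! t"
  have ti: "thread_inv P m (length (trace c)) \<delta> (threads c ! u) (G u)"
    if "u < length (threads c)" for u using inv that by (auto simp: config_inv_def)
  have "safe P m (max_depth (G t)) (max_work (G t)) (post (G t)) (pc ?th) (regs ?th)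
      (owned (G t)) (tokens (G t)) (depth (G t)) (work (G t))"
    using ti[OF t] ready by (simp add: thread_inv_def)
  from safe_rmwD[OF this instr]
  obtain a where a: "regs ?th r = Ptr a" "a \<in> dom (owned (G t))" by auto
  have q: "queue_inv P (threads c) (queue c) (now c)" using inv by (simp add: config_inv_def)
  \<comment> \<open>Absence of contention: the issuer of a waiting request would own
    \<open>a\<close>, which \<open>t\<close> owns already.\<close>
  have empty: "queue c (a, i) = []"
  proof (rule ccontr)
    assume "queue c (a, i) \<noteq> []"
    then obtain u f' where u: "u < length (threads c)" "pending P (threads c ! u) f' (a, i)"
      using q unfolding queue_inv_def by metis
    then have "a \<in> dom (owned (G u))"
      using ti[OF u(1)] safe_rmwD[of P m _ _ _ "pc (threads c ! u)"]
      by (fastforce simp: thread_inv_def pending_def)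
    moreover have "u \<noteq> t" using u ready by (auto simp: pending_def)
    ultimately show False
      using inv a(2) t u(1) unfolding config_inv_def heap_inv_def by (metis disjoint_iff)
  qed
  let ?ths = "(threads c)[t := ?th\<lparr>status := Blocked\<rparr>]"
  let ?q = "(queue c)((a, i) := [(t, f, now c)])"
  have exec: "exec P t c = c\<lparr>threads := ?ths, queue := ?q\<rparr>"
    using instr a empty by (simp add: exec_def Let_def)
  have "?q x = [] \<or> (\<exists>u<length ?ths. \<exists>f. ?q x = [(u, f, now c)] \<and> pending P (?ths ! u) f x)" for x
  proof (cases "x = (a, i) \<or> queue c x = []")
    case True
    then show ?thesis using t instr a by (auto simp: pending_def)
  next
    case False
    then obtain u f' where u: "u < length (threads c)" "queue c x = [(u, f', now c)]"
        "pending P (threads c ! u) f' x"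
      using q unfolding queue_inv_def by metis
    moreover have "u \<noteq> t" using u ready by (auto simp: pending_def)
    ultimately show ?thesis using False by auto
  qed
  moreover have "\<exists>x f. ?q x = [(u, f, now c)]"
    if u: "u < length ?ths" "status (?ths ! u) = Blocked" for u
  proof (cases "u = t")
    case False
    then obtain x f where "queue c x = [(u, f, now c)]"
      using q u unfolding queue_inv_def by auto
    moreover from this have "x \<noteq> (a, i)" using empty by auto
    ultimately have "?q x = [(u, f, now c)]" by simp
    then show ?thesis by blast
  qed (metis fun_upd_same)
  ultimately have "queue_inv P ?ths ?q (now c)" unfolding queue_inv_def by blast
  moreover have "thread_inv P m (length (trace c)) \<delta> (?ths ! u) (G u)"
    if "u < length (threads c)" for u
    using ti[OF that] ready t by (cases "u = t") (auto simp: thread_inv_def)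
  ultimately show ?thesis using inv by (auto simp: config_inv_def exec)
qed

lemma inv_serve:
  assumes inv: "config_inv P m S W Q h\<^sub>0 c G \<delta>"
  shows "\<exists>G \<delta>. config_inv P m S W Q h\<^sub>0 (serve x c) G \<delta>"
proof (cases "queue c x = []")
  case True
  then show ?thesis using inv by (auto simp: serve_def)
next
  case False
  have q: "queue_inv P (threads c) (queue c) (now c)" using inv by (simp add: config_inv_def)
  obtain t f where t: "t < length (threads c)" "queue c x = [(t, f, now c)]"
      "pending P (threads c ! t) f x"
    using q False unfolding queue_inv_def by metis
  let ?th = "threads c ! t"
  obtain a i where x: "x = (a, i)" by fastforce
  obtain r where r: "P ! pc ?th = RMW f r i" "regs ?th r = Ptr a" and "status ?th = Blocked"
    using t(3) x by (auto simp: pending_def)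
  then have safe: "safe P m (max_depth (G t)) (max_work (G t)) (post (G t)) (pc ?th) (regs ?th)
      (owned (G t)) (tokens (G t)) (depth (G t)) (work (G t))"
    using inv t(1) by (auto simp: config_inv_def thread_inv_def)
  obtain g \<rho>' v where g: "owned (G t) a = Some g" "perform f (regs ?th) (g i) = (\<rho>', v)"
      "v = g i \<or> 5 \<le> i \<or> m \<le> a"
      "safe P m (max_depth (G t)) (max_work (G t)) (post (G t)) (Suc (pc ?th)) \<rho>'
        ((owned (G t))(a \<mapsto> g(i := v))) (tokens (G t)) (Suc (depth (G t))) (Suc (work (G t)))"
    using safe_rmwD[OF safe r(1)] r(2) by auto
  have heap: "heap_inv m h\<^sub>0 (length (threads c)) G (heap c) (fresh c)"
    using inv by (simp add: config_inv_def)
  then have ha: "a < fresh c" "heap c (a, j) = g j" for j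
    using g(1) t(1) by (auto simp: heap_inv_def)
  let ?g = "G t\<lparr>owned := (owned (G t))(a \<mapsto> g(i := v)), depth := Suc (depth (G t)),
    work := Suc (work (G t))\<rparr>"
  let ?th' = "?th\<lparr>pc := Suc (pc ?th), regs := \<rho>', status := Ready\<rparr>"
  let ?q = "(queue c)(x := [])"
  let ?ths = "(threads c)[t := ?th'\<lparr>deps := {length (trace c)}\<rparr>]"
  \<comment> \<open>The request was issued at \<open>now c\<close>, so its weight is 1 and its
    service has the form of \<open>finish\<close>.\<close>
  have serve: "serve x c = finish (deps ?th) t ?th'
      (c\<lparr>heap := (heap c)(x := v), fresh := fresh c, queue := ?q\<rparr>)"
    using t(2) g(2) ha by (simp add: serve_def finish_def x Let_def)
  have "heap_inv m h\<^sub>0 (length (threads c)) (G(t := ?g)) ((heap c)(x := v)) (fresh c)"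
    by (rule heap_inv_write[OF heap t(1), where a = a and f = "g(i := v)"])
      (use g ha in \<open>auto simp: x\<close>)
  moreover have "queue_inv P ?ths ?q (now c)"
    unfolding queue_inv_def
  proof (intro conjI allI impI)
    fix y
    show "?q y = [] \<or> (\<exists>u<length ?ths. \<exists>f. ?q y = [(u, f, now c)] \<and> pending P (?ths ! u) f y)"
    proof (cases "y = x \<or> queue c y = []")
      case False
      then obtain u f' where u: "u < length (threads c)" "queue c y = [(u, f', now c)]"
          "pending P (threads c ! u) f' y"
        using q unfolding queue_inv_def by metis
      \<comment> \<open>A pending request is determined by the label and the registers of its
        thread, so \<open>t\<close> waits on no second cell.\<close>
      have "u \<noteq> t"
      proof
        assume "u = t"
        then have "y = x" using u(3) t(3) by (auto simp: pending_def prod_eq_iff)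
        then show False using False by simp
      qed
      then show ?thesis using u False by auto
    qed auto
  next
    fix u assume u: "u < length ?ths" "status (?ths ! u) = Blocked"
    then have "u \<noteq> t" using t(1) by auto
    then obtain y f' where y: "queue c y = [(u, f', now c)]"
      using q u unfolding queue_inv_def by auto
    then have "y \<noteq> x" using t(2) \<open>u \<noteq> t\<close> by auto
    then have "?q y = [(u, f', now c)]" using y by simp
    then show "\<exists>y f'. ?q y = [(u, f', now c)]" by blast
  qed
  ultimately show ?thesis
    unfolding serve
    by (intro inv_finish[OF inv t(1), where g = ?g])
      (use \<open>status ?th = Blocked\<close> g(4) safe_bounds[OF safe] in \<open>auto simp: finish_def\<close>)
qed

lemma safe_joinD:
  assumes "safe P m E K Q l \<rho> h tok d k" "P ! l = Join r"
  shows "\<exists>u Q' e. \<rho> r = Thread u \<and> tok u = Some (Q', e) \<and> max d e < E \<and> k < K \<and>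
    (\<forall>h'. Q' h' \<and> dom h' \<inter> dom h = {} \<longrightarrow>
      safe P m E K Q (Suc l) \<rho> (h ++ h') (tok(u := None)) (Suc (max d e)) (Suc k))"
  using assms by (cases rule: safe.cases) (auto simp: local_step_def)

lemma safe_forkD:
  assumes "safe P m E K Q l \<rho> h tok d k" "P ! l = Fork r l'"
  shows "\<exists>A E' K' Q'. safe P m E' K' Q' l' \<rho> (h |` A) Map.empty 0 0 \<and>
    Suc d + E' < E \<and> Suc k + K' < K \<and>
    (\<forall>u. u \<notin> dom tok \<longrightarrow> safe P m E K Q (Suc l) (\<rho>(r := Thread u)) (h |` (- A))
      (tok(u \<mapsto> (Q', Suc d + E'))) (Suc d) (Suc k + K'))"
  using assms by (cases rule: safe.cases) (auto simp: local_step_def)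

text \<open>The child's memory moves to the parent, from whose memory it is disjoint. The child's
  last instruction is at depth at most \<open>start (G t) + e\<close>, so the join node needs only
  one more than the maximum of the two depths.\<close>

lemma inv_exec_join:
  assumes inv: "config_inv P m S W Q h\<^sub>0 c G \<delta>" and t: "t < length (threads c)"
    and ready: "status (threads c ! t) = Ready"
    and instr: "P ! pc (threads c ! t) = Join r"
    and enabled: "regs (threads c ! t) r = Thread u" "status (threads c ! u) = Terminated"
  shows "\<exists>G \<delta>. config_inv P m S W Q h\<^sub>0 (exec P t c) G \<delta>"
proof -
  let ?n = "length (threads c)" and ?L = "length (trace c)" and ?th = "threads c ! t"
  have ti: "thread_inv P m ?L \<delta> (threads c ! u) (G u)"
    and ends: "start (G u) + max_depth (G u) \<le> S" if "u < ?n" for u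
    using inv that by (auto simp: config_inv_def)
  have heap: "heap_inv m h\<^sub>0 ?n G (heap c) (fresh c)" and tok: "token_inv ?n G"
    using inv by (simp_all add: config_inv_def)
  have safe: "safe P m (max_depth (G t)) (max_work (G t)) (post (G t)) (pc ?th) (regs ?th)
      (owned (G t)) (tokens (G t)) (depth (G t)) (work (G t))"
    using ti[OF t] ready by (simp add: thread_inv_def)
  obtain Q' e where e: "tokens (G t) u = Some (Q', e)" "max (depth (G t)) e < max_depth (G t)"
      "work (G t) < max_work (G t)"
    and cont: "Q' h' \<Longrightarrow> dom h' \<inter> dom (owned (G t)) = {} \<Longrightarrow>
      safe P m (max_depth (G t)) (max_work (G t)) (post (G t)) (Suc (pc ?th)) (regs ?th)
        (owned (G t) ++ h') ((tokens (G t))(u := None)) (Suc (max (depth (G t)) e))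
        (Suc (work (G t)))" for h'
    using safe_joinD[OF safe instr] enabled(1) by auto
  have u: "t < u" "u < ?n" "post (G u) = Q'" "start (G u) + max_depth (G u) \<le> start (G t) + e"
    and unique: "t' < ?n \<Longrightarrow> u \<in> dom (tokens (G t')) \<Longrightarrow> t' = t" for t'
    using token_invD[OF tok t e(1)] by auto
  have disj: "dom (owned (G u)) \<inter> dom (owned (G t)) = {}"
    using heap t u unfolding heap_inv_def by (metis less_irrefl)
  define g where "g = G t\<lparr>owned := owned (G t) ++ owned (G u), tokens := (tokens (G t))(u := None),
    depth := Suc (max (depth (G t)) e), work := Suc (work (G t))\<rparr>"
  \<comment> \<open>The joined thread stays in the list. Having given its memory away, it need no
    longer meet its old postcondition, so it receives a trivial one.\<close>
  define gu where "gu = G u\<lparr>owned := Map.empty, post := (\<lambda>_. True)\<rparr>"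
  define G' where "G' = G(t := g, u := gu)"
  let ?e = "Suc (max (depth (G t)) e)"
  let ?\<delta> = "\<delta>(?L := start (G t) + ?e)"
  let ?ps = "deps ?th \<union> deps (threads c ! u)"
  let ?th' = "?th\<lparr>pc := Suc (pc ?th), deps := {?L}\<rparr>"
  have exec: "exec P t c = c\<lparr>threads := (threads c)[t := ?th'], trace := trace c @ [(1, ?ps)]\<rparr>"
    using instr enabled by (simp add: exec_def Let_def finish_def)
  have G': "start (G' v) = start (G v)" "max_depth (G' v) = max_depth (G v)"
    "max_work (G' v) = max_work (G v)" "work (G v) \<le> work (G' v)" for v
    by (simp_all add: G'_def g_def gu_def)
  have "config_inv P m S W Q h\<^sub>0 (exec P t c) G' ?\<delta>"
  proof (rule inv_advance[OF inv t, where e = ?e and ps = ?ps])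
    show "?n \<le> length (threads (exec P t c))" "trace (exec P t c) = trace c @ [(1, ?ps)]"
      by (simp_all add: exec)
    show "?ps \<subseteq> {..<?L}" using ti[OF t] ti[OF u(2)] by (auto simp: thread_inv_def)
    show "\<delta> v < start (G t) + ?e" if "v \<in> ?ps" for v
      using that ti[OF t] ti[OF u(2)] ready enabled(2) u(4) by (fastforce simp: thread_inv_def)
    show "0 < ?e" "?e \<le> max_depth (G t)" using e by auto
    show "post (G' 0) = Q" using inv u(1) by (auto simp: config_inv_def G'_def g_def)
    show "thread_inv P m ?L \<delta> (threads (exec P t c) ! v) (G' v)" if "v < ?n" "v \<noteq> t" for v
      using ti[OF that(1)] that enabled(2)
      by (auto simp: exec G'_def gu_def thread_inv_def)
    show "thread_inv P m (Suc ?L) ?\<delta> (threads (exec P t c) ! v) (G' v)"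
      if "v = t \<or> ?n \<le> v" "v < length (threads (exec P t c))" for v
    proof -
      have "v = t" using that by (auto simp: exec)
      then show ?thesis
        using cont[OF _ disj] ti[OF u(2)] enabled(2) ready u(1,3) t
        by (simp add: exec G'_def g_def thread_inv_def)
    qed
    show "start (G' v) + max_depth (G' v) \<le> S" if "v < length (threads (exec P t c))" for v
      using ends[of v] that by (simp add: exec G')
    have "\<exists>w. w < ?n \<and> owned (G w) a = Some f \<and> (w = v \<or> w = u \<and> v = t)"
      if "v < ?n" "owned (G' v) a = Some f" for v a f
    proof (cases "v = t")
      case True
      then have "owned (G u) a = Some f \<or> owned (G t) a = Some f"
        using that u(1) by (auto simp: G'_def g_def)
      then show ?thesis using True t u(2) by blast
    qed (use that in \<open>auto simp: G'_def gu_def split: if_splits\<close>)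
    then have "\<forall>v<?n. \<forall>a f. owned (G' v) a = Some f \<longrightarrow> a < fresh c \<and> (\<forall>i. heap c (a, i) = f i)"
      using heap_invD[OF heap] by metis
    moreover have "dom (owned (G' v)) \<inter> dom (owned (G' w)) = {}"
      if "v < ?n" "w < ?n" "v \<noteq> w" for v w
    proof -
      have *: "dom (owned (G v')) \<inter> dom (owned (G w')) = {}" if "v' < ?n" "w' < ?n" "v' \<noteq> w'" for v' w'
        using heap that by (simp add: heap_inv_def)
      have "dom (owned (G' t)) = dom (owned (G t)) \<union> dom (owned (G u))"
        using u by (auto simp: G'_def g_def)
      moreover have "dom (owned (G' u)) = {}"
        by (simp add: G'_def gu_def)
      moreover have "dom (owned (G' x)) = dom (owned (G x))" if "x \<noteq> t" "x \<noteq> u" for x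
        using that by (simp add: G'_def)
      ultimately show ?thesis
        using that t u(2) by (cases "v = t"; cases "v = u"; cases "w = t"; cases "w = u")
          (simp_all add: * Int_Un_distrib Int_Un_distrib2)
    qed
    ultimately show "heap_inv m h\<^sub>0 (length (threads (exec P t c))) G' (heap (exec P t c))
        (fresh (exec P t c))"
      using heap unfolding heap_inv_def by (simp add: exec)
    have "token_inv ?n G'"
    proof (rule token_inv_cong[OF tok])
      fix t' v y assume t': "t' < ?n" "tokens (G' t') v = Some y"
      then have "tokens (G t') v = Some y \<and> v \<noteq> u"
        using unique[of t'] u(1) by (auto simp: G'_def g_def gu_def dom_def split: if_splits)
      then show "tokens (G t') v = Some y \<and> post (G' v) = post (G v)"
        by (simp add: G'_def g_def)
    qed (simp_all add: G')
    then show "token_inv (length (threads (exec P t c))) G'" by (simp add: exec)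
    show "queue_inv P (threads (exec P t c)) (queue (exec P t c)) (now (exec P t c))"
      using queue_inv_upd[of P "threads c" "queue c" "now c" t ?th'] inv t ready
      by (simp add: exec config_inv_def)
    show "(\<Sum>v<length (threads (exec P t c)). remaining (G' v)) < (\<Sum>v<?n. remaining (G v))"
    proof -
      have "(\<Sum>v<?n. remaining (G' v)) < (\<Sum>v<?n. remaining (G v))"
        by (rule sum_strict_mono_ex1)
          (use t e u in \<open>auto simp: G' remaining_def G'_def g_def gu_def intro!: bexI[of _ t] diff_less_mono2\<close>)
      then show ?thesis by (simp add: exec)
    qed
  qed simp
  then show ?thesis by blast
qed

lemma inv_exec_fork:
  assumes inv: "config_inv P m S W Q h\<^sub>0 c G \<delta>" and t: "t < length (threads c)"
    and ready: "status (threads c ! t) = Ready"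
    and instr: "P ! pc (threads c ! t) = Fork r l"
  shows "\<exists>G \<delta>. config_inv P m S W Q h\<^sub>0 (exec P t c) G \<delta>"
proof -
  let ?n = "length (threads c)" and ?L = "length (trace c)" and ?th = "threads c ! t"
  have ti: "thread_inv P m ?L \<delta> (threads c ! u) (G u)"
    and ends: "start (G u) + max_depth (G u) \<le> S" if "u < ?n" for u
    using inv that by (auto simp: config_inv_def)
  have heap: "heap_inv m h\<^sub>0 ?n G (heap c) (fresh c)" and tok: "token_inv ?n G"
    using inv by (simp_all add: config_inv_def)
  have safe: "safe P m (max_depth (G t)) (max_work (G t)) (post (G t)) (pc ?th) (regs ?th)
      (owned (G t)) (tokens (G t)) (depth (G t)) (work (G t))"
    using ti[OF t] ready by (simp add: thread_inv_def)
  obtain A E' K' Q' where child: "safe P m E' K' Q' l (regs ?th) (owned (G t) |` A) Map.empty 0 0"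
    and less: "Suc (depth (G t)) + E' < max_depth (G t)" "Suc (work (G t)) + K' < max_work (G t)"
    and parent: "u \<notin> dom (tokens (G t)) \<Longrightarrow>
      safe P m (max_depth (G t)) (max_work (G t)) (post (G t)) (Suc (pc ?th))
        ((regs ?th)(r := Thread u)) (owned (G t) |` (- A))
        ((tokens (G t))(u \<mapsto> (Q', Suc (depth (G t)) + E'))) (Suc (depth (G t)))
        (Suc (work (G t)) + K')" for u
    using safe_forkD[OF safe instr] by auto
  \<comment> \<open>Tokens refer to existing threads, so the index of the new thread is not yet
    among them.\<close>
  have n: "?n \<notin> dom (tokens (G u))" if "u < ?n" for u
    using token_invD(2)[OF tok that] by (auto simp: dom_def)
  define g where "g = G t\<lparr>owned := owned (G t) |` (- A),
    tokens := (tokens (G t))(?n \<mapsto> (Q', Suc (depth (G t)) + E')),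
    depth := Suc (depth (G t)), work := Suc (work (G t)) + K'\<rparr>"
  \<comment> \<open>The child counts its depth from the fork instruction, which lies one above the
    parent's depth.\<close>
  define gn where "gn = G t\<lparr>owned := owned (G t) |` A, tokens := Map.empty,
    start := start (G t) + Suc (depth (G t)), depth := 0, max_depth := E', work := 0,
    max_work := K', post := Q'\<rparr>"
  define G' where "G' = G(t := g, ?n := gn)"
  let ?e = "Suc (depth (G t))"
  let ?\<delta> = "\<delta>(?L := start (G t) + ?e)"
  let ?th' = "?th\<lparr>pc := Suc (pc ?th), regs := (regs ?th)(r := Thread ?n), deps := {?L}\<rparr>"
  let ?new = "\<lparr>pc = l, regs = regs ?th, status = Ready, deps = {?L}\<rparr>"
  have exec: "exec P t c =
      c\<lparr>threads := (threads c)[t := ?th'] @ [?new], trace := trace c @ [(1, deps ?th)]\<rparr>"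
    using instr t by (simp add: exec_def Let_def finish_def list_update_append1)
  have G': "start (G' v) = start (G v)" "max_depth (G' v) = max_depth (G v)"
    "max_work (G' v) = max_work (G v)" "post (G' v) = post (G v)" if "v < ?n" for v
    using that by (auto simp: G'_def g_def)
  have "config_inv P m S W Q h\<^sub>0 (exec P t c) G' ?\<delta>"
  proof (rule inv_advance[OF inv t, where e = ?e and ps = "deps ?th"])
    show "?n \<le> length (threads (exec P t c))" "trace (exec P t c) = trace c @ [(1, deps ?th)]"
      by (simp_all add: exec)
    show "deps ?th \<subseteq> {..<?L}" "v \<in> deps ?th \<Longrightarrow> \<delta> v < start (G t) + ?e" for v
      using ti[OF t] ready by (auto simp: thread_inv_def)
    show "0 < ?e" "?e \<le> max_depth (G t)" using less by auto
    show "post (G' 0) = Q" using inv t G'(4)[of 0] by (auto simp: config_inv_def)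
    show "thread_inv P m ?L \<delta> (threads (exec P t c) ! v) (G' v)" if "v < ?n" "v \<noteq> t" for v
      using ti[OF that(1)] that by (simp add: exec G'_def nth_append)
    show "thread_inv P m (Suc ?L) ?\<delta> (threads (exec P t c) ! v) (G' v)"
      if v: "v = t \<or> ?n \<le> v" "v < length (threads (exec P t c))" for v
    proof (cases "v = t")
      case True
      then show ?thesis
        using parent[OF n[OF t]] ready t
        by (simp add: exec G'_def g_def thread_inv_def nth_append)
    next
      case False
      then have "v = ?n" using v by (simp add: exec)
      then show ?thesis
        using child t by (simp add: exec G'_def gn_def thread_inv_def nth_append)
    qed
    show "start (G' v) + max_depth (G' v) \<le> S" if "v < length (threads (exec P t c))" for v
      using ends[of v] ends[OF t] that less
      by (auto simp: exec G'_def g_def gn_def less_Suc_eq)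
    have own: "owned (G' v) = (if v = t then owned (G t) |` (- A) else
        if v = ?n then owned (G t) |` A else owned (G v))" for v
      using t by (simp add: G'_def g_def gn_def)
    show "heap_inv m h\<^sub>0 (length (threads (exec P t c))) G' (heap (exec P t c)) (fresh (exec P t c))"
      unfolding heap_inv_def
    proof (intro conjI allI impI)
      show "m \<le> fresh (exec P t c)" "\<And>a i. a < m \<Longrightarrow> i < 5 \<Longrightarrow> heap (exec P t c) (a, i) = h\<^sub>0 (a, i)"
        using heap by (simp_all add: heap_inv_def exec)
      fix v assume v: "v < length (threads (exec P t c))"
      show "a < fresh (exec P t c)" "heap (exec P t c) (a, i) = f i"
        if "owned (G' v) a = Some f" for a f i
      proof -
        have "owned (G (if v = ?n then t else v)) a = Some f"
          using that v t by (auto simp: own restrict_map_def split: if_splits)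
        moreover have "(if v = ?n then t else v) < ?n" using v t by (auto simp: exec)
        ultimately show "a < fresh (exec P t c)" "heap (exec P t c) (a, i) = f i"
          using heap_invD[OF heap] by (simp_all add: exec)
      qed
      show "dom (owned (G' v)) \<inter> dom (owned (G' w)) = {}"
        if "w < length (threads (exec P t c))" "v \<noteq> w" for w
      proof -
        \<comment> \<open>The thread from which the memory of \<open>w\<close> stems. Only parent
          and child have the same source, and they divide its memory along \<open>A\<close>.\<close>
        define src where "src w = (if w = ?n then t else w)" for w
        have sub: "dom (owned (G' w)) \<subseteq> dom (owned (G (src w)))" for w
          by (auto simp: src_def own)
        have lt: "src v < ?n" "src w < ?n" using v that t by (auto simp: src_def exec)
        show ?thesis
        proof (cases "src v = src w")
          case True
          then show ?thesis
            using that(2) by (auto simp: src_def own split: if_splits)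
        next
          case False
          then have "dom (owned (G (src v))) \<inter> dom (owned (G (src w))) = {}"
            using heap lt by (simp add: heap_inv_def)
          then show ?thesis using sub[of v] sub[of w] by blast
        qed
      qed
    qed
    show "token_inv (length (threads (exec P t c))) G'"
      unfolding token_inv_def
    proof (intro allI impI)
      fix t' v Q'' e assume t': "t' < length (threads (exec P t c))"
        "tokens (G' t') v = Some (Q'', e)"
      have "t' \<noteq> ?n" using t' by (auto simp: G'_def gn_def)
      then have t'n: "t' < ?n" using t' by (simp add: exec)
      show "t' < v \<and> v < length (threads (exec P t c)) \<and> post (G' v) = Q'' \<and>
          start (G' v) + max_depth (G' v) \<le> start (G' t') + e \<and>
          (\<forall>w<length (threads (exec P t c)). v \<in> dom (tokens (G' w)) \<longrightarrow> w = t')"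
      proof (cases "v = ?n")
        case True
        have "t' = t"
          using n[OF t'n] True t' t'n by (auto simp: G'_def dom_def split: if_splits)
        moreover have "w = t" if "w < Suc ?n" "?n \<in> dom (tokens (G' w))" for w
          using that n[of w] by (cases "w = t"; cases "w = ?n") (auto simp: G'_def gn_def)
        ultimately show ?thesis using t'(2) t unfolding True
          by (simp add: exec) (simp add: G'_def g_def gn_def)
      next
        case False
        then have v: "tokens (G t') v = Some (Q'', e)"
          using t' t'n by (auto simp: G'_def g_def split: if_splits)
        note tokD = token_invD[OF tok t'n v]
        have "w = t'" if "w < Suc ?n" "v \<in> dom (tokens (G' w))" for w
        proof -
          have "w < ?n" "v \<in> dom (tokens (G w))"
            using that False t by (auto simp: G'_def g_def gn_def split: if_splits)
          then show ?thesis by (rule tokD(5))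
        qed
        then show ?thesis using tokD t'n by (simp add: exec G')
      qed
    qed
    show "queue_inv P (threads (exec P t c)) (queue (exec P t c)) (now (exec P t c))"
      using queue_inv_append[OF queue_inv_upd[of P "threads c" "queue c" "now c" t ?th'], of ?new]
        inv t ready by (simp add: exec config_inv_def)
    show "(\<Sum>v<length (threads (exec P t c)). remaining (G' v)) < (\<Sum>v<?n. remaining (G v))"
    proof -
      have "(\<Sum>v<?n. remaining (G v)) =
          remaining (G t) + (\<Sum>v\<in>{..<?n} - {t}. remaining (G v))"
        using t by (simp add: sum.remove)
      moreover have "(\<Sum>v<?n. remaining (G' v)) =
          remaining (G' t) + (\<Sum>v\<in>{..<?n} - {t}. remaining (G' v))"
        using t by (simp add: sum.remove)
      moreover have "(\<Sum>v\<in>{..<?n} - {t}. remaining (G' v)) = (\<Sum>v\<in>{..<?n} - {t}. remaining (G v))"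
        by (rule sum.cong) (auto simp: G'_def)
      \<comment> \<open>The parent gives up the child's whole budget and one unit for the fork
        itself; this unit makes the sum drop.\<close>
      moreover have "remaining (G' ?n) + remaining (G' t) < remaining (G t)"
        using less t by (simp add: G'_def gn_def g_def remaining_def)
      ultimately show ?thesis by (simp add: exec)
    qed
  qed simp
  then show ?thesis by blast
qed

lemma inv_exec:
  assumes inv: "config_inv P m S W Q h\<^sub>0 c G \<delta>" and en: "enabled P c t"
  shows "\<exists>G \<delta>. config_inv P m S W Q h\<^sub>0 (exec P t c) G \<delta>"
proof -
  let ?th = "threads c ! t" and ?n = "length (threads c)"
  have t: "t < ?n" and ready: "status ?th = Ready" using en by (auto simp: enabled_def)
  then have safe: "safe P m (max_depth (G t)) (max_work (G t)) (post (G t)) (pc ?th) (regs ?th)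
      (owned (G t)) (tokens (G t)) (depth (G t)) (work (G t))"
    using inv by (auto simp: config_inv_def thread_inv_def)
  have heap: "heap_inv m h\<^sub>0 ?n G (heap c) (fresh c)" using inv by (simp add: config_inv_def)
  show ?thesis
    using safe
  proof (cases rule: safe.cases)
    case (safe_local l' \<rho>')
    let ?g = "G t\<lparr>depth := Suc (depth (G t)), work := Suc (work (G t))\<rparr>"
    have "heap_inv m h\<^sub>0 ?n (G(t := ?g)) (heap c) (fresh c)"
      by (rule heap_inv_shrink[OF heap]) simp
    then have "\<exists>G \<delta>. config_inv P m S W Q h\<^sub>0 (finish (deps ?th) t (?th\<lparr>pc := l', regs := \<rho>'\<rparr>)
        (c\<lparr>heap := heap c, fresh := fresh c\<rparr>)) G \<delta>"
      by (intro inv_exec_finish[OF inv t ready, where g = ?g])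
        (use safe_local ready safe_bounds[OF safe] in auto)
    then show ?thesis unfolding exec_local[OF safe_local(2)] by simp
  next
    case (safe_rmw f r i a g \<rho>' v)
    then show ?thesis using inv_exec_rmw[OF inv t ready] by blast
  next
    case (safe_new r)
    let ?f = "\<lambda>_. Null"
    let ?g = "G t\<lparr>owned := (owned (G t))(fresh c \<mapsto> ?f), depth := Suc (depth (G t)),
      work := Suc (work (G t))\<rparr>"
    let ?h = "\<lambda>(a, i). if a = fresh c then Null else heap c (a, i)"
    have "heap_inv m h\<^sub>0 ?n (G(t := ?g)) ?h (Suc (fresh c))"
      by (rule heap_inv_write[OF heap t, where a = "fresh c" and f = ?f]) (use heap in \<open>auto simp: heap_inv_def\<close>)
    moreover have "m \<le> fresh c" "fresh c \<notin> dom (owned (G t))"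
      using heap t unfolding heap_inv_def by (blast, metis domD less_irrefl)
    ultimately have "\<exists>G \<delta>. config_inv P m S W Q h\<^sub>0 (finish (deps ?th) t
        (?th\<lparr>pc := Suc (pc ?th), regs := (regs ?th)(r := Ptr (fresh c))\<rparr>)
        (c\<lparr>heap := ?h, fresh := Suc (fresh c)\<rparr>)) G \<delta>"
      by (intro inv_exec_finish[OF inv t ready, where g = ?g])
        (use safe_new ready safe_bounds[OF safe] in auto)
    then show ?thesis using safe_new(2) by (simp add: exec_def Let_def)
  next
    case (safe_fork r l')
    then show ?thesis using inv_exec_fork[OF inv t ready] by blast
  next
    case (safe_join r u)
    then have "status (threads c ! u) = Terminated" using en by (auto simp: enabled_def Let_def)
    then show ?thesis using inv_exec_join[OF inv t ready safe_join(2,3)] by blast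
  next
    case safe_halt
    let ?g = "G t\<lparr>depth := Suc (depth (G t)), work := Suc (work (G t))\<rparr>"
    have "heap_inv m h\<^sub>0 ?n (G(t := ?g)) (heap c) (fresh c)"
      by (rule heap_inv_shrink[OF heap]) simp
    then have "\<exists>G \<delta>. config_inv P m S W Q h\<^sub>0 (finish (deps ?th) t (?th\<lparr>status := Terminated\<rparr>)
        (c\<lparr>heap := heap c, fresh := fresh c\<rparr>)) G \<delta>"
      by (intro inv_exec_finish[OF inv t ready, where g = ?g]) (use safe_halt in auto)
    then show ?thesis using safe_halt(2) by (simp add: exec_def Let_def)
  qed
qed

section \<open>Time steps: simultaneous instructions followed by servicing\<close>

lemma exec_other:
  assumes "\<And>r. P ! pc (threads c ! t) \<noteq> Resume r" "u < length (threads c)" "u \<noteq> t"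
  shows "u < length (threads (exec P t c))" "threads (exec P t c) ! u = threads c ! u"
  using assms
  by (auto simp: exec_def Let_def finish_def nth_append list_update_append split: instr.splits)

text \<open>A time step chooses threads enabled at its beginning but executes them one after
  another, so enabledness has to survive the instructions of the others. Only a join looks at
  another thread, and that thread stays terminated.\<close>

lemma enabled_exec:
  assumes inv: "config_inv P m S W Q h\<^sub>0 c G \<delta>"
    and t: "enabled P c t" and t': "enabled P c t'" and neq: "t' \<noteq> t"
  shows "enabled P (exec P t c) t'"
proof -
  let ?th = "threads c ! t'"
  have len: "t < length (threads c)" "t' < length (threads c)"
    and ready: "status (threads c ! t) = Ready" "status ?th = Ready"
    using t t' by (auto simp: enabled_def)
  have safe: "safe P m (max_depth (G u)) (max_work (G u)) (post (G u)) (pc (threads c ! u))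
      (regs (threads c ! u)) (owned (G u)) (tokens (G u)) (depth (G u)) (work (G u))"
    if "u \<in> {t, t'}" for u
    using inv len ready that by (auto simp: config_inv_def thread_inv_def)
  have "P ! pc (threads c ! t) \<noteq> Resume r" for r
    using safe[of t] by (cases rule: safe.cases) (auto simp: local_step_def)
  note other = exec_other[OF this]
  \<comment> \<open>The token makes \<open>u\<close> a valid index, so a thread appended by
    \<open>t\<close> cannot alter what is read there.\<close>
  have join: "u < length (threads c)" "u \<noteq> t"
    if *: "P ! pc ?th = Join r" "regs ?th r = Thread u" "status (threads c ! u) = Terminated" for r u
  proof -
    obtain Q' e where "tokens (G t') u = Some (Q', e)"
      using safe_joinD[OF safe[of t'] *(1)] *(2) by auto
    then show "u < length (threads c)"
      using inv len unfolding config_inv_def token_inv_def by metis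
    show "u \<noteq> t" using *(3) ready by auto
  qed
  have "\<exists>u. regs ?th r = Thread u \<and> status (threads (exec P t c) ! u) = Terminated"
    if "P ! pc ?th = Join r" for r
  proof -
    obtain u where "regs ?th r = Thread u" "status (threads c ! u) = Terminated"
      using t' \<open>P ! pc ?th = Join r\<close> by (auto simp: enabled_def Let_def)
    then show ?thesis using join[OF that] other(2) by auto
  qed
  then show ?thesis
    using t' other[OF len(2) neq] by (cases "P ! pc ?th") (simp_all add: enabled_def Let_def)
qed

lemma inv_fold_exec:
  assumes "config_inv P m S W Q h\<^sub>0 c G \<delta>" "distinct ts" "\<And>t. t \<in> set ts \<Longrightarrow> enabled P c t"
  shows "\<exists>G \<delta>. config_inv P m S W Q h\<^sub>0 (fold (exec P) ts c) G \<delta>"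
  using assms
proof (induction ts arbitrary: c G \<delta>)
  case (Cons t ts)
  obtain G' \<delta>' where *: "config_inv P m S W Q h\<^sub>0 (exec P t c) G' \<delta>'"
    using inv_exec Cons.prems by (metis list.set_intros(1))
  have "enabled P (exec P t c) u" if "u \<in> set ts" for u
    using enabled_exec Cons.prems that by (metis distinct.simps(2) list.set_intros)
  then show ?case using Cons.IH[OF *] Cons.prems by simp
qed auto

lemma serve_queue:
  assumes "queue_inv P (threads c) (queue c) (now c)"
  shows "queue (serve x c) = (queue c)(x := [])"
proof (cases "queue c x = []")
  case False
  then obtain t f where "queue c x = [(t, f, now c)]"
    using assms unfolding queue_inv_def by blast
  then show ?thesis by (simp add: serve_def Let_def split: prod.split)
qed (auto simp: serve_def)

lemma inv_fold_serve:
  assumes "config_inv P m S W Q h\<^sub>0 c G \<delta>"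
  shows "(\<exists>G \<delta>. config_inv P m S W Q h\<^sub>0 (fold serve xs c) G \<delta>) \<and>
    queue (fold serve xs c) = (\<lambda>x. if x \<in> set xs then [] else queue c x)"
  using assms
proof (induction xs arbitrary: c G \<delta>)
  case (Cons x xs)
  obtain G' \<delta>' where *: "config_inv P m S W Q h\<^sub>0 (serve x c) G' \<delta>'"
    using inv_serve Cons.prems by metis
  have "queue (serve x c) = (queue c)(x := [])"
    using serve_queue[of P c x] Cons.prems by (simp add: config_inv_def)
  then show ?case using Cons.IH[OF *] by (auto simp: fun_eq_iff)
qed auto

text \<open>An instruction either enters the DAG at once or leaves a request that is serviced in the
  same time step. This is why every time step lengthens the trace.\<close>

lemma exec_trace:
  "length (trace c) \<le> length (trace (exec P t c))"
  "length (trace c) < length (trace (exec P t c)) \<or> (\<exists>x. queue (exec P t c) x \<noteq> [])"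
  "queue c x \<noteq> [] \<Longrightarrow> queue (exec P t c) x \<noteq> []"
  by (auto simp: exec_def Let_def finish_def split: instr.splits if_splits)

lemma fold_exec_trace:
  "length (trace c) \<le> length (trace (fold (exec P) ts c))"
  "queue c x \<noteq> [] \<Longrightarrow> queue (fold (exec P) ts c) x \<noteq> []"
proof (induction ts arbitrary: c)
  case (Cons t ts)
  { case 1 show ?case using Cons.IH(1)[of "exec P t c"] exec_trace(1)[of c P t] by simp }
  { case 2 then show ?case using Cons.IH(2)[of "exec P t c"] exec_trace(3)[of c x P t] by simp }
qed auto

lemma serve_trace:
  "length (trace (serve x c)) = length (trace c) + (if queue c x = [] then 0 else 1)"
  by (auto simp: serve_def Let_def split: list.splits prod.splits)

lemma fold_serve_trace: "length (trace c) \<le> length (trace (fold serve xs c))"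
proof (induction xs arbitrary: c)
  case (Cons x xs)
  show ?case using Cons.IH[of "serve x c"] serve_trace[of x c] by simp
qed auto

text \<open>Holds between time steps, because a queue contains at most one request and every
  non-empty queue is served.\<close>

definition quiet :: "'a config \<Rightarrow> bool" where
  "quiet c \<longleftrightarrow> queue c = (\<lambda>_. [])"

lemma inv_step:
  assumes inv: "config_inv P m S W Q h\<^sub>0 c G \<delta>" and "quiet c" "step P c c'"
  shows "(\<exists>G \<delta>. config_inv P m S W Q h\<^sub>0 c' G \<delta>) \<and> quiet c' \<and> length (trace c) < length (trace c')"
proof -
  obtain ts xs c1 where ts: "distinct ts" "\<And>t. t \<in> set ts \<Longrightarrow> enabled P c t"
    and c1: "c1 = fold (exec P) ts c"
    and xs: "set xs = {x. queue c1 x \<noteq> []}" "ts \<noteq> [] \<or> xs \<noteq> []"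
    and c': "c' = (fold serve xs c1)\<lparr>now := Suc (now c)\<rparr>"
    using \<open>step P c c'\<close> unfolding step_def Let_def by blast
  obtain G1 \<delta>1 where inv1: "config_inv P m S W Q h\<^sub>0 c1 G1 \<delta>1"
    using inv_fold_exec[OF inv ts] c1 by auto
  obtain G2 \<delta>2 where inv2: "config_inv P m S W Q h\<^sub>0 (fold serve xs c1) G2 \<delta>2"
    using inv_fold_serve[OF inv1, of xs] by auto
  have q: "queue (fold serve xs c1) = (\<lambda>_. [])"
    using inv_fold_serve[OF inv1, of xs] xs(1) by (auto simp: fun_eq_iff)
  \<comment> \<open>With all queues empty no thread is blocked, so \<open>queue_inv\<close> holds
    for any time and the clock may advance.\<close>
  have "queue_inv P (threads c') (queue c') (now c')"
    using inv2 q by (auto simp: c' config_inv_def queue_inv_def)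
  then have "config_inv P m S W Q h\<^sub>0 c' G2 \<delta>2" using inv2 by (simp add: c' config_inv_def)
  moreover have "length (trace c) < length (trace c')"
  proof (cases ts)
    case Nil
    then show ?thesis using xs \<open>quiet c\<close> by (auto simp: c1 quiet_def)
  next
    case (Cons t us)
    have le: "length (trace (exec P t c)) \<le> length (trace c1)"
      using fold_exec_trace(1) by (auto simp: c1 Cons)
    consider "length (trace c) < length (trace (exec P t c))" | x where "queue (exec P t c) x \<noteq> []"
      using exec_trace(2) by blast
    then show ?thesis
    proof cases
      case 1
      then show ?thesis using le fold_serve_trace[of c1 xs] by (simp add: c')
    next
      case (2 x)
      then have "queue c1 x \<noteq> []" using fold_exec_trace(2)[of "exec P t c" x P us] by (simp add: c1 Cons)
      then have "x \<in> set xs" using xs(1) by simp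
      then obtain y ys where "xs = y # ys" by (cases xs) auto
      moreover from this have "y \<in> {x. queue c1 x \<noteq> []}" unfolding xs(1)[symmetric] by simp
      ultimately show ?thesis
        using le exec_trace(1)[of c P t] fold_serve_trace[of "serve y c1" ys] serve_trace[of y c1]
        by (simp add: c')
    qed
  qed
  ultimately show ?thesis using q by (auto simp: quiet_def c')
qed

section \<open>Progress, span and the soundness theorem\<close>

lemma inv_progress:
  assumes inv: "config_inv P m S W Q h\<^sub>0 c G \<delta>" and "quiet c" and stuck: "\<And>c'. \<not> step P c c'"
  shows "all_terminated c"
proof (rule ccontr)
  let ?live = "\<lambda>t. t < length (threads c) \<and> status (threads c ! t) \<noteq> Terminated"
  assume "\<not> all_terminated c"
  then have ex: "\<exists>t. ?live t" by (auto simp: all_terminated_def in_set_conv_nth)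
  \<comment> \<open>A safe thread waits only for threads of larger index, so the live thread of
    largest index waits for none that is alive.\<close>
  define t where "t = (GREATEST t. ?live t)"
  have t: "?live t" unfolding t_def by (rule GreatestI_ex_nat[OF ex, where b = "length (threads c)"]) auto
  have maximal: "u \<le> t" if "?live u" for u
    unfolding t_def by (rule Greatest_le_nat[where b = "length (threads c)"]) (use that in auto)
  let ?th = "threads c ! t"
  have "status ?th \<noteq> Blocked"
    using inv t \<open>quiet c\<close> by (auto simp: config_inv_def queue_inv_def quiet_def)
  then have ready: "status ?th = Ready"
    and safe: "safe P m (max_depth (G t)) (max_work (G t)) (post (G t)) (pc ?th) (regs ?th)
      (owned (G t)) (tokens (G t)) (depth (G t)) (work (G t))"
    using inv t by (auto simp: config_inv_def thread_inv_def intro: status.exhaust)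
  have "enabled P c t"
    using safe
  proof (cases rule: safe.cases)
    case (safe_join r u Q' e)
    then have "t < u" "u < length (threads c)"
      using inv t unfolding config_inv_def token_inv_def by metis+
    then have "status (threads c ! u) = Terminated" using maximal[of u] by fastforce
    then show ?thesis using safe_join t ready by (auto simp: enabled_def)
  qed (use t ready in \<open>auto simp: enabled_def Let_def local_step_def split: instr.splits val.splits\<close>)
  \<comment> \<open>A time step needs a list of all non-empty queues; here there is at most
    one.\<close>
  moreover have "finite {x. queue (exec P t c) x \<noteq> []}"
  proof -
    have "\<exists>y. {x. queue (exec P t c) x \<noteq> []} \<subseteq> {y}"
      using \<open>quiet c\<close>
      by (auto simp: exec_def Let_def finish_def quiet_def split: instr.splits)
    then show ?thesis using finite_subset by blast
  qed
  then obtain xs where "set xs = {x. queue (exec P t c) x \<noteq> []}" "distinct xs"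
    using finite_distinct_list by blast
  ultimately have "step P c ((fold serve xs (exec P t c))\<lparr>now := Suc (now c)\<rparr>)"
    unfolding step_def by (intro exI[of _ "[t]"] exI[of _ xs]) (simp add: Let_def)
  then show False using stuck by blast
qed

text \<open>Nodes have weight 1 and \<delta> grows strictly along edges from a positive value, so a
  path weighs at most \<delta> of its last node.\<close>

lemma dag_span_le:
  assumes "dag_inv S \<delta> G"
  shows "dag_span G \<le> S"
proof -
  have *: "(\<Sum>v\<leftarrow>p. fst (G ! v)) \<le> (if p = [] then 0 else \<delta> (last p))" if "dag_path G p" for p
    using that
  proof (induction p rule: rev_induct)
    case (snoc v p)
    have "dag_path G p" "v < length G"
      using snoc.prems by (auto simp: dag_path_def successively_append_iff)
    then have IH: "(\<Sum>v\<leftarrow>p. fst (G ! v)) \<le> (if p = [] then 0 else \<delta> (last p))" "fst (G ! v) = 1" "0 < \<delta> v"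
      using snoc.IH assms by (auto simp: dag_inv_def)
    moreover have "p \<noteq> [] \<Longrightarrow> \<delta> (last p) < \<delta> v"
      using snoc.prems assms
      by (auto simp: dag_path_def successively_append_iff dag_edges_def dag_inv_def)
    ultimately show ?case by (auto split: if_splits)
  qed simp
  have le: "x \<le> S" if x: "x \<in> {(\<Sum>v\<leftarrow>p. fst (G ! v)) | p. dag_path G p}" for x
  proof -
    obtain p where p: "x = (\<Sum>v\<leftarrow>p. fst (G ! v))" "dag_path G p" using x by blast
    have "\<delta> (last p) \<le> S" if "p \<noteq> []"
    proof -
      have "last p < length G"
        using p(2) last_in_set[OF that] by (auto simp: dag_path_def)
      then show ?thesis using assms by (simp add: dag_inv_def)
    qed
    then show ?thesis using *[OF p(2)] p(1) by (auto split: if_splits)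
  qed
  moreover have "finite {(\<Sum>v\<leftarrow>p. fst (G ! v)) | p. dag_path G p}"
    by (rule finite_subset[of _ "{..S}"]) (use le in auto)
  \<comment> \<open>The empty path makes the set of path weights non-empty, as \<open>Max\<close>
    requires.\<close>
  moreover have "dag_path G []" by (simp add: dag_path_def)
  ultimately show ?thesis unfolding dag_span_def by (subst Max_le_iff) blast+
qed

theorem safe_sound:
  assumes safe: "safe P m E K Q 0 \<rho> hp Map.empty 0 0"
    and hp: "\<forall>a f. hp a = Some f \<longrightarrow> a < m \<and> (\<forall>i. h (a, i) = f i)"
  shows "always_terminates P (initial_config h m \<rho>)"
    and "complete_execution P (initial_config h m \<rho>) c \<Longrightarrow>
      all_terminated c \<and>
      (\<exists>hp'. Q hp' \<and> (\<forall>a f. hp' a = Some f \<longrightarrow> (\<forall>i. heap c (a, i) = f i))) \<and>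
      (\<forall>a<m. \<forall>i<5. heap c (a, i) = h (a, i)) \<and>
      dag_work (trace c) \<le> K \<and> dag_span (trace c) \<le> E"
proof -
  let ?c0 = "initial_config h m \<rho>"
  let ?I = "\<lambda>c. (\<exists>G \<delta>. config_inv P m E K Q h c G \<delta>) \<and> quiet c"
  let ?g = "\<lparr>owned = hp, tokens = Map.empty, start = 0, depth = 0, max_depth = E, work = 0,
    max_work = K, post = Q\<rparr>"
  have "config_inv P m E K Q h ?c0 (\<lambda>_. ?g) (\<lambda>_. 0)"
    using safe hp
    by (auto simp: config_inv_def initial_config_def thread_inv_def heap_inv_def token_inv_def
        queue_inv_def dag_inv_def remaining_def)
  then have I0: "?I ?c0" by (auto simp: quiet_def initial_config_def)
  have I_step: "?I c' \<and> length (trace c) < length (trace c')" if "?I c" "step P c c'" for c c'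
    using inv_step that by blast
  show "always_terminates P ?c0"
    unfolding always_terminates_def
  proof
    assume "\<exists>f. f 0 = ?c0 \<and> (\<forall>i. step P (f i) (f (Suc i)))"
    then obtain f where f: "f 0 = ?c0" "\<And>i. step P (f i) (f (Suc i))" by blast
    have "?I (f i) \<and> i \<le> length (trace (f i))" for i
    proof (induction i)
      case (Suc i)
      then show ?case using I_step[OF _ f(2)[of i]] by fastforce
    qed (use f(1) I0 in simp)
    \<comment> \<open>Every time step lengthens the trace, whose length never exceeds
      \<open>K\<close>; so no run has \<open>Suc K\<close> steps.\<close>
    then obtain G \<delta> where "config_inv P m E K Q h (f (Suc K)) G \<delta>" "Suc K \<le> length (trace (f (Suc K)))"
      by blast
    then show False by (simp add: config_inv_def)
  qed
  assume "complete_execution P ?c0 c"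
  then have run: "(step P)\<^sup>*\<^sup>* ?c0 c" and stuck: "\<And>c'. \<not> step P c c'"
    by (auto simp: complete_execution_def)
  from run have "?I c"
    by (induction rule: rtranclp_induct) (use I0 I_step in blast)+
  then obtain G \<delta> where inv: "config_inv P m E K Q h c G \<delta>" and "quiet c" by blast
  then have all: "all_terminated c" using inv_progress stuck by blast
  have root: "0 < length (threads c)" "post (G 0) = Q" using inv by (auto simp: config_inv_def)
  then have "status (threads c ! 0) = Terminated" using all by (auto simp: all_terminated_def)
  then have "Q (owned (G 0))" using inv root by (auto simp: config_inv_def thread_inv_def)
  moreover have "heap c (a, i) = f i" if "owned (G 0) a = Some f" for a f i
    using inv root(1) that by (auto simp: config_inv_def heap_inv_def)
  moreover have "dag_work (trace c) \<le> K"
  proof -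
    have "dag_work (trace c) = length (trace c)"
      using inv by (simp add: dag_work_def config_inv_def dag_inv_def)
    then show ?thesis using inv by (simp add: config_inv_def)
  qed
  moreover have "dag_span (trace c) \<le> E"
    using inv dag_span_le by (auto simp: config_inv_def)
  moreover have "\<forall>a<m. \<forall>i<5. heap c (a, i) = h (a, i)"
    using inv by (simp add: config_inv_def heap_inv_def)
  ultimately show "all_terminated c \<and>
      (\<exists>hp'. Q hp' \<and> (\<forall>a f. hp' a = Some f \<longrightarrow> (\<forall>i. heap c (a, i) = f i))) \<and>
      (\<forall>a<m. \<forall>i<5. heap c (a, i) = h (a, i)) \<and>
      dag_work (trace c) \<le> K \<and> dag_span (trace c) \<le> E"
    using all by blast
qed

section \<open>The program\<close>

text \<open>The numbers in the comments are labels; empty batches and sets are the pointer \<open>Null\<close>.\<close>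

definition search_program :: program where
  "search_program =
    [ \<comment> \<open>0: search the set at register 0 for the batch at register 1\<close>
      Set_Null 2, Jump_Eq 1 2 22, Move 5 2, Jump_Eq 0 2 23,
      RMW (Read 3) 0 0, RMW (Read 5) 0 2, Set_Int 4 0, Jump_Eq 3 4 23,
      Fork 6 47, Join 6,
      RMW (Read 7) 0 3, RMW (Read 8) 0 4, RMW (Read 9) 1 7, RMW (Read 10) 1 8,
      Move 0 7, Move 1 9, Fork 6 0, Move 0 8, Move 1 10, Fork 7 0, Join 6, Join 7, Halt,
      \<comment> \<open>23\<close>
      Fork 6 26, Join 6, Halt,
      \<comment> \<open>26: tag the batch at register 1, given a leaf at register 0 with its item in register 5\<close>
      RMW (Read 3) 1 0, Set_Int 4 0, Jump_Eq 3 4 38,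
      RMW (Read 7) 1 3, RMW (Read 8) 1 4,
      Move 1 7, Fork 6 26, Move 1 8, Fork 7 26, Join 6, Join 7, Halt,
      \<comment> \<open>38\<close>
      RMW (Read 3) 1 2, Jump_Eq 3 5 43, Set_Int 3 0, RMW (Write 3) 1 5, Halt,
      \<comment> \<open>43\<close>
      Set_Int 3 1, RMW (Write 3) 1 5, RMW (Write 0) 1 6, Halt,
      \<comment> \<open>47: split the batch at register 1 by the key in register 5\<close>
      RMW (Read 3) 1 0, Set_Int 4 0, Set_Null 2, Jump_Eq 3 4 85,
      RMW (Read 7) 1 3, RMW (Read 8) 1 4, Move 9 1,
      Move 1 7, Fork 10 47, Move 1 8, Fork 11 47, Join 10, Join 11,
      \<comment> \<open>60\<close>
      RMW (Read 12) 7 7, RMW (Read 13) 8 7,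
      Move 14 13, Jump_Eq 12 2 71, Move 14 12, Jump_Eq 13 2 71,
      New 14, Set_Int 3 1, RMW (Write 3) 14 0, RMW (Write 12) 14 3, RMW (Write 13) 14 4,
      \<comment> \<open>71\<close>
      RMW (Write 14) 9 7,
      RMW (Read 12) 7 8, RMW (Read 13) 8 8,
      Move 14 13, Jump_Eq 12 2 83, Move 14 12, Jump_Eq 13 2 83,
      New 14, Set_Int 3 1, RMW (Write 3) 14 0, RMW (Write 12) 14 3, RMW (Write 13) 14 4,
      \<comment> \<open>83\<close>
      RMW (Write 14) 9 8, Halt,
      \<comment> \<open>85\<close>
      RMW (Read 3) 1 2, Jump_Less 5 3 90, RMW (Write 1) 1 7, RMW (Write 2) 1 8, Halt,
      \<comment> \<open>90\<close>
      RMW (Write 2) 1 7, RMW (Write 1) 1 8, Halt]"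

section \<open>Symbolic execution of code and proof rules for calls\<close>

definition simple_step :: "addr \<Rightarrow> instr \<Rightarrow> label \<times> 'a::linorder regs \<times> 'a frag \<Rightarrow>
    (label \<times> 'a regs \<times> 'a frag) option" where
  "simple_step m i = (\<lambda>(l, \<rho>, h).
     case i of
       RMW (Read d) r j \<Rightarrow>
         (case h (the_addr (\<rho> r)) of
            Some g \<Rightarrow> if \<rho> r = Ptr (the_addr (\<rho> r)) then Some (Suc l, \<rho>(d := g j), h) else None
          | None \<Rightarrow> None)
     | RMW (Write s) r j \<Rightarrow>
         (case h (the_addr (\<rho> r)) of
            Some g \<Rightarrow>
              if \<rho> r = Ptr (the_addr (\<rho> r)) \<and> (5 \<le> j \<or> m \<le> the_addr (\<rho> r))
              then Some (Suc l, \<rho>, h(the_addr (\<rho> r) \<mapsto> g(j := \<rho> s))) else None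
          | None \<Rightarrow> None)
     | _ \<Rightarrow> map_option (\<lambda>(l', \<rho>'). (l', \<rho>', h)) (local_step i l \<rho>))"

lemma safe_simple_step:
  assumes "l < length P" "simple_step m (P ! l) (l, \<rho>, h) = Some (l', \<rho>', h')"
    "safe P m E K Q l' \<rho>' h' tok (Suc d) (Suc k)"
  shows "safe P m E K Q l \<rho> h tok d k"
proof (cases "local_step (P ! l) l \<rho>")
  case (Some x)
  then have "local_step (P ! l) l \<rho> = Some (l', \<rho>')" "h' = h"
    using assms(2) by (auto simp: simple_step_def local_step_def split: instr.splits)
  then show ?thesis using assms safe_local by blast
next
  case None
  then obtain f r j where f: "P ! l = RMW f r j" "\<exists>s. f = Read s \<or> f = Write s"
    using assms(2) by (auto simp: simple_step_def split: instr.splits rmw.splits)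
  then obtain a g where a: "\<rho> r = Ptr a" "h a = Some g"
    using assms(2) by (auto simp: simple_step_def split: option.splits if_splits)
  obtain v where v: "perform f \<rho> (g j) = (\<rho>', v)" "v = g j \<or> 5 \<le> j \<or> m \<le> a"
      "l' = Suc l" "h' = h(a \<mapsto> g(j := v))"
    using assms(2) f a by (auto simp: simple_step_def map_upd_triv split: if_splits)
  show ?thesis
    by (rule safe_rmw[where h = h and g = g and v = v, OF assms(1) f(1) a v(1,2)]) (use v assms in simp)
qed

text \<open>With a literal number of steps and the literal program, \<open>simp\<close> runs a piece
  of code in one go, jumps included. Allocation, fork, join and halting remain for the rules of
  \<open>safe\<close>.\<close>

fun simple_steps :: "addr \<Rightarrow> program \<Rightarrow> nat \<Rightarrow> label \<times> 'a::linorder regs \<times> 'a frag \<Rightarrow>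
    (label \<times> 'a regs \<times> 'a frag) option" where
  "simple_steps m P 0 s = Some s"
| "simple_steps m P (Suc n) s =
     (if fst s < length P
      then Option.bind (simple_step m (P ! fst s) s) (simple_steps m P n) else None)"

lemma simple_steps_numeral [simp]:
  "simple_steps m P (numeral n) s =
     (if fst s < length P
      then Option.bind (simple_step m (P ! fst s) s) (simple_steps m P (pred_numeral n)) else None)"
  by (simp add: numeral_eq_Suc)

lemma safe_simple_steps:
  assumes "simple_steps m P n (l, \<rho>, h) = Some (l', \<rho>', h')"
    "safe P m E K Q l' \<rho>' h' tok (d + n) (k + n)"
  shows "safe P m E K Q l \<rho> h tok d k"
  using assms
proof (induction n arbitrary: l \<rho> h d k)
  case (Suc n)
  then obtain l1 \<rho>1 h1 where "l < length P" "simple_step m (P ! l) (l, \<rho>, h) = Some (l1, \<rho>1, h1)"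
      "simple_steps m P n (l1, \<rho>1, h1) = Some (l', \<rho>', h')"
    by (auto split: if_splits bind_splits)
  then show ?case using Suc.IH[of l1 \<rho>1 h1 "Suc d" "Suc k"] Suc.prems safe_simple_step by simp
qed simp


lemma safe_weaken:
  assumes "safe P m E K Q l \<rho> h tok d k" "d' \<le> d" "k' \<le> k"
  shows "safe P m E K Q l \<rho> h tok d' k'"
  using safe_mono[OF assms] by blast

text \<open>A fork joined at once serves as a subroutine call: the callee works on a copy of the
  registers, which takes the place of a stack. The continuation is stated for any fragment extending
  both memories, which hides how they are combined.\<close>

lemma safe_call:
  assumes code: "Suc l < length P" "P ! l = Fork r l'" "P ! Suc l = Join r"
    and callee: "safe P m E' K' Q' l' \<rho> (h |` A) Map.empty 0 0"
    and bounds: "d + 2 + E' < E" "k + 2 + K' < K"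
    and cont: "\<And>u h' h''. Q' h' \<Longrightarrow> dom h' \<inter> dom (h |` (- A)) = {} \<Longrightarrow> h' \<subseteq>\<^sub>m h'' \<Longrightarrow>
      h |` (- A) \<subseteq>\<^sub>m h'' \<Longrightarrow>
      safe P m E K Q (Suc (Suc l)) (\<rho>(r := Thread u)) h'' Map.empty (d + 2 + E') (k + 2 + K')"
  shows "safe P m E K Q l \<rho> h Map.empty d k"
proof (rule safe_fork[OF _ code(2) callee])
  fix u :: tid
  show "safe P m E K Q (Suc l) (\<rho>(r := Thread u)) (h |` (- A)) [u \<mapsto> (Q', Suc d + E')]
      (Suc d) (Suc k + K')"
  proof (rule safe_join[OF code(1,3)])
    fix h' assume h': "Q' h'" "dom h' \<inter> dom (h |` (- A)) = {}"
    have "safe P m E K Q (Suc (Suc l)) (\<rho>(r := Thread u)) (h |` (- A) ++ h') Map.empty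
        (d + 2 + E') (k + 2 + K')"
    proof (rule cont[OF h'])
      show "h |` (- A) \<subseteq>\<^sub>m h |` (- A) ++ h'"
        using h'(2) by (auto simp: map_le_def map_add_def split: option.splits)
    qed simp
    then show "safe P m E K Q (Suc (Suc l)) (\<rho>(r := Thread u)) (h |` (- A) ++ h')
        (([u \<mapsto> (Q', Suc d + E')])(u := None)) (Suc (max (Suc d) (Suc d + E'))) (Suc (Suc k + K'))"
      by (auto elim: safe_weaken)
  qed (use bounds in auto)
qed (use code bounds in auto)

text \<open>
  Two calls in parallel; \<open>n\<close> instructions between the forks set up the arguments of the second.
\<close>

lemma safe_par:
  assumes code: "Suc (Suc lm) < length P" "l < length P" "P ! l = Fork r lx" "P ! lm = Fork r' ly"
      "P ! Suc lm = Join r" "P ! Suc (Suc lm) = Join r'" "r \<noteq> r'"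
    and disj: "A \<inter> B = {}"
    and args: "\<And>u. simple_steps m P n (Suc l, \<rho>(r := Thread u), h |` (- A)) =
      Some (lm, \<rho>'(r := Thread u), h |` (- A))"
    and callee1: "safe P m E1 K1 Q1 lx \<rho> (h |` A) Map.empty 0 0"
    and callee2: "\<And>u. safe P m E2 K2 Q2 ly (\<rho>'(r := Thread u)) (h |` B) Map.empty 0 0"
    and bounds: "d + n + 4 + max E1 E2 < E" "k + n + 4 + K1 + K2 < K"
    and cont: "\<And>u v h1 h2 h'. Q1 h1 \<Longrightarrow> Q2 h2 \<Longrightarrow> dom h1 \<inter> dom h2 = {} \<Longrightarrow>
      dom h1 \<inter> dom (h |` (- (A \<union> B))) = {} \<Longrightarrow> dom h2 \<inter> dom (h |` (- (A \<union> B))) = {} \<Longrightarrow>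
      h1 \<subseteq>\<^sub>m h' \<Longrightarrow> h2 \<subseteq>\<^sub>m h' \<Longrightarrow> h |` (- (A \<union> B)) \<subseteq>\<^sub>m h' \<Longrightarrow>
      safe P m E K Q (Suc (Suc (Suc lm))) (\<rho>'(r := Thread u, r' := Thread v)) h' Map.empty
        (d + n + 4 + max E1 E2) (k + n + 4 + K1 + K2)"
  shows "safe P m E K Q l \<rho> h Map.empty d k"
proof (rule safe_fork[OF code(2,3) callee1])
  fix u :: tid
  let ?h = "h |` (- (A \<union> B))"
  have B: "(h |` (- A)) |` B = h |` B" using disj by (auto simp: restrict_map_def fun_eq_iff)
  have rest: "(h |` (- A)) |` (- B) = ?h" by (auto simp: restrict_map_def fun_eq_iff)
  let ?tok = "[u \<mapsto> (Q1, Suc d + E1)]"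
  have "safe P m E K Q lm (\<rho>'(r := Thread u)) (h |` (- A)) ?tok (Suc d + n) (Suc k + K1 + n)"
  proof (rule safe_fork[OF _ code(4), where A = B])
    show "safe P m E2 K2 Q2 ly (\<rho>'(r := Thread u)) (h |` (- A) |` B) Map.empty 0 0"
      using callee2 B by simp
    fix v :: tid assume "v \<notin> dom ?tok"
    \<comment> \<open>The second handle differs from the first, so the first token survives the
      update until it is joined.\<close>
    then have v: "v \<noteq> u" by simp
    let ?tok2 = "?tok(v \<mapsto> (Q2, Suc (Suc d + n) + E2))"
    let ?\<rho> = "\<rho>'(r := Thread u, r' := Thread v)"
    have "safe P m E K Q (Suc lm) ?\<rho> ?h ?tok2 (Suc (Suc d + n)) (Suc (Suc k + K1 + n) + K2)"
    proof (rule safe_join[OF _ code(5)])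
      show "?\<rho> r = Thread u" "?tok2 u = Some (Q1, Suc d + E1)" using code(7) v by auto
      fix h1 assume h1: "Q1 h1" "dom h1 \<inter> dom ?h = {}"
      let ?d = "Suc (max (Suc (Suc d + n)) (Suc d + E1))"
      have "safe P m E K Q (Suc (Suc lm)) ?\<rho> (?h ++ h1) [v \<mapsto> (Q2, Suc (Suc d + n) + E2)]
          ?d (Suc (Suc (Suc k + K1 + n) + K2))"
      proof (rule safe_join[OF code(1,6)])
        fix h2 assume h2: "Q2 h2" "dom h2 \<inter> dom (?h ++ h1) = {}"
        have "safe P m E K Q (Suc (Suc (Suc lm))) ?\<rho> (?h ++ h1 ++ h2) Map.empty
            (d + n + 4 + max E1 E2) (k + n + 4 + K1 + K2)"
        proof (rule cont[OF h1(1) h2(1)])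
          show "h1 \<subseteq>\<^sub>m ?h ++ h1 ++ h2" "?h \<subseteq>\<^sub>m ?h ++ h1 ++ h2"
            using h1 h2 by (auto simp: map_le_def map_add_def split: option.splits)
        qed (use h1 h2 in auto)
        then show "safe P m E K Q (Suc (Suc (Suc lm))) ?\<rho> (?h ++ h1 ++ h2)
            (([v \<mapsto> (Q2, Suc (Suc d + n) + E2)])(v := None))
            (Suc (max ?d (Suc (Suc d + n) + E2))) (Suc (Suc (Suc (Suc k + K1 + n) + K2)))"
          by (auto elim!: safe_weaken)
      qed (use bounds code in auto)
      moreover have "?tok2(u := None) = [v \<mapsto> (Q2, Suc (Suc d + n) + E2)]"
        using v by (auto simp: fun_eq_iff)
      ultimately show "safe P m E K Q (Suc (Suc lm)) ?\<rho> (?h ++ h1) (?tok2(u := None))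
          ?d (Suc (Suc (Suc k + K1 + n) + K2))"
        by (simp only:)
    qed (use bounds code in auto)
    then show "safe P m E K Q (Suc lm) ?\<rho> (h |` (- A) |` (- B)) ?tok2
        (Suc (Suc d + n)) (Suc (Suc k + K1 + n) + K2)"
      unfolding rest .
  qed (use bounds code in auto)
  then show "safe P m E K Q (Suc l) (\<rho>(r := Thread u)) (h |` (- A)) ?tok (Suc d) (Suc k + K1)"
    by (rule safe_simple_steps[OF args])
qed (use bounds in auto)

section \<open>Batches and sets in fragments\<close>

text \<open>The cells 0 to 4 hold the structure of the trees, whereas tags and returned parts go to
  higher cells. So one relation covers restriction, extension and the writes to old nodes.\<close>

definition keeps :: "addr set \<Rightarrow> 'a frag \<Rightarrow> 'a frag \<Rightarrow> bool" where
  "keeps A h h' \<longleftrightarrow> (\<forall>a\<in>A. \<forall>g. h a = Some g \<longrightarrow> (\<exists>g'. h' a = Some g' \<and> (\<forall>i<5. g' i = g i)))"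

lemma keeps_restrict: "A \<subseteq> B \<Longrightarrow> keeps A h (h |` B)"
  by (auto simp: keeps_def restrict_map_def)

lemma keeps_map_le: "h \<subseteq>\<^sub>m h' \<Longrightarrow> keeps A h h'"
  unfolding keeps_def map_le_def by (metis domI)

lemma keeps_upd: "h a = Some g \<Longrightarrow> \<forall>i<5. g' i = g i \<Longrightarrow> keeps A h (h(a \<mapsto> g'))"
  by (auto simp: keeps_def)

lemma keeps_trans: "keeps A h h' \<Longrightarrow> keeps A h' h'' \<Longrightarrow> keeps A h h''"
  unfolding keeps_def by metis

fun bbt_in :: "'a frag \<Rightarrow> 'a val \<Rightarrow> 'a bbt \<Rightarrow> bool" where
  "bbt_in h p (Query a x) \<longleftrightarrow>
     p = Ptr a \<and> (\<exists>g. h a = Some g \<and> g 0 = Integer 0 \<and> g 2 = Item x)"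
| "bbt_in h p (Branch a l r) \<longleftrightarrow>
     p = Ptr a \<and> (\<exists>g. h a = Some g \<and> g 0 = Integer 1 \<and> bbt_in h (g 3) l \<and> bbt_in h (g 4) r)"

fun rbt_in :: "'a frag \<Rightarrow> 'a val \<Rightarrow> 'a rbt \<Rightarrow> bool" where
  "rbt_in h p (RB_Leaf a x) \<longleftrightarrow>
     p = Ptr a \<and> (\<exists>g. h a = Some g \<and> g 0 = Integer 0 \<and> g 2 = Item x)"
| "rbt_in h p (RB_Node a c k l r) \<longleftrightarrow>
     p = Ptr a \<and> (\<exists>g. h a = Some g \<and> g 0 = Integer 1 \<and> g 2 = Item k \<and>
       rbt_in h (g 3) l \<and> rbt_in h (g 4) r)"

lemma bbt_in_keeps: "bbt_in h p T \<Longrightarrow> keeps (set (bbt_addrs T)) h h' \<Longrightarrow> bbt_in h' p T"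
  by (induction T arbitrary: p) (fastforce simp: keeps_def)+

lemma rbt_in_keeps: "rbt_in h p R \<Longrightarrow> keeps (set (rbt_addrs R)) h h' \<Longrightarrow> rbt_in h' p R"
  by (induction R arbitrary: p) (fastforce simp: keeps_def)+

lemma bbt_in_dom: "bbt_in h p T \<Longrightarrow> set (bbt_addrs T) \<subseteq> dom h"
  by (induction T arbitrary: p) fastforce+

lemma rbt_in_dom: "rbt_in h p R \<Longrightarrow> set (rbt_addrs R) \<subseteq> dom h"
  by (induction R arbitrary: p) fastforce+

definition batch_in :: "'a frag \<Rightarrow> 'a val \<Rightarrow> 'a bbt option \<Rightarrow> bool" where
  "batch_in h p B \<longleftrightarrow> (case B of None \<Rightarrow> p = Null | Some T \<Rightarrow> bbt_in h p T)"

definition batch_addrs :: "'a bbt option \<Rightarrow> addr list" where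
  "batch_addrs B = (case B of None \<Rightarrow> [] | Some T \<Rightarrow> bbt_addrs T)"

definition batch_height :: "'a bbt option \<Rightarrow> nat" where
  "batch_height B = (case B of None \<Rightarrow> 0 | Some T \<Rightarrow> bbt_height T)"

lemma batch_simps [simp]:
  "batch_in h p None \<longleftrightarrow> p = Null" "batch_in h p (Some T) \<longleftrightarrow> bbt_in h p T"
  "batch_addrs None = []" "batch_addrs (Some T) = bbt_addrs T"
  "batch_height None = 0" "batch_height (Some T) = bbt_height T"
  "batch_queries None = []" "batch_queries (Some T) = bbt_queries T"
  by (simp_all add: batch_in_def batch_addrs_def batch_height_def batch_queries_def)

lemma batch_in_keeps: "batch_in h p B \<Longrightarrow> keeps (set (batch_addrs B)) h h' \<Longrightarrow> batch_in h' p B"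
  by (cases B) (auto intro: bbt_in_keeps)

lemma batch_in_dom: "batch_in h p B \<Longrightarrow> set (batch_addrs B) \<subseteq> dom h"
  by (cases B) (auto dest!: bbt_in_dom)

lemma bbt_in_not_Null [simp]: "\<not> bbt_in h Null T"
  by (cases T) auto

text \<open>Tagging and splitting are charged per node of the batch; this turns the charge into one
  per query.\<close>

lemma length_bbt_addrs: "Suc (length (bbt_addrs T)) = 2 * length (bbt_queries T)"
  by (induction T) auto

section \<open>Tagging a batch\<close>

lemmas steps_simps = search_program_def simple_step_def local_step_def

text \<open>Refers to a list of leaves instead of a tree, so that it also applies to the empty set
  and is easy to combine over two subtrees.\<close>

definition item_tagged :: "(addr \<times> 'a) list \<Rightarrow> 'a \<Rightarrow> (nat \<Rightarrow> 'a val) \<Rightarrow> bool" where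
  "item_tagged ls x f \<longleftrightarrow>
     (if x \<in> snd ` set ls then f 5 = Integer 1 \<and> (\<exists>l. (l, x) \<in> set ls \<and> f 6 = Ptr l)
      else f 5 = Integer 0)"

definition tagged_in :: "(addr \<times> 'a) list \<Rightarrow> (addr \<times> 'a) list \<Rightarrow> 'a frag \<Rightarrow> bool" where
  "tagged_in ls qs h \<longleftrightarrow> (\<forall>(a, x)\<in>set qs. \<exists>f. h a = Some f \<and> item_tagged ls x f)"

lemma tagged_in_map_le: "tagged_in ls qs h \<Longrightarrow> h \<subseteq>\<^sub>m h' \<Longrightarrow> tagged_in ls qs h'"
  unfolding tagged_in_def map_le_def by (fastforce simp: dom_def)

lemma tagged_in_append: "tagged_in ls (qs @ qs') h \<longleftrightarrow> tagged_in ls qs h \<and> tagged_in ls qs' h"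
  by (simp add: tagged_in_def ball_Un)

text \<open>The empty set is handled like a leaf whose item is \<open>Null\<close>, since no query
  item equals \<open>Null\<close>. The factor 20 has room to spare: a branch takes 12 instructions
  of its own and a query at most 9.\<close>

lemma safe_tag:
  fixes T :: "'a::linorder bbt"
  assumes "bbt_in h (\<rho> 1) T" "distinct (bbt_addrs T)"
    and "ls = [] \<and> \<rho> 5 = Null \<or> (\<exists>l y. ls = [(l, y)] \<and> \<rho> 0 = Ptr l \<and> \<rho> 5 = Item y)"
  shows "safe search_program m (20 * (bbt_height T + 1)) (20 * length (bbt_addrs T))
    (tagged_in ls (bbt_queries T)) 26 \<rho> h Map.empty 0 0"
  using assms
proof (induction T arbitrary: \<rho> h)
  case (Query a x)
  then obtain g where g: "\<rho> 1 = Ptr a" "h a = Some g" "g 0 = Integer 0" "g 2 = Item x" by auto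
  show ?case
  proof (cases "\<rho> 5 = Item x")
    case True
    then obtain l where l: "ls = [(l, x)]" "\<rho> 0 = Ptr l" using Query by auto
    let ?f = "g(5 := Integer 1, 6 := Ptr l)"
    have "\<exists>\<rho>'. simple_steps m search_program 8 (26, \<rho>, h) = Some (46, \<rho>', h(a \<mapsto> ?f))"
      using g True l by (simp add: steps_simps)
    then obtain \<rho>' where *: "simple_steps m search_program 8 (26, \<rho>, h) = Some (46, \<rho>', h(a \<mapsto> ?f))"
      by blast
    show ?thesis
      by (rule safe_simple_steps[OF *], rule safe_halt)
        (use l in \<open>auto simp: search_program_def tagged_in_def item_tagged_def\<close>)
  next
    case False
    then have l: "x \<notin> snd ` set ls" using Query by auto
    let ?f = "g(5 := Integer 0)"
    have "\<exists>\<rho>'. simple_steps m search_program 7 (26, \<rho>, h) = Some (42, \<rho>', h(a \<mapsto> ?f))"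
      using g False l by (simp add: steps_simps)
    then obtain \<rho>' where *: "simple_steps m search_program 7 (26, \<rho>, h) = Some (42, \<rho>', h(a \<mapsto> ?f))"
      by blast
    show ?thesis
      by (rule safe_simple_steps[OF *], rule safe_halt)
        (use l in \<open>auto simp: search_program_def tagged_in_def item_tagged_def\<close>)
  qed
next
  case (Branch a l r)
  then obtain g where g: "\<rho> 1 = Ptr a" "h a = Some g" "g 0 = Integer 1"
    and in_h: "bbt_in h (g 3) l" "bbt_in h (g 4) r" by auto
  have "\<exists>\<rho>'. simple_steps m search_program 6 (26, \<rho>, h) = Some (32, \<rho>', h) \<and>
      \<rho>' 1 = g 3 \<and> \<rho>' 8 = g 4 \<and> \<rho>' 5 = \<rho> 5 \<and> \<rho>' 0 = \<rho> 0"
    using g by (simp add: steps_simps)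
  then obtain \<rho>' where steps: "simple_steps m search_program 6 (26, \<rho>, h) = Some (32, \<rho>', h)"
    and \<rho>': "\<rho>' 1 = g 3" "\<rho>' 8 = g 4" "\<rho>' 5 = \<rho> 5" "\<rho>' 0 = \<rho> 0" by blast
  show ?case
  proof (rule safe_simple_steps[OF steps],
      rule safe_par[where A = "set (bbt_addrs l)" and B = "set (bbt_addrs r)" and n = 1
        and r = 6 and r' = 7 and lx = 26 and lm = 34 and ly = 26 and \<rho>' = "\<rho>'(1 := g 4)"])
    show "safe search_program m (20 * (bbt_height l + 1)) (20 * length (bbt_addrs l))
        (tagged_in ls (bbt_queries l)) 26 \<rho>' (h |` set (bbt_addrs l)) Map.empty 0 0"
      by (rule Branch.IH) (use Branch.prems \<rho>' bbt_in_keeps[OF in_h(1)] keeps_restrict in auto)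
    show "safe search_program m (20 * (bbt_height r + 1)) (20 * length (bbt_addrs r))
        (tagged_in ls (bbt_queries r)) 26 (\<rho>'(1 := g 4, 6 := Thread u))
        (h |` set (bbt_addrs r)) Map.empty 0 0" for u
      by (rule Branch.IH) (use Branch.prems \<rho>' bbt_in_keeps[OF in_h(2)] keeps_restrict in auto)
    show "simple_steps m search_program 1
        (Suc 32, \<rho>'(6 := Thread u), h |` (- set (bbt_addrs l))) =
        Some (34, \<rho>'(1 := g 4, 6 := Thread u), h |` (- set (bbt_addrs l)))" for u
      using \<rho>'(2) by (simp add: steps_simps fun_upd_twist)
  next
    fix u v h1 h2 h'
    assume "tagged_in ls (bbt_queries l) h1" "tagged_in ls (bbt_queries r) h2"
      "h1 \<subseteq>\<^sub>m h'" "h2 \<subseteq>\<^sub>m h'"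
    then have "tagged_in ls (bbt_queries (Branch a l r)) h'"
      by (auto simp: tagged_in_append intro: tagged_in_map_le)
    then show "safe search_program m (20 * (bbt_height (Branch a l r) + 1))
      (20 * length (bbt_addrs (Branch a l r))) (tagged_in ls (bbt_queries (Branch a l r)))
      (Suc (Suc (Suc 34))) (\<rho>'(1 := g 4, 6 := Thread u, 7 := Thread v)) h' Map.empty
      (0 + 6 + 1 + 4 + max (20 * (bbt_height l + 1)) (20 * (bbt_height r + 1)))
      (0 + 6 + 1 + 4 + 20 * length (bbt_addrs l) + 20 * length (bbt_addrs r))"
      by (intro safe_halt) (auto simp: search_program_def)
  qed (use Branch.prems in \<open>auto simp: search_program_def\<close>)
qed

section \<open>Splitting a batch\<close>

text \<open>
  The code from label \<open>l\<close> on joins two batches, omitting the branch if one of them is empty;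
  hence a batch that results from splitting is never higher than the original one.
\<close>

lemma safe_merge:
  fixes B C :: "'a::linorder bbt option"
  assumes l: "l = 62 \<or> l = 74" and null: "\<rho> 2 = Null"
    and B: "batch_in h (\<rho> 12) B" and C: "batch_in h (\<rho> 13) C"
    and dist: "distinct (batch_addrs B @ batch_addrs C)"
    and bounds: "d + 9 < E" "k + 9 < K"
    and cont: "\<And>\<rho>' h' D. h \<subseteq>\<^sub>m h' \<Longrightarrow> batch_in h' (\<rho>' 14) D \<Longrightarrow>
      batch_queries D = batch_queries B @ batch_queries C \<Longrightarrow>
      set (batch_addrs D) \<subseteq> set (batch_addrs B) \<union> set (batch_addrs C) \<union> (- dom h) \<Longrightarrow>
      distinct (batch_addrs D) \<Longrightarrow>
      batch_height D \<le> Suc (max (batch_height B) (batch_height C)) \<Longrightarrow>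
      (\<And>r. r \<noteq> 3 \<Longrightarrow> r \<noteq> 14 \<Longrightarrow> \<rho>' r = \<rho> r) \<Longrightarrow>
      safe search_program m E K Q (l + 9) \<rho>' h' Map.empty (d + 9) (k + 9)"
  shows "safe search_program m E K Q l \<rho> h Map.empty d k"
proof (cases B)
  case None
  have steps: "simple_steps m search_program 2 (l, \<rho>, h) = Some (l + 9, \<rho>(14 := \<rho> 13), h)"
    using l null B None by (auto simp: steps_simps)
  \<comment> \<open>The shorter paths are charged the 9 units of the longest one, so that the
    continuation has a single cost.\<close>
  show ?thesis
    by (rule safe_simple_steps[OF steps], rule safe_weaken[OF cont[where D = C]])
      (use None C dist in auto)
next
  case (Some T)
  then have "\<rho> 12 \<noteq> Null" using B by auto
  show ?thesis
  proof (cases C)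
    case None
    have steps: "simple_steps m search_program 4 (l, \<rho>, h) = Some (l + 9, \<rho>(14 := \<rho> 12), h)"
      using l null C None \<open>\<rho> 12 \<noteq> Null\<close> by (auto simp: steps_simps)
    show ?thesis
      by (rule safe_simple_steps[OF steps], rule safe_weaken[OF cont[where D = B]])
        (use None B dist in auto)
  next
    case (Some U)
    then have "\<rho> 13 \<noteq> Null" using C by auto
    have steps: "simple_steps m search_program 4 (l, \<rho>, h) = Some (l + 4, \<rho>(14 := \<rho> 12), h)"
      using l null \<open>\<rho> 12 \<noteq> Null\<close> \<open>\<rho> 13 \<noteq> Null\<close> by (auto simp: steps_simps)
    show ?thesis
    proof (rule safe_simple_steps[OF steps], rule safe_new[where r = 14])
      show "l + 4 < length search_program" "search_program ! (l + 4) = New 14"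
        using l by (auto simp: search_program_def)
      fix a assume a: "m \<le> a" "a \<notin> dom h"
      let ?f = "(\<lambda>_. Null)(0 := Integer 1, 3 := \<rho> 12, 4 := \<rho> 13)"
      let ?h = "h(a \<mapsto> ?f)"
      let ?\<rho> = "\<rho>(14 := Ptr a, 3 := Integer 1)"
      let ?D = "Some (Branch a T U)"
      have steps: "simple_steps m search_program 4
          (Suc (l + 4), \<rho>(14 := \<rho> 12, 14 := Ptr a), h(a \<mapsto> (\<lambda>_. Null))) = Some (l + 9, ?\<rho>, ?h)"
        using l a by (auto simp: steps_simps)
      have le: "h \<subseteq>\<^sub>m ?h" using a by (auto simp: map_le_def)
      have T: "bbt_in h (\<rho> 12) T" and U: "bbt_in h (\<rho> 13) U"
        using B C \<open>B = Some T\<close> \<open>C = Some U\<close> by auto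
      have "safe search_program m E K Q (l + 9) ?\<rho> ?h Map.empty (d + 9) (k + 9)"
      proof (rule cont[where D = ?D])
        show "batch_in ?h (?\<rho> 14) ?D"
          using bbt_in_keeps[OF T keeps_map_le[OF le]] bbt_in_keeps[OF U keeps_map_le[OF le]] by simp
        show "distinct (batch_addrs ?D)"
          using dist \<open>B = Some T\<close> \<open>C = Some U\<close> a bbt_in_dom[OF T] bbt_in_dom[OF U] by auto
      qed (use le a \<open>B = Some T\<close> \<open>C = Some U\<close> in auto)
      then show "safe search_program m E K Q (Suc (l + 4)) (\<rho>(14 := \<rho> 12, 14 := Ptr a))
          (h(a \<mapsto> (\<lambda>_. Null))) Map.empty (Suc (d + 4)) (Suc (k + 4))"
        by (intro safe_simple_steps[OF steps]) (simp add: eval_nat_numeral)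
    qed (use bounds in auto)
  qed
qed

text \<open>
  The parts are returned in the cells 7 and 8 of the root of the batch, which the input leaves unused.
\<close>

definition split_at :: "'a::linorder \<Rightarrow> 'a val \<Rightarrow> 'a bbt \<Rightarrow> 'a frag \<Rightarrow> bool" where
  "split_at k p T h \<longleftrightarrow>
     (\<exists>a g B C. p = Ptr a \<and> h a = Some g \<and> batch_in h (g 7) B \<and> batch_in h (g 8) C \<and>
        distinct (batch_addrs B @ batch_addrs C) \<and>
        batch_queries B = filter (\<lambda>q. snd q \<le> k) (bbt_queries T) \<and>
        batch_queries C = filter (\<lambda>q. k < snd q) (bbt_queries T) \<and>
        batch_height B \<le> bbt_height T \<and> batch_height C \<le> bbt_height T)"

text \<open>A branch takes at most 38 instructions of its own, including two merges at 9 units each,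
  and a query takes 9; the factor 60 covers both.\<close>

lemma safe_split:
  fixes T :: "'a::linorder bbt"
  assumes "bbt_in h (\<rho> 1) T" "distinct (bbt_addrs T)" "\<rho> 5 = Item k"
  shows "safe search_program m (60 * (bbt_height T + 1)) (60 * length (bbt_addrs T))
    (split_at k (\<rho> 1) T) 47 \<rho> h Map.empty 0 0"
  using assms
proof (induction T arbitrary: \<rho> h)
  case (Query a x)
  then obtain g where g: "\<rho> 1 = Ptr a" "h a = Some g" "g 0 = Integer 0" "g 2 = Item x" by auto
  \<comment> \<open>The query node itself becomes one of the parts, so its cell 7 or 8 points back
    to it. In this way later tags reach the original batch.\<close>
  let ?B = "if k < x then None else Some (Query a x)"
  let ?C = "if k < x then Some (Query a x) else None"
  let ?f = "if k < x then g(7 := Null, 8 := Ptr a) else g(7 := Ptr a, 8 := Null)"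
  have "\<exists>\<rho>' l. simple_steps m search_program 8 (47, \<rho>, h) = Some (l, \<rho>', h(a \<mapsto> ?f)) \<and>
      (l = 89 \<or> l = 92)"
    using g Query.prems(3) by (simp add: steps_simps fun_upd_twist)
  then obtain \<rho>' l where steps:
      "simple_steps m search_program 8 (47, \<rho>, h) = Some (l, \<rho>', h(a \<mapsto> ?f))"
    and l: "l = 89 \<or> l = 92" by blast
  show ?case
  proof (rule safe_simple_steps[OF steps], rule safe_halt)
    show "split_at k (\<rho> 1) (Query a x) (h(a \<mapsto> ?f))"
      unfolding split_at_def
      by (rule exI[of _ a], rule exI[of _ ?f], rule exI[of _ ?B], rule exI[of _ ?C]) (use g in auto)
  qed (use l in \<open>auto simp: search_program_def\<close>)
next
  case (Branch a l r)
  let ?T = "Branch a l r"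
  let ?E = "60 * (bbt_height ?T + 1)" and ?K = "60 * length (bbt_addrs ?T)"
  let ?El = "60 * (bbt_height l + 1)" and ?Er = "60 * (bbt_height r + 1)"
  let ?Kl = "60 * length (bbt_addrs l)" and ?Kr = "60 * length (bbt_addrs r)"
  obtain g where g: "\<rho> 1 = Ptr a" "h a = Some g" "g 0 = Integer 1"
    and in_h: "bbt_in h (g 3) l" "bbt_in h (g 4) r" using Branch.prems by auto
  have "\<exists>\<rho>'. simple_steps m search_program 8 (47, \<rho>, h) = Some (55, \<rho>', h) \<and>
      \<rho>' 1 = g 3 \<and> \<rho>' 2 = Null \<and> \<rho>' 5 = \<rho> 5 \<and> \<rho>' 7 = g 3 \<and> \<rho>' 8 = g 4 \<and> \<rho>' 9 = Ptr a"
    using g by (simp add: steps_simps)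
  then obtain \<rho>' where steps: "simple_steps m search_program 8 (47, \<rho>, h) = Some (55, \<rho>', h)"
    and \<rho>': "\<rho>' 1 = g 3" "\<rho>' 2 = Null" "\<rho>' 5 = Item k" "\<rho>' 7 = g 3" "\<rho>' 8 = g 4" "\<rho>' 9 = Ptr a"
    using Branch.prems(3) by auto
  show ?case
  proof (rule safe_simple_steps[OF steps],
      rule safe_par[where A = "set (bbt_addrs l)" and B = "set (bbt_addrs r)" and n = 1
        and r = 10 and r' = 11 and lx = 47 and lm = 57 and ly = 47 and \<rho>' = "\<rho>'(1 := g 4)"])
    show "safe search_program m ?El ?Kl (split_at k (g 3) l) 47 \<rho>' (h |` set (bbt_addrs l))
        Map.empty 0 0"
      unfolding \<rho>'(1)[symmetric]
      by (rule Branch.IH) (use Branch.prems \<rho>' bbt_in_keeps[OF in_h(1)] keeps_restrict in auto)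
    show "safe search_program m ?Er ?Kr (split_at k (g 4) r) 47 (\<rho>'(1 := g 4, 10 := Thread u))
        (h |` set (bbt_addrs r)) Map.empty 0 0" for u
    proof -
      let ?\<rho> = "\<rho>'(1 := g 4, 10 := Thread u)"
      have "safe search_program m ?Er ?Kr (split_at k (?\<rho> 1) r) 47 ?\<rho>
          (h |` set (bbt_addrs r)) Map.empty 0 0"
        by (rule Branch.IH) (use Branch.prems \<rho>' bbt_in_keeps[OF in_h(2)] keeps_restrict in auto)
      then show ?thesis by simp
    qed
    show "simple_steps m search_program 1
        (Suc 55, \<rho>'(10 := Thread u), h |` (- set (bbt_addrs l))) =
        Some (57, \<rho>'(1 := g 4, 10 := Thread u), h |` (- set (bbt_addrs l)))" for u
      using \<rho>' by (simp add: steps_simps fun_upd_twist)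
  next
    fix u v h1 h2 h3
    let ?rest = "h |` (- (set (bbt_addrs l) \<union> set (bbt_addrs r)))"
    let ?d = "0 + 8 + 1 + 4 + max ?El ?Er" and ?k = "0 + 8 + 1 + 4 + ?Kl + ?Kr"
    let ?\<rho> = "\<rho>'(1 := g 4, 10 := Thread u, 11 := Thread v)"
    assume split: "split_at k (g 3) l h1" "split_at k (g 4) r h2"
      and disj: "dom h1 \<inter> dom h2 = {}" "dom h1 \<inter> dom ?rest = {}" "dom h2 \<inter> dom ?rest = {}"
      and le: "h1 \<subseteq>\<^sub>m h3" "h2 \<subseteq>\<^sub>m h3" "?rest \<subseteq>\<^sub>m h3"
    obtain b f B C where l: "g 3 = Ptr b" "h1 b = Some f" "batch_in h1 (f 7) B"
        "batch_in h1 (f 8) C" "distinct (batch_addrs B @ batch_addrs C)"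
        "batch_queries B = filter (\<lambda>q. snd q \<le> k) (bbt_queries l)"
        "batch_queries C = filter (\<lambda>q. k < snd q) (bbt_queries l)"
        "batch_height B \<le> bbt_height l" "batch_height C \<le> bbt_height l"
      using split(1) unfolding split_at_def by blast
    obtain b' f' B' C' where r: "g 4 = Ptr b'" "h2 b' = Some f'" "batch_in h2 (f' 7) B'"
        "batch_in h2 (f' 8) C'" "distinct (batch_addrs B' @ batch_addrs C')"
        "batch_queries B' = filter (\<lambda>q. snd q \<le> k) (bbt_queries r)"
        "batch_queries C' = filter (\<lambda>q. k < snd q) (bbt_queries r)"
        "batch_height B' \<le> bbt_height r" "batch_height C' \<le> bbt_height r"
      using split(2) unfolding split_at_def by blast
    have dom1: "set (batch_addrs B) \<subseteq> dom h1" "set (batch_addrs C) \<subseteq> dom h1"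
      and dom2: "set (batch_addrs B') \<subseteq> dom h2" "set (batch_addrs C') \<subseteq> dom h2"
      using l(3,4) r(3,4) by (simp_all add: batch_in_dom)
    \<comment> \<open>The results of the two recursive calls lie in the disjoint memories returned
      by the two children.\<close>
    have cross: "set (batch_addrs B) \<inter> set (batch_addrs B') = {}"
        "set (batch_addrs B) \<inter> set (batch_addrs C') = {}"
        "set (batch_addrs C) \<inter> set (batch_addrs B') = {}"
        "set (batch_addrs C) \<inter> set (batch_addrs C') = {}"
      using dom1 dom2 disj(1) by blast+
    have a: "?rest a = Some g" using g(2) Branch.prems(2) by auto
    then have h3: "h3 a = Some g" "h3 b = Some f" "h3 b' = Some f'"
      using le l(2) r(2) by (metis domI map_le_def)+
    have "a \<in> dom ?rest" "b \<in> dom h1" "b' \<in> dom h2" using a l(2) r(2) by blast+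
    then have neq: "a \<noteq> b" "a \<noteq> b'" using disj by blast+
    have dom3: "dom h1 \<subseteq> dom h3" "dom h2 \<subseteq> dom h3" using le by (simp_all add: map_le_implies_dom_le)
    have "\<exists>\<rho>2. simple_steps m search_program 2 (60, ?\<rho>, h3) = Some (62, \<rho>2, h3) \<and>
        \<rho>2 2 = Null \<and> \<rho>2 7 = Ptr b \<and> \<rho>2 8 = Ptr b' \<and> \<rho>2 9 = Ptr a \<and> \<rho>2 12 = f 7 \<and> \<rho>2 13 = f' 7"
      using \<rho>' h3 l(1) r(1) by (simp add: steps_simps)
    then obtain \<rho>2 where steps2: "simple_steps m search_program 2 (60, ?\<rho>, h3) = Some (62, \<rho>2, h3)"
      and \<rho>2: "\<rho>2 2 = Null" "\<rho>2 7 = Ptr b" "\<rho>2 8 = Ptr b'" "\<rho>2 9 = Ptr a" "\<rho>2 12 = f 7"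
        "\<rho>2 13 = f' 7" by blast
    have "safe search_program m ?E ?K (split_at k (\<rho> 1) ?T) 60 ?\<rho> h3 Map.empty ?d ?k"
    proof (rule safe_simple_steps[OF steps2], rule safe_merge)
      show "batch_in h3 (\<rho>2 12) B" "batch_in h3 (\<rho>2 13) B'"
        using l(3) r(3) le \<rho>2 by (auto intro: batch_in_keeps keeps_map_le)
      show "distinct (batch_addrs B @ batch_addrs B')"
        using l(5) r(5) cross by auto
      fix \<rho>3 h4 D
      assume h4: "h3 \<subseteq>\<^sub>m h4" and D: "batch_in h4 (\<rho>3 14) D"
        "batch_queries D = batch_queries B @ batch_queries B'"
        "set (batch_addrs D) \<subseteq> set (batch_addrs B) \<union> set (batch_addrs B') \<union> - dom h3"
        "distinct (batch_addrs D)" "batch_height D \<le> Suc (max (batch_height B) (batch_height B'))"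
        and "\<And>r. r \<noteq> 3 \<Longrightarrow> r \<noteq> 14 \<Longrightarrow> \<rho>3 r = \<rho>2 r"
      then have \<rho>3: "\<rho>3 2 = Null" "\<rho>3 7 = Ptr b" "\<rho>3 8 = Ptr b'" "\<rho>3 9 = Ptr a"
        using \<rho>2 by auto
      have h4a: "h4 a = Some g" "h4 b = Some f" "h4 b' = Some f'"
        using h4 h3 by (metis domI map_le_def)+
      let ?g = "g(7 := \<rho>3 14)"
      let ?h5 = "h4(a \<mapsto> ?g)"
      have "\<exists>\<rho>4. simple_steps m search_program 3 (71, \<rho>3, h4) = Some (74, \<rho>4, ?h5) \<and>
          \<rho>4 2 = Null \<and> \<rho>4 9 = Ptr a \<and> \<rho>4 12 = f 8 \<and> \<rho>4 13 = f' 8"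
        using \<rho>3 h4a neq by (simp add: steps_simps)
      then obtain \<rho>4 where steps4: "simple_steps m search_program 3 (71, \<rho>3, h4) = Some (74, \<rho>4, ?h5)"
        and \<rho>4: "\<rho>4 2 = Null" "\<rho>4 9 = Ptr a" "\<rho>4 12 = f 8" "\<rho>4 13 = f' 8" by blast
      have keeps5: "keeps S h4 ?h5" for S using h4a by (auto intro: keeps_upd)
      have "safe search_program m ?E ?K (split_at k (\<rho> 1) ?T) 71 \<rho>3 h4 Map.empty
          (?d + 2 + 9) (?k + 2 + 9)"
      proof (rule safe_simple_steps[OF steps4], rule safe_merge)
        show "batch_in ?h5 (\<rho>4 12) C" "batch_in ?h5 (\<rho>4 13) C'"
          using l(4) r(4) le h4 \<rho>4 keeps5
          by (auto intro: batch_in_keeps[OF _ keeps_trans[OF keeps_map_le[OF map_le_trans]]])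
        show "distinct (batch_addrs C @ batch_addrs C')"
          using l(5) r(5) cross by auto
        fix \<rho>5 h6 D'
        assume h6: "?h5 \<subseteq>\<^sub>m h6" and D': "batch_in h6 (\<rho>5 14) D'"
          "batch_queries D' = batch_queries C @ batch_queries C'"
          "set (batch_addrs D') \<subseteq> set (batch_addrs C) \<union> set (batch_addrs C') \<union> - dom ?h5"
          "distinct (batch_addrs D')" "batch_height D' \<le> Suc (max (batch_height C) (batch_height C'))"
          and "\<And>r. r \<noteq> 3 \<Longrightarrow> r \<noteq> 14 \<Longrightarrow> \<rho>5 r = \<rho>4 r"
        then have \<rho>5: "\<rho>5 9 = Ptr a" using \<rho>4 by auto
        have h6a: "h6 a = Some ?g"
          using h6 by (metis domI fun_upd_same map_le_def)
        let ?g' = "?g(8 := \<rho>5 14)"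
        let ?h7 = "h6(a \<mapsto> ?g')"
        have steps6: "simple_steps m search_program 1 (83, \<rho>5, h6) = Some (84, \<rho>5, ?h7)"
          using \<rho>5 h6a by (simp add: steps_simps)
        have keeps7: "keeps S h6 ?h7" for S using h6a by (auto intro: keeps_upd)
        have "split_at k (\<rho> 1) ?T ?h7"
          unfolding split_at_def
        proof (rule exI[of _ a], rule exI[of _ ?g'], rule exI[of _ D], rule exI[of _ D'], intro conjI)
          show "batch_in ?h7 (?g' 7) D"
            using batch_in_keeps[OF D(1) keeps_trans[OF keeps5 keeps_trans[OF keeps_map_le[OF h6] keeps7]]]
            by simp
          show "batch_in ?h7 (?g' 8) D'"
            using batch_in_keeps[OF D'(1) keeps7] by simp
          \<comment> \<open>A node added by the first merge lies outside \<open>h3\<close>, which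
            contains \<open>C\<close> and \<open>C'\<close>; one added by the second lies outside
            \<open>?h5\<close>, which contains \<open>D\<close>. So the two results are
            disjoint.\<close>
          have "set (batch_addrs D) \<subseteq> dom ?h5" using batch_in_dom[OF D(1)] by auto
          moreover have "set (batch_addrs B) \<inter> set (batch_addrs C) = {}"
            "set (batch_addrs B') \<inter> set (batch_addrs C') = {}"
            "set (batch_addrs C) \<subseteq> dom h3" "set (batch_addrs C') \<subseteq> dom h3"
            using l(5) r(5) dom1 dom2 dom3 by auto
          then have "set (batch_addrs C) \<inter> set (batch_addrs D) = {}"
            "set (batch_addrs C') \<inter> set (batch_addrs D) = {}"
            using D(3) cross by blast+
          ultimately show "distinct (batch_addrs D @ batch_addrs D')"
            using D(4) D'(3,4) by auto
          show "batch_height D \<le> bbt_height ?T" "batch_height D' \<le> bbt_height ?T"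
            using D(5) D'(5) l(8,9) r(8,9) by auto
        qed (use g D(2) D'(2) l(6,7) r(6,7) in auto)
        then show "safe search_program m ?E ?K (split_at k (\<rho> 1) ?T) (74 + 9) \<rho>5 h6 Map.empty
            (?d + 2 + 9 + 3 + 9) (?k + 2 + 9 + 3 + 9)"
          by (simp del: bbt_addrs.simps bbt_height.simps,
              intro safe_simple_steps[OF steps6] safe_halt) (auto simp: search_program_def)
      qed (use \<rho>4 in auto)
      then show "safe search_program m ?E ?K (split_at k (\<rho> 1) ?T) (62 + 9) \<rho>3 h4 Map.empty
          (?d + 2 + 9) (?k + 2 + 9)"
        by simp
    qed (use \<rho>2 in auto)
    then show "safe search_program m ?E ?K (split_at k (\<rho> 1) ?T) (Suc (Suc (Suc 57))) ?\<rho> h3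
        Map.empty ?d ?k"
      by simp
  qed (use Branch.prems in \<open>auto simp: search_program_def\<close>)
qed

section \<open>Searching\<close>

fun rbt_height :: "'a rbt \<Rightarrow> nat" where
  "rbt_height (RB_Leaf a x) = 0"
| "rbt_height (RB_Node a c k l r) = Suc (max (rbt_height l) (rbt_height r))"

lemma map_leD: "f \<subseteq>\<^sub>m g \<Longrightarrow> f a = Some b \<Longrightarrow> g a = Some b"
  by (metis domI map_le_def)

text \<open>Shared by the leaves of the search tree and the empty set, which both enter at label 23.
  The forked thread starts at depth and work 0, the form in which \<open>safe_tag\<close> is
  proved.\<close>

lemma safe_call_tag:
  fixes T :: "'a::linorder bbt"
  assumes T: "bbt_in h (\<rho> 1) T" "distinct (bbt_addrs T)"
    and ls: "ls = [] \<and> \<rho> 5 = Null \<or> (\<exists>l y. ls = [(l, y)] \<and> \<rho> 0 = Ptr l \<and> \<rho> 5 = Item y)"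
    and bounds: "d + 20 * (bbt_height T + 1) + 2 < E" "k + 20 * length (bbt_addrs T) + 2 < K"
  shows "safe search_program m E K (tagged_in ls (bbt_queries T)) 23 \<rho> h Map.empty d k"
proof (rule safe_call[where r = 6 and l' = 26 and A = "set (bbt_addrs T)"])
  show "safe search_program m (20 * (bbt_height T + 1)) (20 * length (bbt_addrs T))
      (tagged_in ls (bbt_queries T)) 26 \<rho> (h |` set (bbt_addrs T)) Map.empty 0 0"
    by (rule safe_tag) (use assms bbt_in_keeps[OF T(1)] keeps_restrict in auto)
  fix u h' h'' assume "tagged_in ls (bbt_queries T) h'" "h' \<subseteq>\<^sub>m h''"
  then have "tagged_in ls (bbt_queries T) h''" by (rule tagged_in_map_le)
  then show "safe search_program m E K (tagged_in ls (bbt_queries T)) (Suc (Suc 23))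
      (\<rho>(6 := Thread u)) h'' Map.empty (d + 2 + 20 * (bbt_height T + 1))
      (k + 2 + 20 * length (bbt_addrs T))"
    by (intro safe_halt) (use bounds in \<open>auto simp: search_program_def\<close>)
qed (use bounds in \<open>auto simp: search_program_def\<close>)

text \<open>The key separates the leaves, so a query on one side of it cannot occur among the leaves
  on the other side, and its tag with respect to its own side is correct for both.\<close>

lemma tagged_in_split:
  fixes k :: "'a::linorder"
  assumes "\<forall>x\<in>snd ` set ls. x \<le> k" "\<forall>x\<in>snd ` set ls'. k < x"
    and "tagged_in ls (filter (\<lambda>q. snd q \<le> k) qs) h" "tagged_in ls' (filter (\<lambda>q. k < snd q) qs) h"
  shows "tagged_in (ls @ ls') qs h"
  unfolding tagged_in_def
proof clarify
  fix a x assume q: "(a, x) \<in> set qs"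
  show "\<exists>f. h a = Some f \<and> item_tagged (ls @ ls') x f"
  proof (cases "x \<le> k")
    case True
    then have "x \<notin> snd ` set ls'" using assms(2) by (meson leD)
    then have "item_tagged (ls @ ls') x f \<longleftrightarrow> item_tagged ls x f" for f
      by (auto simp: item_tagged_def rev_image_eqI)
    then show ?thesis using assms(3) q True by (auto simp: tagged_in_def)
  next
    case False
    then have "x \<notin> snd ` set ls" using assms(1) by blast
    then have "item_tagged (ls @ ls') x f \<longleftrightarrow> item_tagged ls' x f" for f
      by (auto simp: item_tagged_def rev_image_eqI)
    then show ?thesis using assms(4) q False by (auto simp: tagged_in_def not_le)
  qed
qed

text \<open>The height bound \<open>H\<close> stays fixed in the recursion, as parts are never
  higher than the batch they come from. For s queries a split costs at most 60 (H + 1) in span and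
  120 s in work; the factors 100 and 200 absorb this and the constant overhead of a call. The
  summand 10 in the work bound pays for a call with an empty batch. A recursive call always comes
  from a caller with at least one query, whose share of 200 s also covers the two summands 10 of its
  children.\<close>

lemma safe_search:
  fixes R :: "'a::linorder rbt" and B :: "'a bbt option"
  assumes "rbt_in h (\<rho> 0) R" "batch_in h (\<rho> 1) B" "distinct (rbt_addrs R @ batch_addrs B)"
    "routed R" "batch_height B \<le> H"
  shows "safe search_program m (5 + 100 * ((H + 1) * (rbt_height R + 1)))
    (10 + 200 * (length (batch_queries B) * (rbt_height R + 1)))
    (tagged_in (rbt_leaves R) (batch_queries B)) 0 \<rho> h Map.empty 0 0"
  using assms
proof (induction R arbitrary: \<rho> h B)
  case (RB_Leaf l y)
  then obtain f where f: "\<rho> 0 = Ptr l" "h l = Some f" "f 0 = Integer 0" "f 2 = Item y" by auto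
  show ?case
  proof (cases B)
    case None
    have "\<exists>\<rho>'. simple_steps m search_program 2 (0, \<rho>, h) = Some (22, \<rho>', h)"
      using RB_Leaf.prems None by (simp add: steps_simps)
    then obtain \<rho>' where steps: "simple_steps m search_program 2 (0, \<rho>, h) = Some (22, \<rho>', h)"
      by blast
    show ?thesis
      by (rule safe_simple_steps[OF steps], rule safe_halt)
        (use None in \<open>auto simp: search_program_def tagged_in_def\<close>)
  next
    case (Some T)
    then have T: "bbt_in h (\<rho> 1) T" "distinct (bbt_addrs T)" "bbt_height T \<le> H"
      using RB_Leaf.prems by auto
    then have "\<rho> 1 \<noteq> Null" by auto
    then have "\<exists>\<rho>'. simple_steps m search_program 8 (0, \<rho>, h) = Some (23, \<rho>', h) \<and>
        \<rho>' 0 = Ptr l \<and> \<rho>' 1 = \<rho> 1 \<and> \<rho>' 5 = Item y"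
      using f by (simp add: steps_simps)
    then obtain \<rho>' where steps: "simple_steps m search_program 8 (0, \<rho>, h) = Some (23, \<rho>', h)"
      and \<rho>': "\<rho>' 0 = Ptr l" "\<rho>' 1 = \<rho> 1" "\<rho>' 5 = Item y" by blast
    have "safe search_program m (5 + 100 * (H + 1)) (10 + 200 * length (bbt_queries T))
        (tagged_in [(l, y)] (bbt_queries T)) 23 \<rho>' h Map.empty (0 + 8) (0 + 8)"
    proof (rule safe_call_tag)
      show "0 + 8 + 20 * length (bbt_addrs T) + 2 < 10 + 200 * length (bbt_queries T)"
        using length_bbt_addrs[of T] by linarith
    qed (use T \<rho>' in auto)
    then show ?thesis by (intro safe_simple_steps[OF steps]) (simp add: Some)
  qed
next
  case (RB_Node a c k l r)
  let ?R = "RB_Node a c k l r"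
  obtain f where f: "\<rho> 0 = Ptr a" "h a = Some f" "f 0 = Integer 1" "f 2 = Item k"
      "rbt_in h (f 3) l" "rbt_in h (f 4) r"
    using RB_Node.prems by auto
  show ?case
  proof (cases B)
    case None
    have "\<exists>\<rho>'. simple_steps m search_program 2 (0, \<rho>, h) = Some (22, \<rho>', h)"
      using RB_Node.prems None by (simp add: steps_simps)
    then obtain \<rho>' where steps: "simple_steps m search_program 2 (0, \<rho>, h) = Some (22, \<rho>', h)"
      by blast
    show ?thesis
      by (rule safe_simple_steps[OF steps], rule safe_halt)
        (use None in \<open>auto simp: search_program_def tagged_in_def\<close>)
  next
    case (Some T)
    then have T: "bbt_in h (\<rho> 1) T" "distinct (bbt_addrs T)" "bbt_height T \<le> H"
      using RB_Node.prems by auto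
    then have "\<rho> 1 \<noteq> Null" by auto
    then have "\<exists>\<rho>'. simple_steps m search_program 8 (0, \<rho>, h) = Some (8, \<rho>', h) \<and>
        \<rho>' 0 = Ptr a \<and> \<rho>' 1 = \<rho> 1 \<and> \<rho>' 5 = Item k"
      using f by (simp add: steps_simps)
    then obtain \<rho>' where steps: "simple_steps m search_program 8 (0, \<rho>, h) = Some (8, \<rho>', h)"
      and \<rho>': "\<rho>' 0 = Ptr a" "\<rho>' 1 = \<rho> 1" "\<rho>' 5 = Item k" by blast
    define s where "s = length (bbt_queries T)"
    define n where "n = max (rbt_height l) (rbt_height r)"
    let ?Q = "tagged_in (rbt_leaves ?R) (bbt_queries T)"
    let ?E = "5 + 100 * ((H + 1) * (rbt_height ?R + 1))"
    let ?K = "10 + 200 * (s * (rbt_height ?R + 1))"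
    let ?E' = "60 * (bbt_height T + 1)" and ?K' = "60 * length (bbt_addrs T)"
    let ?d = "0 + 8 + 2 + ?E'" and ?k = "0 + 8 + 2 + ?K'"
    have K': "?K' + 60 = 120 * s" "0 < s"
      using length_bbt_addrs[of T] by (auto simp: s_def)
    define p where "p = (H + 1) * (n + 1)"
    define q where "q = s * (n + 1)"
    have EK: "?E = 5 + 100 * p + 100 * (H + 1)" "?K = 10 + 200 * q + 200 * s"
      by (simp_all add: n_def p_def q_def algebra_simps)
    have E': "?E' \<le> 60 * (H + 1)" using T(3) by simp
    have "safe search_program m ?E ?K ?Q 8 \<rho>' h Map.empty (0 + 8) (0 + 8)"
    proof (rule safe_call[where r = 6 and l' = 47 and A = "set (bbt_addrs T)"])
      have "safe search_program m ?E' ?K' (split_at k (\<rho>' 1) T) 47 \<rho>'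
          (h |` set (bbt_addrs T)) Map.empty 0 0"
        by (rule safe_split) (use T \<rho>' bbt_in_keeps[OF T(1)] keeps_restrict in auto)
      then show "safe search_program m ?E' ?K' (split_at k (\<rho> 1) T) 47 \<rho>'
          (h |` set (bbt_addrs T)) Map.empty 0 0"
        unfolding \<rho>'(2) .
      show "0 + 8 + 2 + ?E' < ?E" unfolding EK using E' by simp
      show "0 + 8 + 2 + ?K' < ?K" unfolding EK using K' by simp
      fix u h1 h2
      let ?rest = "h |` (- set (bbt_addrs T))"
      assume split: "split_at k (\<rho> 1) T h1" and disj: "dom h1 \<inter> dom ?rest = {}"
        and le: "h1 \<subseteq>\<^sub>m h2" "?rest \<subseteq>\<^sub>m h2"
      obtain b g C D where g: "\<rho> 1 = Ptr b" "h1 b = Some g" "batch_in h1 (g 7) C"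
        "batch_in h1 (g 8) D" "distinct (batch_addrs C @ batch_addrs D)"
        "batch_queries C = filter (\<lambda>q. snd q \<le> k) (bbt_queries T)"
        "batch_queries D = filter (\<lambda>q. k < snd q) (bbt_queries T)"
        "batch_height C \<le> bbt_height T" "batch_height D \<le> bbt_height T"
        using split unfolding split_at_def by blast
      have addrs: "a \<notin> set (bbt_addrs T)" "set (rbt_addrs l) \<inter> set (bbt_addrs T) = {}"
        "set (rbt_addrs r) \<inter> set (bbt_addrs T) = {}"
        using RB_Node.prems Some by auto
      have a: "?rest a = Some f" using f(2) addrs(1) by simp
      have l_rest: "rbt_in ?rest (f 3) l" and r_rest: "rbt_in ?rest (f 4) r"
        using rbt_in_keeps[OF f(5) keeps_restrict[of _ "- set (bbt_addrs T)"]]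
          rbt_in_keeps[OF f(6) keeps_restrict[of _ "- set (bbt_addrs T)"]] addrs by blast+
      have in2: "h2 a = Some f" "h2 b = Some g" "rbt_in h2 (f 3) l" "rbt_in h2 (f 4) r"
        "batch_in h2 (g 7) C" "batch_in h2 (g 8) D"
        using map_leD[OF le(2) a] map_leD[OF le(1) g(2)]
          rbt_in_keeps[OF l_rest keeps_map_le[OF le(2)]]
          rbt_in_keeps[OF r_rest keeps_map_le[OF le(2)]]
          batch_in_keeps[OF g(3) keeps_map_le[OF le(1)]]
          batch_in_keeps[OF g(4) keeps_map_le[OF le(1)]] by blast+
      let ?A = "set (rbt_addrs l) \<union> set (batch_addrs C)"
      let ?B = "set (rbt_addrs r) \<union> set (batch_addrs D)"
      have cross: "set (rbt_addrs l) \<inter> set (batch_addrs C) = {}"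
        "set (rbt_addrs l) \<inter> set (batch_addrs D) = {}"
        "set (rbt_addrs r) \<inter> set (batch_addrs C) = {}"
        "set (rbt_addrs r) \<inter> set (batch_addrs D) = {}"
        using rbt_in_dom[OF l_rest] rbt_in_dom[OF r_rest] batch_in_dom[OF g(3)] batch_in_dom[OF g(4)]
          disj by blast+
      let ?\<rho> = "\<rho>'(6 := Thread u)"
      have "\<exists>\<rho>2. simple_steps m search_program 6 (10, ?\<rho>, h2) = Some (16, \<rho>2, h2) \<and>
          \<rho>2 0 = f 3 \<and> \<rho>2 1 = g 7 \<and> \<rho>2 8 = f 4 \<and> \<rho>2 10 = g 8"
        using \<rho>' in2 g(1) by (simp add: steps_simps)
      then obtain \<rho>2 where steps2: "simple_steps m search_program 6 (10, ?\<rho>, h2) = Some (16, \<rho>2, h2)"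
        and \<rho>2: "\<rho>2 0 = f 3" "\<rho>2 1 = g 7" "\<rho>2 8 = f 4" "\<rho>2 10 = g 8" by blast
      let ?\<rho>3 = "\<rho>2(0 := f 4, 1 := g 8)"
      let ?El = "5 + 100 * ((H + 1) * (rbt_height l + 1))"
      let ?Er = "5 + 100 * ((H + 1) * (rbt_height r + 1))"
      let ?Kl = "10 + 200 * (length (batch_queries C) * (rbt_height l + 1))"
      let ?Kr = "10 + 200 * (length (batch_queries D) * (rbt_height r + 1))"
      have El: "?El \<le> 5 + 100 * p" and Er: "?Er \<le> 5 + 100 * p"
        unfolding p_def n_def by (intro add_left_mono mult_left_mono; simp)+
      \<comment> \<open>No query is lost or doubled, so the work of the two calls together is
        bounded by that for \<open>s\<close> queries and the larger height \<open>n\<close>.\<close>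
      have s: "length (batch_queries C) + length (batch_queries D) = s"
        using sum_length_filter_compl[of "\<lambda>q. snd q \<le> k" "bbt_queries T"]
        by (simp add: g(6,7) s_def not_le)
      have "?Kl + ?Kr = 20 + 200 * (length (batch_queries C) * (rbt_height l + 1) +
          length (batch_queries D) * (rbt_height r + 1))" by simp
      also have "\<dots> \<le> 20 + 200 * (length (batch_queries C) * (n + 1) +
          length (batch_queries D) * (n + 1))"
        unfolding n_def by (intro add_mono mult_left_mono; simp)
      also have "\<dots> = 20 + 200 * q"
        by (simp only: q_def s[symmetric] add_mult_distrib)
      finally have Klr: "?Kl + ?Kr \<le> 20 + 200 * q" .
      have label: "Suc (Suc 8) = (10 :: nat)" by simp
      show "safe search_program m ?E ?K ?Q (Suc (Suc 8)) ?\<rho> h2 Map.empty ?d ?k"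
        unfolding label
      proof (rule safe_simple_steps[OF steps2],
          rule safe_par[where A = ?A and B = ?B and n = 2
            and r = 6 and r' = 7 and lx = 0 and lm = 19 and ly = 0 and \<rho>' = ?\<rho>3])
        show "safe search_program m ?El ?Kl (tagged_in (rbt_leaves l) (batch_queries C)) 0 \<rho>2
            (h2 |` ?A) Map.empty 0 0"
        proof (rule RB_Node.IH)
          show "rbt_in (h2 |` ?A) (\<rho>2 0) l" "batch_in (h2 |` ?A) (\<rho>2 1) C"
            unfolding \<rho>2 using rbt_in_keeps[OF in2(3) keeps_restrict[of _ ?A]]
              batch_in_keeps[OF in2(5) keeps_restrict[of _ ?A]] by simp_all
        qed (use RB_Node.prems g(5,8) T(3) cross in auto)
        show "safe search_program m ?Er ?Kr (tagged_in (rbt_leaves r) (batch_queries D)) 0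
            (?\<rho>3(6 := Thread v)) (h2 |` ?B) Map.empty 0 0" for v
        proof (rule RB_Node.IH)
          show "rbt_in (h2 |` ?B) ((?\<rho>3(6 := Thread v)) 0) r"
            "batch_in (h2 |` ?B) ((?\<rho>3(6 := Thread v)) 1) D"
            using rbt_in_keeps[OF in2(4) keeps_restrict[of _ ?B]]
              batch_in_keeps[OF in2(6) keeps_restrict[of _ ?B]] by simp_all
        qed (use RB_Node.prems g(5,9) T(3) cross in auto)
        show "simple_steps m search_program 2 (Suc 16, \<rho>2(6 := Thread v), h2 |` (- ?A)) =
            Some (19, ?\<rho>3(6 := Thread v), h2 |` (- ?A))" for v
          using \<rho>2 by (simp add: steps_simps fun_upd_twist)
        show "?A \<inter> ?B = {}"
          using RB_Node.prems(3) g(5) cross by auto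
      next
        fix v w h3 h4 h5
        assume tagged: "tagged_in (rbt_leaves l) (batch_queries C) h3"
            "tagged_in (rbt_leaves r) (batch_queries D) h4"
          and le: "h3 \<subseteq>\<^sub>m h5" "h4 \<subseteq>\<^sub>m h5"
        have "?Q h5"
          using tagged_in_split tagged_in_map_le[OF tagged(1) le(1)]
            tagged_in_map_le[OF tagged(2) le(2)] g(6,7) RB_Node.prems(4) by auto
        then show "safe search_program m ?E ?K ?Q (Suc (Suc (Suc 19)))
            (?\<rho>3(6 := Thread v, 7 := Thread w)) h5 Map.empty
            (?d + 6 + 2 + 4 + max ?El ?Er) (?k + 6 + 2 + 4 + ?Kl + ?Kr)"
        proof (intro safe_halt)
          show "?d + 6 + 2 + 4 + max ?El ?Er < ?E" unfolding EK using E' El Er by simp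
          show "?k + 6 + 2 + 4 + ?Kl + ?Kr < ?K" unfolding EK using K' Klr by simp
        qed (auto simp: search_program_def)
      next
        show "?d + 6 + 2 + 4 + max ?El ?Er < ?E" unfolding EK using E' El Er by simp
        show "?k + 6 + 2 + 4 + ?Kl + ?Kr < ?K" unfolding EK using K' Klr by simp
      qed (auto simp: search_program_def)
    qed (auto simp: search_program_def)
    then show ?thesis
      by (intro safe_simple_steps[OF steps]) (simp add: Some s_def)
  qed
qed

section \<open>Heights\<close>

lemma leaf_depths_nonempty: "leaf_depths t \<noteq> {}"
  by (induction t) auto

lemma Suc_image_eq_singleton: "Suc ` A = {d} \<Longrightarrow> \<exists>d'. d = Suc d' \<and> A = {d'}"
  by (cases d) (auto simp: set_eq_iff image_iff)

text \<open>A node of the 2-3 tree accounts for at most two levels of the red-black tree, a black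
  node and a red child, hence the factor 2. At least two children per inner node give
  \<open>2 ^ d\<close> leaves.\<close>

lemma encodes_height:
  assumes "encodes t R" "leaf_depths t = {d}"
  shows "rbt_height R \<le> 2 * d \<and> 2 ^ d \<le> length (rbt_leaves R)"
  using assms
proof (induction arbitrary: d rule: encodes.induct)
  case (2 s s' t t' a k)
  obtain d' where d: "d = Suc d'" "leaf_depths s \<union> leaf_depths t = {d'}"
    using Suc_image_eq_singleton 2 by (metis leaf_depths.simps(2))
  then have "leaf_depths s = {d'}" "leaf_depths t = {d'}"
    using leaf_depths_nonempty by (metis Un_singleton_iff)+
  then show ?case using "2.IH"(1)[of d'] "2.IH"(2)[of d'] d by auto
next
  case (3 s s' t t' u u' a k a' k')
  obtain d' where d: "d = Suc d'" "leaf_depths s \<union> leaf_depths t \<union> leaf_depths u = {d'}"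
    using Suc_image_eq_singleton 3 by (metis leaf_depths.simps(3))
  then have "leaf_depths s = {d'}" "leaf_depths t = {d'}" "leaf_depths u = {d'}"
    using leaf_depths_nonempty by (metis Un_empty Un_singleton_iff)+
  then show ?case using "3.IH"(1)[of d'] "3.IH"(2)[of d'] "3.IH"(3)[of d'] d by auto
next
  case (4 s s' t t' u u' a k a' k')
  obtain d' where d: "d = Suc d'" "leaf_depths s \<union> leaf_depths t \<union> leaf_depths u = {d'}"
    using Suc_image_eq_singleton 4 by (metis leaf_depths.simps(3))
  then have "leaf_depths s = {d'}" "leaf_depths t = {d'}" "leaf_depths u = {d'}"
    using leaf_depths_nonempty by (metis Un_empty Un_singleton_iff)+
  then show ?case using "4.IH"(1)[of d'] "4.IH"(2)[of d'] "4.IH"(3)[of d'] d by auto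
qed auto

text \<open>As for AVL trees, a root of height h + 1 has subtrees of heights h and at least h - 1.
  The resulting Fibonacci-like recurrence is used only in the weaker form that two more levels
  double the number of leaves.\<close>

lemma bbt_height: "is_bbt T \<Longrightarrow> 2 ^ (bbt_height T div 2) \<le> length (bbt_queries T)"
proof (induction T)
  case (Branch a l r)
  define h where "h = max (bbt_height l) (bbt_height r)"
  \<comment> \<open>For odd \<open>h\<close> the summands are equal and this is an equality; for
    even \<open>h\<close> the first summand alone is enough.\<close>
  have pow: "2 ^ (Suc h div 2) \<le> (2::nat) ^ (h div 2) + 2 ^ ((h - 1) div 2)"
  proof (cases "even h")
    case False
    then obtain i where "h = 2 * i + 1" by (elim oddE)
    then show ?thesis by simp
  qed simp
  have mono: "(2::nat) ^ (i div 2) \<le> 2 ^ (j div 2)" if "i \<le> j" for i j :: nat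
    using that by (intro power_increasing div_le_mono) auto
  have "(2::nat) ^ (h div 2) + 2 ^ ((h - 1) div 2) \<le>
      2 ^ (bbt_height l div 2) + 2 ^ (bbt_height r div 2)"
  proof (cases "bbt_height r \<le> bbt_height l")
    case True
    then have "h = bbt_height l" "h - 1 \<le> bbt_height r" using Branch.prems by (auto simp: h_def)
    then show ?thesis using mono[of "h - 1" "bbt_height r"] by simp
  next
    case False
    then have "h = bbt_height r" "h - 1 \<le> bbt_height l" using Branch.prems by (auto simp: h_def)
    then show ?thesis using mono[of "h - 1" "bbt_height l"] by simp
  qed
  with pow Branch show ?case by (simp add: h_def)
qed simp

definition set_height :: "'a rbt option \<Rightarrow> nat" where
  "set_height R = (case R of None \<Rightarrow> 0 | Some t \<Rightarrow> rbt_height t)"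

text \<open>For \<open>n = 0\<close> and \<open>b = 0\<close> the following two lemmas rely on \<open>log 2 0 = 0\<close>.\<close>

lemma set_height_le:
  assumes "stored_set h p R" "n = length (set_leaves R)"
  shows "real (set_height R) \<le> 2 * log 2 (real n)" "0 \<le> log 2 (real n)"
proof -
  have "real (set_height R) \<le> 2 * log 2 (real n) \<and> 0 \<le> log 2 (real n)"
  proof (cases R)
    case (Some t)
    then obtain u d where "encodes u t" "leaf_depths u = {d}"
      using assms(1) by (auto simp: stored_set_def is_rb_encoding_def is_23_tree_def)
    then have d: "rbt_height t \<le> 2 * d" "2 ^ d \<le> n"
      using encodes_height assms(2) Some by (auto simp: set_leaves_def)
    have "0 < n" using d(2) by (rule less_le_trans[rotated]) simp
    moreover have "real d \<le> log 2 (real n)"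
      using le_log2_of_power[OF d(2)] .
    ultimately show ?thesis using d(1) Some by (simp add: set_height_def)
  qed (use assms in \<open>simp add: set_height_def set_leaves_def log_def\<close>)
  then show "real (set_height R) \<le> 2 * log 2 (real n)" "0 \<le> log 2 (real n)" by auto
qed

lemma batch_height_le:
  assumes "stored_batch h q B" "b = length (batch_queries B)"
  shows "real (batch_height B) \<le> 2 * log 2 (real b) + 1" "0 \<le> log 2 (real b)"
proof -
  have "real (batch_height B) \<le> 2 * log 2 (real b) + 1 \<and> 0 \<le> log 2 (real b)"
  proof (cases B)
    case (Some T)
    then have le: "2 ^ (bbt_height T div 2) \<le> b"
      using assms bbt_height[of T] by (auto simp: stored_batch_def)
    have "0 < b" using le by (rule less_le_trans[rotated]) simp
    moreover have "real (bbt_height T div 2) \<le> log 2 (real b)"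
      using le_log2_of_power[OF le] .
    moreover have "real (bbt_height T) \<le> 2 * real (bbt_height T div 2) + 1" by linarith
    ultimately show ?thesis using Some by simp
  qed (use assms in \<open>simp add: log_def\<close>)
  then show "real (batch_height B) \<le> 2 * log 2 (real b) + 1" "0 \<le> log 2 (real b)" by auto
qed

section \<open>The whole memory\<close>

text \<open>The initial thread owns every memory node that exists at the start, with all its
  cells.\<close>

definition frag_of :: "'a heap \<Rightarrow> addr \<Rightarrow> 'a frag" where
  "frag_of h m = (\<lambda>a. if a < m then Some (\<lambda>i. h (a, i)) else None)"

lemma rbt_at_frag: "rbt_at h p R \<Longrightarrow> \<forall>a\<in>set (rbt_addrs R). a < m \<Longrightarrow> rbt_in (frag_of h m) p R"
  by (induction R arbitrary: p) (auto simp: frag_of_def)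

lemma bbt_at_frag: "bbt_at h p T \<Longrightarrow> \<forall>a\<in>set (bbt_addrs T). a < m \<Longrightarrow> bbt_in (frag_of h m) p T"
  by (induction T arbitrary: p) (auto simp: frag_of_def)

lemma rbt_at_cong:
  "rbt_at h p R \<Longrightarrow> \<forall>a\<in>set (rbt_addrs R). \<forall>i<5. h' (a, i) = h (a, i) \<Longrightarrow> rbt_at h' p R"
  by (induction R arbitrary: p) auto

lemma bbt_at_cong:
  "bbt_at h p T \<Longrightarrow> \<forall>a\<in>set (bbt_addrs T). \<forall>i<5. h' (a, i) = h (a, i) \<Longrightarrow> bbt_at h' p T"
  by (induction T arbitrary: p) auto

lemma safe_search_memory:
  fixes R :: "'a::linorder rbt option"
  assumes R: "stored_set h p R" and B: "stored_batch h q B" and sep: "separate m R B"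
  shows "safe search_program m (5 + 100 * ((batch_height B + 1) * (set_height R + 1)))
    (10 + 200 * (length (batch_queries B) * (set_height R + 1)))
    (tagged_in (set_leaves R) (batch_queries B)) 0 (input_regs p q) (frag_of h m) Map.empty 0 0"
proof -
  have batch: "batch_in (frag_of h m) (input_regs p q 1) B"
    using B sep
    by (cases B) (auto simp: stored_batch_def separate_def Let_def input_regs_def intro: bbt_at_frag)
  show ?thesis
  proof (cases R)
    case (Some t)
    have "rbt_in (frag_of h m) (input_regs p q 0) t"
      using R sep Some
      by (auto simp: stored_set_def separate_def Let_def input_regs_def intro: rbt_at_frag)
    moreover have "distinct (rbt_addrs t @ batch_addrs B)"
      using sep Some by (cases B) (auto simp: separate_def Let_def)
    ultimately show ?thesis
      using safe_search[where R = t and H = "batch_height B" and B = B and h = "frag_of h m" and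
          \<rho> = "input_regs p q"] batch R Some
      by (simp add: set_height_def set_leaves_def stored_set_def is_rb_encoding_def)
  next
    case None
    then have p: "input_regs p q 0 = Null" using R by (simp add: stored_set_def input_regs_def)
    show ?thesis
    proof (cases B)
      case None
      then have "input_regs p q 1 = Null" using B by (simp add: stored_batch_def input_regs_def)
      then have "\<exists>\<rho>. simple_steps m search_program 2 (0, input_regs p q, frag_of h m) =
          Some (22, \<rho>, frag_of h m)"
        by (simp add: steps_simps)
      then obtain \<rho> where steps: "simple_steps m search_program 2
          (0, input_regs p q, frag_of h m) = Some (22, \<rho>, frag_of h m)" by blast
      show ?thesis
        by (rule safe_simple_steps[OF steps], rule safe_halt)
          (use None in \<open>auto simp: search_program_def tagged_in_def\<close>)
    next
      case (Some T)
      then have T: "bbt_in (frag_of h m) (input_regs p q 1) T" "distinct (bbt_addrs T)"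
        using batch sep by (auto simp: separate_def Let_def)
      then have "input_regs p q 1 \<noteq> Null" by auto
      then have "\<exists>\<rho>. simple_steps m search_program 4 (0, input_regs p q, frag_of h m) =
          Some (23, \<rho>, frag_of h m) \<and> \<rho> 1 = input_regs p q 1 \<and> \<rho> 5 = Null"
        using p by (simp add: steps_simps)
      then obtain \<rho> where steps: "simple_steps m search_program 4
          (0, input_regs p q, frag_of h m) = Some (23, \<rho>, frag_of h m)"
        and \<rho>: "\<rho> 1 = input_regs p q 1" "\<rho> 5 = Null" by blast
      have "safe search_program m (5 + 100 * (bbt_height T + 1)) (10 + 200 * length (bbt_queries T))
          (tagged_in [] (bbt_queries T)) 23 \<rho> (frag_of h m) Map.empty (0 + 4) (0 + 4)"
      proof (rule safe_call_tag)
        show "0 + 4 + 20 * length (bbt_addrs T) + 2 < 10 + 200 * length (bbt_queries T)"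
          using length_bbt_addrs[of T] by linarith
      qed (use T \<rho> in auto)
      then show ?thesis
        using \<open>R = None\<close> Some
        by (intro safe_simple_steps[OF steps]) (simp add: set_height_def set_leaves_def)
    qed
  qed
qed

section \<open>Asymptotics\<close>

text \<open>The cost in \<open>safe_search_memory\<close> with the height of the set replaced by its
  bound 2 log n.\<close>

definition work_bound :: "nat \<times> nat \<Rightarrow> real" where
  "work_bound = (\<lambda>(b, n). 10 + 200 * (real b * (2 * log 2 (real n) + 1)))"

text \<open>Likewise, with the height of the batch also replaced by its bound 2 log b + 1.\<close>

definition span_bound :: "nat \<times> nat \<Rightarrow> real" where
  "span_bound = (\<lambda>(b, n). 5 + 100 * ((2 * log 2 (real b) + 2) * (2 * log 2 (real n) + 1)))"

lemma eventually_two_le: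
  "\<forall>\<^sub>F x in at_top \<times>\<^sub>F at_top. (2::nat) \<le> fst x \<and> (2::nat) \<le> snd x"
  using eventually_prodI[OF eventually_ge_at_top[of "2::nat"] eventually_ge_at_top[of "2::nat"]] .

lemma work_bound_bigo:
  "work_bound \<in> O[at_top \<times>\<^sub>F at_top](\<lambda>(b, n). real b * log 2 (real n))"
\<comment> \<open>610 = 10 + 400 + 200: since b and log n are at least 1, each term of the expanded
  bound is at most its coefficient times b log n.\<close>
proof (rule bigoI[where c = 610], rule eventually_mono[OF eventually_two_le])
  fix x :: "nat \<times> nat" assume "2 \<le> fst x \<and> 2 \<le> snd x"
  then obtain b n where x: "x = (b, n)" and b: "1 \<le> real b" and n: "1 \<le> log 2 (real n)"
    by (cases x) (auto simp: le_log_iff)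
  have "1 * 1 \<le> real b * log 2 (real n)" using b n by (intro mult_mono) auto
  moreover have "real b * 1 \<le> real b * log 2 (real n)" using b n by (intro mult_left_mono) auto
  moreover have "0 \<le> work_bound x" using b n by (simp add: x work_bound_def)
  ultimately show "norm (work_bound x) \<le> 610 * norm (case x of (b, n) \<Rightarrow> real b * log 2 (real n))"
    by (simp add: x work_bound_def algebra_simps)
qed

lemma span_bound_bigo:
  "span_bound \<in> O[at_top \<times>\<^sub>F at_top](\<lambda>(b, n). log 2 (real b) * log 2 (real n))"
\<comment> \<open>1205 = 5 + 400 + 200 + 400 + 200, again the coefficients of the expanded bound,
  since both logarithms are at least 1.\<close>
proof (rule bigoI[where c = 1205], rule eventually_mono[OF eventually_two_le])
  fix x :: "nat \<times> nat" assume "2 \<le> fst x \<and> 2 \<le> snd x"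
  then obtain b n where x: "x = (b, n)" and b: "1 \<le> log 2 (real b)" and n: "1 \<le> log 2 (real n)"
    by (cases x) (auto simp: le_log_iff)
  have "1 * 1 \<le> log 2 (real b) * log 2 (real n)" using b n by (intro mult_mono) auto
  moreover have "log 2 (real b) * 1 \<le> log 2 (real b) * log 2 (real n)"
    using b n by (intro mult_left_mono) auto
  moreover have "1 * log 2 (real n) \<le> log 2 (real b) * log 2 (real n)"
    using b n by (intro mult_right_mono) auto
  moreover have "0 \<le> span_bound x" using b n by (simp add: x span_bound_def)
  ultimately show "norm (span_bound x) \<le>
      1205 * norm (case x of (b, n) \<Rightarrow> log 2 (real b) * log 2 (real n))"
    by (simp add: x span_bound_def algebra_simps)
qed

lemma search_correct:
  fixes R :: "'a::linorder rbt option"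
  assumes R: "stored_set h p R" and B: "stored_batch h q B" and sep: "separate m R B"
    and n: "n = length (set_leaves R)" and b: "b = length (batch_queries B)"
  shows "always_terminates search_program (initial_config h m (input_regs p q))"
    and "complete_execution search_program (initial_config h m (input_regs p q)) c \<Longrightarrow>
      all_terminated c \<and> stored_set (heap c) p R \<and> stored_batch (heap c) q B \<and>
      tagged (heap c) R B \<and> real (dag_work (trace c)) \<le> work_bound (b, n) \<and>
      real (dag_span (trace c)) \<le> span_bound (b, n)"
proof -
  have frag: "\<forall>a f. frag_of h m a = Some f \<longrightarrow> a < m \<and> (\<forall>i. h (a, i) = f i)"
    by (auto simp: frag_of_def split: if_splits)
  note sound = safe_sound[where h = h, OF safe_search_memory[OF R B sep] frag]
  show "always_terminates search_program (initial_config h m (input_regs p q))"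
    by (rule sound)
  assume "complete_execution search_program (initial_config h m (input_regs p q)) c"
  note final = sound(2)[OF this]
  then obtain h' where h': "tagged_in (set_leaves R) (batch_queries B) h'"
      "\<And>a f i. h' a = Some f \<Longrightarrow> heap c (a, i) = f i"
    by blast
  \<comment> \<open>These are the only cells that \<open>rbt_at\<close> and \<open>bbt_at\<close>
    read, so set and batch are still stored at the end.\<close>
  have input: "a < m \<Longrightarrow> i < 5 \<Longrightarrow> heap c (a, i) = h (a, i)" for a i using final by blast
  have "stored_set (heap c) p R"
    using R sep input
    by (cases R) (auto simp: stored_set_def separate_def Let_def intro!: rbt_at_cong[of h])
  moreover have "stored_batch (heap c) q B"
    using B sep input
    by (cases B) (auto simp: stored_batch_def separate_def Let_def intro!: bbt_at_cong[of h])
  moreover have "tagged (heap c) R B"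
    unfolding tagged_def
  proof clarify
    fix a x assume "(a, x) \<in> set (batch_queries B)"
    then obtain f where "h' a = Some f" "item_tagged (set_leaves R) x f"
      using h'(1) by (auto simp: tagged_in_def)
    then show "if x \<in> snd ` set (set_leaves R)
        then heap c (a, 5) = Integer 1 \<and>
          (\<exists>l. (l, x) \<in> set (set_leaves R) \<and> heap c (a, 6) = Ptr l)
        else heap c (a, 5) = Integer 0"
      using h'(2) by (simp add: item_tagged_def)
  qed
  moreover have "real (dag_work (trace c)) \<le> work_bound (b, n)"
  proof -
    have "real (dag_work (trace c)) \<le> real (10 + 200 * (b * (set_height R + 1)))"
      using final b by (intro of_nat_mono) simp
    also have "\<dots> = 10 + 200 * (real b * (real (set_height R) + 1))"
      by (simp add: algebra_simps)
    also have "\<dots> \<le> work_bound (b, n)"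
      using set_height_le(1)[OF R n] by (simp add: work_bound_def mult_left_mono)
    finally show ?thesis .
  qed
  moreover have "real (dag_span (trace c)) \<le> span_bound (b, n)"
  proof -
    have "real (dag_span (trace c)) \<le> real (5 + 100 * ((batch_height B + 1) * (set_height R + 1)))"
      using final by (intro of_nat_mono) blast
    also have "\<dots> = 5 + 100 * ((real (batch_height B) + 1) * (real (set_height R) + 1))"
      by (simp add: algebra_simps)
    also have "\<dots> \<le> 5 + 100 * ((2 * log 2 (real b) + 2) * (2 * log 2 (real n) + 1))"
      using set_height_le[OF R n] batch_height_le[OF B b]
      by (intro add_left_mono mult_left_mono mult_mono) auto
    finally show ?thesis by (simp add: span_bound_def)
  qed
  ultimately show "all_terminated c \<and> stored_set (heap c) p R \<and> stored_batch (heap c) q B \<and>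
      tagged (heap c) R B \<and> real (dag_work (trace c)) \<le> work_bound (b, n) \<and>
      real (dag_span (trace c)) \<le> span_bound (b, n)"
    using final by blast
qed

theorem mainTheorem11:
  shows "\<exists>(P :: program) (W :: nat \<times> nat \<Rightarrow> real) (S :: nat \<times> nat \<Rightarrow> real).
    W \<in> O[at_top \<times>\<^sub>F at_top](\<lambda>(b, n). real b * log 2 (real n)) \<and>
    S \<in> O[at_top \<times>\<^sub>F at_top](\<lambda>(b, n). log 2 (real b) * log 2 (real n)) \<and>
    (\<forall>(h :: 'a::linorder heap) m p q R B b n.
       stored_set h p R \<longrightarrow> stored_batch h q B \<longrightarrow> separate m R B \<longrightarrow>
       n = length (set_leaves R) \<longrightarrow> b = length (batch_queries B) \<longrightarrow>
       always_terminates P (initial_config h m (input_regs p q)) \<and>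
       (\<forall>c. complete_execution P (initial_config h m (input_regs p q)) c \<longrightarrow>
          all_terminated c \<and>
          stored_set (heap c) p R \<and> stored_batch (heap c) q B \<and> tagged (heap c) R B \<and>
          real (dag_work (trace c)) \<le> W (b, n) \<and>
          real (dag_span (trace c)) \<le> S (b, n)))"
  by (rule exI[of _ search_program], rule exI[of _ work_bound], rule exI[of _ span_bound],
      rule conjI[OF work_bound_bigo], rule conjI[OF span_bound_bigo], intro allI impI, rule conjI,
      rule search_correct(1); (assumption | intro allI impI, rule search_correct(2); assumption)?)

end
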